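(* Let $d\ge 2$ be a constant and let $G=(V,\mathcal{E})$ be an implicit (possibly edge-weighted) $(d,c)$-grid graph with $1\le c\le s^{1/d^3}$. For every constant $\alpha\in\left(\max\{\frac{d+1}{d+2},\frac45\},1\right)$ there exists a Las Vegas MPC algorithm with local memory $\Theta(s)\subseteq\Theta(|V|^{\alpha})$ per machine which computes all the connected components (respectively, a minimum spanning forest) of $G$ in $O(1)$ rounds with high probability.
   Context: An implicit graph $G=(V,\mathcal{E})$ consists of a node set $V$, each node carrying $O(1)$ words of information (e.g. coordinates), and an edge formation rule $\mathcal{E}$ (of $O(1)$ words) which, for two distinct nodes, decides from their information whether they are adjacent and, if so, the edge weight. It is an implicit $(d,c)$-grid graph if the resulting explicit graph has nodes in $\mathbb{N}^d$ and every edge $(u,v)$ satisfies $0<\|u-v\|_\infty\le c$. MPC model: input evenly distributed over $m$ machines, each with local memory $\Theta(s)$, $s=|V|^{\alpha}$; synchronous rounds in which each machine sends/receives $O(s)$ words, then computes locally. Las Vegas: never wrong; with high probability: probability $\ge1-1/|V|^{\Omega(1)}$. *)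

theory Defs
  imports "HOL-Probability.Product_PMF"
begin

text \<open>
  A word is a natural number of \<open>O(log n)\<close> bits, where \<open>n\<close> is the number of nodes; the bound on
  its value is imposed separately. A node is identified with its information, a list of words.
  The first \<open>d\<close> words are its coordinates. Writing \<open>sem r u v\<close>, the rule with text \<open>r\<close> says
  whether \<open>u\<close> and \<open>v\<close> are adjacent, and with which weight (\<open>None\<close>: not adjacent). The function
  \<open>sem\<close> plays the role of the language in which edge formation rules are written.
\<close>

type_synonym rule_semantics = "nat list \<Rightarrow> nat list \<Rightarrow> nat list \<Rightarrow> real option"

record implicit_graph =
  nodes :: "nat list set"
  edge_rule :: "nat list"

definition adjacent :: "rule_semantics \<Rightarrow> implicit_graph \<Rightarrow> (nat list \<times> nat list) set" where
  "adjacent sem G =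
     {(u, v). u \<in> nodes G \<and> v \<in> nodes G \<and> u \<noteq> v \<and> sem (edge_rule G) u v \<noteq> None}"

definition edges :: "rule_semantics \<Rightarrow> implicit_graph \<Rightarrow> nat list set set" where
  "edges sem G = {{u, v} | u v. (u, v) \<in> adjacent sem G}"

definition edge_weight :: "rule_semantics \<Rightarrow> implicit_graph \<Rightarrow> nat list set \<Rightarrow> real" where
  "edge_weight sem G e =
     (THE w. \<exists>u v. e = {u, v} \<and> u \<noteq> v \<and> sem (edge_rule G) u v = Some w)"

definition position :: "nat \<Rightarrow> nat list \<Rightarrow> nat list" where
  "position d v = take d v"

definition linf_dist :: "nat \<Rightarrow> nat list \<Rightarrow> nat list \<Rightarrow> nat" where
  "linf_dist d u v = Max ((\<lambda>i. nat \<bar>int (u ! i) - int (v ! i)\<bar>) ` {..<d})"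

text \<open>
  The constants \<open>k\<close> and \<open>K\<close> make the bounds on the input explicit: besides its coordinates, every
  node carries \<open>k\<close> words, the rule takes at most \<open>k\<close> words, and every word is less than
  \<open>(n + 1) ^ K\<close>. Since the nodes of the explicit graph are points, distinct nodes have distinct
  positions.
\<close>

definition implicit_graph :: "nat \<Rightarrow> nat \<Rightarrow> nat \<Rightarrow> rule_semantics \<Rightarrow> implicit_graph \<Rightarrow> bool" where
  "implicit_graph d k K sem G \<longleftrightarrow>
     finite (nodes G) \<and>
     (\<forall>v \<in> nodes G. length v = d + k \<and> (\<forall>w \<in> set v. w < (card (nodes G) + 1) ^ K)) \<and>
     length (edge_rule G) \<le> k \<and>
     (\<forall>w \<in> set (edge_rule G). w < (card (nodes G) + 1) ^ K) \<and>
     (\<forall>u \<in> nodes G. \<forall>v \<in> nodes G.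
        u \<noteq> v \<longrightarrow> sem (edge_rule G) u v = sem (edge_rule G) v u)"

definition implicit_grid_graph ::
    "nat \<Rightarrow> nat \<Rightarrow> nat \<Rightarrow> nat \<Rightarrow> rule_semantics \<Rightarrow> implicit_graph \<Rightarrow> bool" where
  "implicit_grid_graph d c k K sem G \<longleftrightarrow>
     implicit_graph d k K sem G \<and>
     inj_on (position d) (nodes G) \<and>
     (\<forall>(u, v) \<in> adjacent sem G.
        0 < linf_dist d (position d u) (position d v) \<and>
        linf_dist d (position d u) (position d v) \<le> c)"

definition connection :: "'a set \<Rightarrow> 'a set set \<Rightarrow> ('a \<times> 'a) set" where
  "connection V F = {(u, v). {u, v} \<in> F}\<^sup>* \<inter> V \<times> V"

definition components :: "rule_semantics \<Rightarrow> implicit_graph \<Rightarrow> nat list set set" where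
  "components sem G = nodes G // connection (nodes G) (edges sem G)"

definition is_cycle :: "'a set set \<Rightarrow> 'a list \<Rightarrow> bool" where
  "is_cycle F p \<longleftrightarrow>
     3 \<le> length p \<and> distinct p \<and>
     (\<forall>i < length p. {p ! i, p ! ((i + 1) mod length p)} \<in> F)"

definition spanning_forest :: "rule_semantics \<Rightarrow> implicit_graph \<Rightarrow> nat list set set \<Rightarrow> bool" where
  "spanning_forest sem G F \<longleftrightarrow>
     F \<subseteq> edges sem G \<and> \<not> (\<exists>p. is_cycle F p) \<and>
     connection (nodes G) F = connection (nodes G) (edges sem G)"

definition minimum_spanning_forest ::
    "rule_semantics \<Rightarrow> implicit_graph \<Rightarrow> nat list set set \<Rightarrow> bool" where
  "minimum_spanning_forest sem G F \<longleftrightarrow>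
     spanning_forest sem G F \<and>
     (\<forall>F'. spanning_forest sem G F' \<longrightarrow>
        (\<Sum>e\<in>F. edge_weight sem G e) \<le> (\<Sum>e\<in>F'. edge_weight sem G e))"

text \<open>
  Machines are numbered \<open>0, \<dots>, m - 1\<close>. In a round, machine \<open>i\<close> with memory contents \<open>x\<close> sends the
  words \<open>send P i x j\<close> to every machine \<open>j\<close>. It then replaces its memory by a sample from
  \<open>compute P i x y\<close>, where \<open>y l\<close> are the words received from machine \<open>l\<close>. The machines draw their
  samples independently, and local computation is not restricted otherwise. A halted machine
  neither sends nor changes its memory, which then is its final output.
\<close>

datatype machine_state =
    Running (memory: "nat list")
  | is_Halted: Halted (memory: "nat list")

type_synonym configuration = "nat \<Rightarrow> machine_state"

record mpc_program =
  send :: "nat \<Rightarrow> nat list \<Rightarrow> nat \<Rightarrow> nat list"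
  compute :: "nat \<Rightarrow> nat list \<Rightarrow> (nat \<Rightarrow> nat list) \<Rightarrow> machine_state pmf"

definition message :: "mpc_program \<Rightarrow> nat \<Rightarrow> configuration \<Rightarrow> nat \<Rightarrow> nat \<Rightarrow> nat list" where
  "message P m cfg i j =
     (if i < m \<and> j < m then
        (case cfg i of Running x \<Rightarrow> send P i x j | Halted _ \<Rightarrow> [])
      else [])"

definition mpc_round :: "mpc_program \<Rightarrow> nat \<Rightarrow> configuration \<Rightarrow> configuration pmf" where
  "mpc_round P m cfg =
     Pi_pmf {..<m} (Halted [])
       (\<lambda>j. case cfg j of
          Running x \<Rightarrow> compute P j x (\<lambda>i. message P m cfg i j)
        | Halted x \<Rightarrow> return_pmf (Halted x))"

primrec mpc_run :: "mpc_program \<Rightarrow> nat \<Rightarrow> configuration \<Rightarrow> nat \<Rightarrow> configuration pmf" where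
  "mpc_run P m cfg 0 = return_pmf cfg"
| "mpc_run P m cfg (Suc t) = bind_pmf (mpc_run P m cfg t) (mpc_round P m)"

definition all_halted :: "nat \<Rightarrow> configuration \<Rightarrow> bool" where
  "all_halted m cfg \<longleftrightarrow> (\<forall>j < m. is_Halted (cfg j))"

definition within_resources ::
    "mpc_program \<Rightarrow> nat \<Rightarrow> real \<Rightarrow> nat \<Rightarrow> configuration \<Rightarrow> bool" where
  "within_resources P m S W cfg \<longleftrightarrow>
     (\<forall>j < m.
        real (length (memory (cfg j))) \<le> S \<and>
        real (\<Sum>i<m. length (message P m cfg j i)) \<le> S \<and>
        real (\<Sum>i<m. length (message P m cfg i j)) \<le> S \<and>
        (\<forall>w \<in> set (memory (cfg j)). w < W) \<and>
        (\<forall>i < m. \<forall>w \<in> set (message P m cfg j i). w < W))"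

text \<open>
  The resource bounds and the correctness of the result hold on every computation path of positive
  probability. The algorithm halts almost surely, and within \<open>R\<close> rounds with probability at
  least \<open>p\<close>.
\<close>

definition las_vegas ::
    "mpc_program \<Rightarrow> nat \<Rightarrow> real \<Rightarrow> nat \<Rightarrow> nat \<Rightarrow> real \<Rightarrow> configuration \<Rightarrow>
     (configuration \<Rightarrow> bool) \<Rightarrow> bool" where
  "las_vegas P m S W R p cfg\<^sub>0 correct \<longleftrightarrow>
     (\<forall>t. \<forall>cfg \<in> set_pmf (mpc_run P m cfg\<^sub>0 t).
        within_resources P m S W cfg \<and> (all_halted m cfg \<longrightarrow> correct cfg)) \<and>
     (\<lambda>t. measure_pmf.prob (mpc_run P m cfg\<^sub>0 t) {cfg. all_halted m cfg}) \<longlonglongrightarrow> 1 \<and>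
     measure_pmf.prob (mpc_run P m cfg\<^sub>0 R) {cfg. all_halted m cfg} \<ge> p"

definition memory_scale :: "real \<Rightarrow> nat \<Rightarrow> real" where
  "memory_scale \<alpha> n = real n powr \<alpha>"

text \<open>
  The number of machines is such that the machines together hold \<open>\<Theta>(n)\<close> words.
\<close>

definition num_machines :: "real \<Rightarrow> nat \<Rightarrow> nat" where
  "num_machines \<alpha> n = nat \<lceil>real n / memory_scale \<alpha> n\<rceil>"

definition evenly_distributed :: "nat \<Rightarrow> nat list set \<Rightarrow> (nat \<Rightarrow> nat list list) \<Rightarrow> bool" where
  "evenly_distributed m V inp \<longleftrightarrow>
     distinct (concat (map inp [0..<m])) \<and>
     set (concat (map inp [0..<m])) = V \<and>
     (\<forall>i < m. \<lfloor>real (card V) / real m\<rfloor> \<le> int (length (inp i)) \<and>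
              int (length (inp i)) \<le> \<lceil>real (card V) / real m\<rceil>)"

definition initial_configuration :: "nat \<Rightarrow> (nat \<Rightarrow> nat list list) \<Rightarrow> configuration" where
  "initial_configuration m inp = (\<lambda>i. if i < m then Running (concat (inp i)) else Halted [])"

text \<open>
  The output is a set of records of \<open>L\<close> words, stored consecutively in the memories of the machines.
\<close>

definition records :: "nat \<Rightarrow> nat \<Rightarrow> configuration \<Rightarrow> nat list set" where
  "records L m cfg =
     (\<Union>j<m. {take L (drop (i * L) (memory (cfg j))) | i. i * L < length (memory (cfg j))})"

text \<open>
  Components are reported by giving each node a label of \<open>d\<close> words (enough for the coordinates of a
  representative). A record consists of the position and the label of a node.
\<close>

definition outputs_components ::
    "nat \<Rightarrow> rule_semantics \<Rightarrow> implicit_graph \<Rightarrow> nat \<Rightarrow> configuration \<Rightarrow> bool" where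
  "outputs_components d sem G m cfg \<longleftrightarrow>
     (\<exists>label. (\<forall>v \<in> nodes G. length (label v) = d) \<and>
        records (2 * d) m cfg = (\<lambda>v. position d v @ label v) ` nodes G \<and>
        (\<lambda>l. {v \<in> nodes G. label v = l}) ` (label ` nodes G) = components sem G)"

definition outputs_minimum_spanning_forest ::
    "nat \<Rightarrow> rule_semantics \<Rightarrow> implicit_graph \<Rightarrow> nat \<Rightarrow> configuration \<Rightarrow> bool" where
  "outputs_minimum_spanning_forest d sem G m cfg \<longleftrightarrow>
     (\<exists>A \<subseteq> nodes G \<times> nodes G.
        records (2 * d) m cfg = (\<lambda>(u, v). position d u @ position d v) ` A \<and>
        minimum_spanning_forest sem G ((\<lambda>(u, v). {u, v}) ` A))"

text \<open>
  The program may depend on the number \<open>n\<close> of nodes, on \<open>c\<close> and on the text of the rule, which are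
  \<open>O(1)\<close> words known to every machine, but not on the nodes or on how they are distributed. The
  constant \<open>C\<close> bounds the local memory by \<open>C * s\<close> words and the length of a word by
  \<open>C * log (n + 1)\<close> bits.
\<close>

definition solves_grid_problem ::
    "nat \<Rightarrow> nat \<Rightarrow> nat \<Rightarrow> real \<Rightarrow> rule_semantics \<Rightarrow> nat \<Rightarrow> nat \<Rightarrow> real \<Rightarrow>
     (nat \<Rightarrow> nat \<Rightarrow> nat list \<Rightarrow> mpc_program) \<Rightarrow>
     (nat \<Rightarrow> rule_semantics \<Rightarrow> implicit_graph \<Rightarrow> nat \<Rightarrow> configuration \<Rightarrow> bool) \<Rightarrow> bool" where
  "solves_grid_problem d k K \<alpha> sem C R \<gamma> alg problem \<longleftrightarrow>
     (\<forall>G c inp n s m.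
        n = card (nodes G) \<and> s = memory_scale \<alpha> n \<and> m = num_machines \<alpha> n \<and>
        implicit_grid_graph d c k K sem G \<and>
        1 \<le> c \<and> real c \<le> s powr (1 / real (d ^ 3)) \<and>
        evenly_distributed m (nodes G) inp \<longrightarrow>
        las_vegas (alg n c (edge_rule G)) m (real C * s) ((n + 1) ^ C)
          R (1 - 1 / real n powr \<gamma>)
          (initial_configuration m inp) (problem d sem G m))"

end

theory Submission
  imports Defs "HOL-Library.Nat_Bijection"
begin

text \<open>
  The algorithm is deterministic. Cut space into cubes of side \<open>L \<approx> s powr (1/d)\<close>, shifted along the
  diagonal by some \<open>a < L\<close>. A cube holds at most \<open>L ^ d = O(s)\<close> nodes. A node lies within distance
  \<open>c\<close> of a wall for at most \<open>2 * c * d\<close> of the shifts, so the best shift leaves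
  \<open>O(c * n / L) = O(s)\<close> such border nodes; this is where \<open>\<alpha> > (d + 1) / (d + 2)\<close> and the bound on \<open>c\<close>
  enter. All machines find this shift by exchanging their counts, and exchanging regular samples of
  the cube numbers then lets every node be sent to a machine such that no cube is split and every
  machine receives \<open>O(s)\<close> nodes. Both exchanges are all-to-all and fit because there are only
  \<open>O(s powr (1/4))\<close> machines.

  Only border nodes have edges to other machines. Break ties between weights, so that an edge belongs
  to the minimum spanning forest iff its ends are not connected by smaller edges. An edge of a local
  forest is settled locally unless both clusters that it merges contain border nodes. There are at
  most as many of the remaining edges as border nodes. Each is sent to machine 0 together with one
  border node from either cluster; with the edges between border nodes, these pairs determine how the
  border nodes are connected below every threshold. For the components, machine 0 sends a
  representative back for every border node.
\<close>

section \<open>Connectivity and forests\<close>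

text \<open>Being deterministic, the program runs through a single path of configurations, so the
  probabilistic requirements reduce to halting after a fixed number of rounds. The obstacle to a
  direct assignment of cubes to machines is that cubes may be filled very unevenly. What balances
  the load is the rank of a cube number among those of all nodes. An approximate rank is enough,
  provided that it depends on the cube alone. For the forest, knowing the final connectivity of the
  border is not enough: whether an edge belongs to it depends on the edges smaller than it. The
  exchanged data must therefore be right below every threshold at once. Recording only the moments
  at which Kruskal's algorithm joins two clusters that meet the border achieves this, and each such
  moment lowers the number of these clusters by one. Connected components are the case of the
  threshold that admits all edges, so both problems share one proof. Local computation is
  unrestricted and may use arbitrary choices, but the machines must agree on the shift and on the
  order of the edges.\<close>

definition conn :: "'a set set \<Rightarrow> ('a \<times> 'a) set" where
  "conn F = {(u, v). {u, v} \<in> F}\<^sup>*"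

lemma conn_refl [simp, intro]: "(x, x) \<in> conn F"
  by (simp add: conn_def)

lemma conn_edge: "{u, v} \<in> F \<Longrightarrow> (u, v) \<in> conn F"
  unfolding conn_def by (rule r_into_rtrancl) simp

lemma conn_trans [trans]: "(x, y) \<in> conn F \<Longrightarrow> (y, z) \<in> conn F \<Longrightarrow> (x, z) \<in> conn F"
  unfolding conn_def by (rule rtrancl_trans)

lemma conn_sym: "(x, y) \<in> conn F \<Longrightarrow> (y, x) \<in> conn F"
proof -
  have "sym {(u, v). {u, v} \<in> F}" by (auto simp: sym_def insert_commute)
  then show "(x, y) \<in> conn F \<Longrightarrow> (y, x) \<in> conn F"
    unfolding conn_def by (meson sym_rtrancl symD)
qed

lemma conn_subset:
  assumes "\<And>u v. {u, v} \<in> F \<Longrightarrow> (u, v) \<in> conn F'"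
  shows "conn F \<subseteq> conn F'"
proof
  fix p assume "p \<in> conn F"
  then obtain x y where p: "p = (x, y)" "(x, y) \<in> {(u, v). {u, v} \<in> F}\<^sup>*"
    unfolding conn_def by (cases p) auto
  from p(2) have "(x, y) \<in> conn F'"
    by (induction rule: rtrancl_induct) (auto intro: conn_trans assms)
  then show "p \<in> conn F'" using p by simp
qed

lemma conn_mono: "F \<subseteq> F' \<Longrightarrow> conn F \<subseteq> conn F'"
  by (rule conn_subset) (auto intro: conn_edge)

lemma conn_monoD: "(x, y) \<in> conn F \<Longrightarrow> F \<subseteq> F' \<Longrightarrow> (x, y) \<in> conn F'"
  using conn_mono by blast

lemma conn_induct [consumes 1, case_names base step]:
  assumes "(x, y) \<in> conn F" "P x"
    "\<And>y z. (x, y) \<in> conn F \<Longrightarrow> {y, z} \<in> F \<Longrightarrow> P y \<Longrightarrow> P z"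
  shows "P y"
proof -
  have "(x, y) \<in> {(u, v). {u, v} \<in> F}\<^sup>*" using assms(1) by (simp add: conn_def)
  then show ?thesis
    by (induction rule: rtrancl_induct) (auto intro: assms simp: conn_def)
qed

text \<open>A path need not use the new edge more than once, in one of two directions. When a prefix
  crosses it back, the induction returns to an earlier case.\<close>

lemma conn_insert_cases:
  assumes "(x, y) \<in> conn (insert {a, b} F)"
  obtains "(x, y) \<in> conn F"
  | "(x, a) \<in> conn F" "(b, y) \<in> conn F"
  | "(x, b) \<in> conn F" "(a, y) \<in> conn F"
proof -
  have "(x, y) \<in> conn F \<or> ((x, a) \<in> conn F \<and> (b, y) \<in> conn F) \<or> ((x, b) \<in> conn F \<and> (a, y) \<in> conn F)"
    using assms
  proof (induction rule: conn_induct)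
    case base
    then show ?case by simp
  next
    case (step y z)
    from step(2) consider "{y, z} \<in> F" | "y = a" "z = b" | "y = b" "z = a"
      by (auto simp: doubleton_eq_iff)
    then show ?case
    proof cases
      case 1
      then show ?thesis using step(3) conn_edge[OF 1] conn_trans by metis
    next
      case 2
      then show ?thesis using step(3) conn_refl conn_trans conn_sym by metis
    next
      case 3
      then show ?thesis using step(3) conn_refl conn_trans conn_sym by metis
    qed
  qed
  then show thesis using that by blast
qed

lemma conn_crossing_edge:
  assumes "(x, y) \<in> conn F" "x \<in> S" "y \<notin> S"
  shows "\<exists>a b. {a, b} \<in> F \<and> a \<in> S \<and> b \<notin> S"
proof (rule ccontr)
  assume *: "\<not> ?thesis"
  from assms(1) have "y \<in> S"
    by (induction rule: conn_induct) (use assms(2) * in auto)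
  then show False using assms by simp
qed

text \<open>Every edge is a bridge. This form is better suited to inserting and exchanging edges
  than \<open>is_cycle\<close>. It also excludes loops, as \<open>conn\<close> is reflexive, whereas
  a loop is too short for \<open>is_cycle\<close>.\<close>

definition forest :: "'a set set \<Rightarrow> bool" where
  "forest F \<longleftrightarrow> (\<forall>u v. {u, v} \<in> F \<longrightarrow> (u, v) \<notin> conn (F - {{u, v}}))"

lemma forestD: "forest F \<Longrightarrow> {u, v} \<in> F \<Longrightarrow> (u, v) \<notin> conn (F - {{u, v}})"
  unfolding forest_def by blast

lemma simple_path:
  assumes "(x, y) \<in> conn F"
  shows "\<exists>p. p \<noteq> [] \<and> hd p = x \<and> last p = y \<and> distinct p \<and>
             (\<forall>i. Suc i < length p \<longrightarrow> {p ! i, p ! Suc i} \<in> F)"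
  using assms
proof (induction rule: conn_induct)
  case base
  show ?case by (rule exI[of _ "[x]"]) auto
next
  case (step y z)
  then obtain p where p: "p \<noteq> []" "hd p = x" "last p = y" "distinct p"
    "\<And>i. Suc i < length p \<Longrightarrow> {p ! i, p ! Suc i} \<in> F" by blast
  show ?case
  proof (cases "z \<in> set p")
    case True
    then obtain j where j: "j < length p" "p ! j = z" by (auto simp: in_set_conv_nth)
    show ?thesis
    proof (rule exI[of _ "take (Suc j) p"], intro conjI)
      show "last (take (Suc j) p) = z"
        using j by (simp add: take_Suc_conv_app_nth)
    qed (use p j in auto)
  next
    case False
    show ?thesis
    proof (rule exI[of _ "p @ [z]"], intro conjI allI impI)
      fix i assume i: "Suc i < length (p @ [z])"
      show "{(p @ [z]) ! i, (p @ [z]) ! Suc i} \<in> F"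
      proof (cases "Suc i < length p")
        case True then show ?thesis using p(5)[of i] by (simp add: nth_append)
      next
        case F: False
        then have "Suc i = length p" using i by simp
        then have "p ! i = y" using p(1,3) by (metis diff_Suc_1 last_conv_nth)
        then show ?thesis using \<open>Suc i = length p\<close> step(2) by (simp add: nth_append)
      qed
    qed (use p False in auto)
  qed
qed

text \<open>A simple path between the ends of an edge that avoids the edge closes to a cycle. It has
  at least 3 nodes: one node would make the edge a loop, and two nodes would make the path use the
  edge itself.\<close>

lemma no_cycle_imp_forest:
  assumes "\<not> (\<exists>p. is_cycle F p)" "\<And>u v. {u, v} \<in> F \<Longrightarrow> u \<noteq> v"
  shows "forest F"
  unfolding forest_def
proof (intro allI impI notI)
  fix u v assume e: "{u, v} \<in> F" and c: "(u, v) \<in> conn (F - {{u, v}})"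
  obtain p where p: "p \<noteq> []" "hd p = u" "last p = v" "distinct p"
    "\<And>i. Suc i < length p \<Longrightarrow> {p ! i, p ! Suc i} \<in> F - {{u, v}}"
    using simple_path[OF c] by blast
  have uv: "u \<noteq> v" using assms(2)[OF e] .
  have h: "p ! 0 = u" "p ! (length p - 1) = v" using p by (auto simp: hd_conv_nth last_conv_nth)
  have "length p \<noteq> 1" using h uv by auto
  moreover have "length p \<noteq> 2"
  proof
    assume "length p = 2"
    then show False using p(5)[of 0] h by auto
  qed
  ultimately have len: "3 \<le> length p" using p(1) by (cases p) (auto simp: neq_Nil_conv Suc_le_eq)
  have "is_cycle F p"
    unfolding is_cycle_def
  proof (intro conjI allI impI)
    fix i assume i: "i < length p"
    show "{p ! i, p ! ((i + 1) mod length p)} \<in> F"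
    proof (cases "Suc i < length p")
      case True then show ?thesis using p(5)[of i] by simp
    next
      case False
      then have l: "Suc i = length p" using i by simp
      then have "i = length p - 1" "(i + 1) mod length p = 0" by auto
      then show ?thesis using h e by (simp add: insert_commute)
    qed
  qed (use len p in auto)
  then show False using assms(1) by blast
qed

lemma forest_imp_no_cycle:
  assumes "forest F"
  shows "\<not> (\<exists>p. is_cycle F p)"
proof
  assume "\<exists>p. is_cycle F p"
  then obtain p where p: "3 \<le> length p" "distinct p"
    "\<And>i. i < length p \<Longrightarrow> {p ! i, p ! ((i + 1) mod length p)} \<in> F"
    unfolding is_cycle_def by blast
  let ?e = "{p ! 0, p ! 1}"
  have "p \<noteq> []" using p(1) by auto
  then have e: "?e \<in> F" using p(3)[of 0] p(1) by simp
  have ne: "p ! i \<noteq> p ! j" if "i < length p" "j < length p" "i \<noteq> j" for i j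
    using p(2) that by (simp add: nth_eq_iff_index_eq)
  \<comment> \<open>Walking the cycle the long way round: each edge used here has an end that is
    neither \<open>p ! 0\<close> nor \<open>p ! 1\<close>, so it differs from
    \<open>?e\<close>.\<close>
  have path: "(p ! 1, p ! i) \<in> conn (F - {?e})" if "1 \<le> i" "i < length p" for i
    using that
  proof (induction i rule: dec_induct)
    case base then show ?case by simp
  next
    case (step i)
    have "{p ! i, p ! Suc i} \<in> F" using p(3)[of i] step by simp
    moreover have "{p ! i, p ! Suc i} \<noteq> ?e"
    proof -
      have "p ! Suc i \<noteq> p ! 0" "p ! Suc i \<noteq> p ! 1" using ne[of "Suc i" 0] ne[of "Suc i" 1] step p(1) \<open>p \<noteq> []\<close> by simp_all
      then show ?thesis by auto
    qed
    ultimately show ?case using step by (intro conn_trans[OF step(3)] conn_edge) auto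
  qed
  have "Suc (length p - 1) = length p" using p(1) by simp
  then have l: "{p ! (length p - 1), p ! 0} \<in> F" using p(3)[of "length p - 1"] p(1) by simp
  have "p ! (length p - 1) \<noteq> p ! 0" "p ! (length p - 1) \<noteq> p ! 1"
    using ne[of "length p - 1" 0] ne[of "length p - 1" 1] p(1) by force+
  then have "{p ! (length p - 1), p ! 0} \<noteq> ?e" by auto
  then have "(p ! (length p - 1), p ! 0) \<in> conn (F - {?e})"
    using l by (intro conn_edge) auto
  then have "(p ! 1, p ! 0) \<in> conn (F - {?e})"
    using path[of "length p - 1"] p(1) conn_trans by fastforce
  then show False using forestD[OF assms e] conn_sym by metis
qed

text \<open>If an old edge could be bypassed through the new one, then the old edge together with
  the rest of the bypass would already connect \<open>a\<close> and \<open>b\<close> in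
  \<open>F\<close>.\<close>

lemma forest_insert:
  assumes F: "forest F" and ab: "(a, b) \<notin> conn F"
  shows "forest (insert {a, b} F)"
  unfolding forest_def
proof (intro allI impI notI)
  fix u v assume e: "{u, v} \<in> insert {a, b} F"
    and c: "(u, v) \<in> conn (insert {a, b} F - {{u, v}})"
  have abF: "{a, b} \<notin> F" using ab conn_edge[of a b F] by auto
  show False
  proof (cases "{u, v} = {a, b}")
    case True
    then have "insert {a, b} F - {{u, v}} = F" using abF by simp
    then have "(u, v) \<in> conn F" using c by simp
    then show False using True ab conn_sym by (metis doubleton_eq_iff)
  next
    case False
    then have uv: "{u, v} \<in> F" using e by simp
    let ?F0 = "F - {{u, v}}"
    have "insert {a, b} F - {{u, v}} = insert {a, b} ?F0" using False by (simp add: insert_Diff_if)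
    with c have "(u, v) \<in> conn (insert {a, b} ?F0)" by simp
    moreover have sub: "(x, y) \<in> conn F" if "(x, y) \<in> conn ?F0" for x y
      using that by (rule conn_monoD) simp
    have uvF: "(u, v) \<in> conn F" using uv by (rule conn_edge)
    have "(a, b) \<in> conn F" if "(u, a) \<in> conn ?F0" "(b, v) \<in> conn ?F0"
      using conn_trans[OF conn_trans[OF conn_sym[OF sub[OF that(1)]] uvF] conn_sym[OF sub[OF that(2)]]] .
    moreover have "(b, a) \<in> conn F" if "(u, b) \<in> conn ?F0" "(a, v) \<in> conn ?F0"
      using conn_trans[OF conn_trans[OF conn_sym[OF sub[OF that(1)]] uvF] conn_sym[OF sub[OF that(2)]]] .
    ultimately show False using ab forestD[OF F uv] conn_sym[of b a]
      by (elim conn_insert_cases) blast+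
  qed
qed

lemma forest_subset:
  assumes "forest F" "F' \<subseteq> F"
  shows "forest F'"
  unfolding forest_def
proof (intro allI impI notI)
  fix u v assume "{u, v} \<in> F'" "(u, v) \<in> conn (F' - {{u, v}})"
  then have "{u, v} \<in> F" "(u, v) \<in> conn (F - {{u, v}})"
    using assms(2) conn_monoD[of u v "F' - {{u, v}}" "F - {{u, v}}"] by auto
  then show False using forestD[OF assms(1)] by simp
qed

section \<open>Kruskal's forest for a strict order of the edges\<close>

locale edge_order =
  fixes lt :: "'a set \<Rightarrow> 'a set \<Rightarrow> bool"
  assumes lt_irrefl: "\<not> lt e e"
    and lt_trans: "lt e f \<Longrightarrow> lt f g \<Longrightarrow> lt e g"
    and lt_total: "finite e \<Longrightarrow> finite f \<Longrightarrow> e \<noteq> f \<Longrightarrow> lt e f \<or> lt f e"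
begin

definition below :: "'a set set \<Rightarrow> 'a set \<Rightarrow> 'a set set" where
  "below E e = {f \<in> E. lt f e}"

text \<open>The edges at which Kruskal's algorithm joins two clusters that both meet
  \<open>B\<close>. If \<open>B\<close> contains all ends of edges, this is the whole
  forest.\<close>

definition merges :: "'a set \<Rightarrow> 'a set set \<Rightarrow> 'a set set" where
  "merges B E = {e \<in> E. \<exists>u v. e = {u, v} \<and> (u, v) \<notin> conn (below E e) \<and>
     (\<exists>x\<in>B. (u, x) \<in> conn (below E e)) \<and> (\<exists>y\<in>B. (v, y) \<in> conn (below E e))}"

text \<open>The result of Kruskal's algorithm in closed form. The test concerns each edge
  separately, so the forests of a part and of the whole graph can be compared edge by edge.\<close>

definition msf :: "'a set set \<Rightarrow> 'a set set" where
  "msf E = {e \<in> E. \<exists>u v. e = {u, v} \<and> (u, v) \<notin> conn (below E e)}"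

lemma below_subset: "below E e \<subseteq> E"
  by (auto simp: below_def)

lemma below_mono: "E \<subseteq> E' \<Longrightarrow> below E e \<subseteq> below E' e"
  by (auto simp: below_def)

lemma msf_subset: "msf E \<subseteq> E"
  by (auto simp: msf_def)

lemma msfD: "{u, v} \<in> msf E \<Longrightarrow> (u, v) \<notin> conn (below E {u, v})"
  unfolding msf_def by (auto simp: doubleton_eq_iff dest: conn_sym)

lemma mergesD:
  assumes "{u, v} \<in> merges B E"
  shows "{u, v} \<in> E" "(u, v) \<notin> conn (below E {u, v})"
    "\<exists>x\<in>B. (u, x) \<in> conn (below E {u, v})" "\<exists>y\<in>B. (v, y) \<in> conn (below E {u, v})"
  using assms unfolding merges_def by (auto simp: doubleton_eq_iff dest: conn_sym)

lemma merges_subset_msf: "merges B E \<subseteq> msf E"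
  unfolding merges_def msf_def by auto

lemma below_insert_subset: "e \<in> E \<Longrightarrow> lt e f \<Longrightarrow> insert e (below E e) \<subseteq> below E f"
  unfolding below_def using lt_trans by blast

text \<open>
  The elder rule of persistent homology: an edge that merges two clusters is charged to the younger
  of the oldest elements of \<open>B\<close> in these clusters, which is the oldest element of its cluster
  never again.
\<close>

lemma card_merges:
  assumes B: "finite B" and E: "\<And>e. e \<in> E \<Longrightarrow> finite e"
  shows "finite (merges B E) \<and> card (merges B E) \<le> card B"
proof -
  obtain age :: "'a \<Rightarrow> nat" where age: "inj_on age B"
    using finite_imp_inj_to_nat_seg[OF B] by blast
  define oldest where "oldest z F \<longleftrightarrow> (\<forall>w\<in>B. (z, w) \<in> conn F \<longrightarrow> age z \<le> age w)" for z F
  define P where "P e z \<longleftrightarrow> z \<in> B \<and> oldest z (below E e) \<and> \<not> oldest z (insert e (below E e))"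
    for e z
  have ex_oldest: "\<exists>z\<in>B. (u, z) \<in> conn F \<and> oldest z F" if x: "x \<in> B" "(u, x) \<in> conn F" for u x F
  proof -
    let ?z = "arg_min age (\<lambda>z. z \<in> B \<and> (u, z) \<in> conn F)"
    have "?z \<in> B \<and> (u, ?z) \<in> conn F"
      using arg_min_natI[of "\<lambda>z. z \<in> B \<and> (u, z) \<in> conn F" x age] x by blast
    moreover have "age ?z \<le> age w" if "w \<in> B" "(u, w) \<in> conn F" for w
      using arg_min_nat_le[of "\<lambda>z. z \<in> B \<and> (u, z) \<in> conn F" w age] that by blast
    ultimately show ?thesis unfolding oldest_def by (meson conn_trans)
  qed
  have "\<exists>z. P e z" if e: "e \<in> merges B E" for e
  proof -
    obtain u v where uv: "e = {u, v}" using e unfolding merges_def by auto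
    let ?F = "below E e"
    obtain x where x: "x \<in> B" "(u, x) \<in> conn ?F" "oldest x ?F"
      using mergesD(3)[OF e[unfolded uv]] ex_oldest uv by metis
    obtain y where y: "y \<in> B" "(v, y) \<in> conn ?F" "oldest y ?F"
      using mergesD(4)[OF e[unfolded uv]] ex_oldest uv by metis
    have "x \<noteq> y" using mergesD(2)[OF e[unfolded uv]] x y uv conn_trans conn_sym by metis
    then have ne: "age x \<noteq> age y" using age x y by (auto dest: inj_onD)
    have "(x, u) \<in> conn (insert e ?F)" "(v, y) \<in> conn (insert e ?F)"
      using x(2) y(2) by (auto intro: conn_sym conn_monoD)
    moreover have "(u, v) \<in> conn (insert e ?F)" by (rule conn_edge) (simp add: uv)
    ultimately have xy: "(x, y) \<in> conn (insert e ?F)" by (meson conn_trans)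
    show ?thesis
    proof (cases "age x < age y")
      case True
      then have "\<not> oldest y (insert e ?F)" unfolding oldest_def using x conn_sym[OF xy] by force
      then show ?thesis using y unfolding P_def by blast
    next
      case False
      then have "\<not> oldest x (insert e ?F)" unfolding oldest_def using y xy ne by force
      then show ?thesis using x unfolding P_def by blast
    qed
  qed
  then obtain f where f: "\<And>e. e \<in> merges B E \<Longrightarrow> P e (f e)" by metis
  have False if "P e z" "P e' z" "lt e e'" "e \<in> E" for e e' z
  proof -
    have "insert e (below E e) \<subseteq> below E e'" using below_insert_subset that by blast
    then have "conn (insert e (below E e)) \<subseteq> conn (below E e')" by (rule conn_mono)
    then show False using that(1,2) unfolding P_def oldest_def by blast
  qed
  then have "inj_on f (merges B E)"
    unfolding inj_on_def using f lt_total E merges_def by (metis (no_types, lifting) mem_Collect_eq)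
  moreover have "f ` merges B E \<subseteq> B" using f unfolding P_def by auto
  ultimately show ?thesis using B by (meson card_inj_on_le finite_imageD finite_subset)
qed

text \<open>Strong induction along the order: a rejected edge is bypassed by smaller edges, each of
  which is bypassed within the forest. Because of the intersection with \<open>msf E\<close>, the
  edge \<open>e\<close> itself may be used only if it was accepted.\<close>

lemma conn_below_msf:
  assumes "finite E" "e \<in> E" "e = {u, v}"
  shows "(u, v) \<in> conn (insert e (below (msf E) e) \<inter> msf E)"
  using assms(2,3)
proof (induction "card (below E e)" arbitrary: e u v rule: less_induct)
  case less
  show ?case
  proof (cases "e \<in> msf E")
    case True
    then show ?thesis using less by (intro conn_edge) auto
  next
    case False
    then have "(u, v) \<in> conn (below E e)" using less unfolding msf_def by auto
    moreover have "conn (below E e) \<subseteq> conn (insert e (below (msf E) e) \<inter> msf E)"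
    proof (rule conn_subset)
      fix x y assume xy: "{x, y} \<in> below E e"
      then have l: "lt {x, y} e" "{x, y} \<in> E" by (auto simp: below_def)
      have "below E {x, y} \<subset> below E e"
        using l xy lt_irrefl unfolding below_def using lt_trans by blast
      then have "card (below E {x, y}) < card (below E e)"
        using assms(1) by (intro psubset_card_mono) (auto intro: finite_subset[OF below_subset])
      from less(1)[OF this l(2) refl]
      show "(x, y) \<in> conn (insert e (below (msf E) e) \<inter> msf E)"
        by (rule conn_monoD) (use l lt_trans in \<open>auto simp: below_def\<close>)
    qed
    ultimately show ?thesis by blast
  qed
qed

lemma conn_msf: "finite E \<Longrightarrow> conn (msf E) = conn E"
proof (rule antisym)
  assume E: "finite E"
  show "conn E \<subseteq> conn (msf E)"
  proof (rule conn_subset)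
    fix u v assume "{u, v} \<in> E"
    from conn_below_msf[OF E this refl] show "(u, v) \<in> conn (msf E)"
      by (rule conn_monoD) auto
  qed
qed (rule conn_mono, rule msf_subset)

lemma ex_greatest_edge:
  assumes "finite S" "S \<noteq> {}" "\<And>e. e \<in> S \<Longrightarrow> finite e"
  shows "\<exists>e\<in>S. \<forall>f\<in>S. f \<noteq> e \<longrightarrow> lt f e"
  using assms
proof (induction S rule: finite_ne_induct)
  case (singleton x)
  then show ?case by simp
next
  case (insert x S)
  then obtain e where e: "e \<in> S" "\<And>f. f \<in> S \<Longrightarrow> f \<noteq> e \<Longrightarrow> lt f e" by auto
  have "x \<noteq> e" using insert e by auto
  then have "lt x e \<or> lt e x" using lt_total insert e by simp
  then show ?case using e lt_trans by (metis insertE insertI1 insertI2)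
qed

lemma forest_msf:
  assumes E: "finite E" "\<And>e. e \<in> E \<Longrightarrow> finite e"
  shows "forest (msf E)"
proof -
  have fin: "finite (msf E)" using E msf_subset finite_subset by blast
  \<comment> \<open>Generalised to subsets so that the greatest edge can be removed: all other edges
    of \<open>M\<close> lie below it and hence do not connect its ends.\<close>
  have *: "forest M" if "finite M" "M \<subseteq> msf E" for M
    using that
  proof (induction "card M" arbitrary: M)
    case 0
    then show ?case by (simp add: forest_def)
  next
    case (Suc k)
    have "M \<noteq> {}" using Suc.hyps(2) by auto
    moreover have "finite e" if "e \<in> M" for e using that Suc.prems E msf_subset by blast
    ultimately have "\<exists>e\<in>M. \<forall>f\<in>M. f \<noteq> e \<longrightarrow> lt f e"
      using ex_greatest_edge[of M] Suc.prems by simp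
    then obtain e where e: "e \<in> M" "\<And>f. f \<in> M \<Longrightarrow> f \<noteq> e \<Longrightarrow> lt f e"
      by auto
    have F: "forest (M - {e})"
      by (rule Suc.hyps(1)) (use Suc e in auto)
    obtain u v where uv: "e = {u, v}" "(u, v) \<notin> conn (below E e)"
      using e Suc.prems unfolding msf_def by blast
    have "M - {e} \<subseteq> below E e" using e(2) Suc.prems msf_subset unfolding below_def by auto
    then have "(u, v) \<notin> conn (M - {e})" using uv conn_monoD by metis
    from forest_insert[OF F this] show ?case using e uv by (simp add: insert_absorb)
  qed
  show ?thesis using *[OF fin] by simp
qed

text \<open>The exchange argument, by induction on the number of edges outside \<open>msf E\<close>.
  Ties do no harm, since \<open>w\<close> has to respect the order only weakly.\<close>

lemma msf_minimum:
  fixes w :: "'a set \<Rightarrow> real"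
  assumes E: "finite E" "\<And>e. e \<in> E \<Longrightarrow> finite e" "\<And>e. e \<in> E \<Longrightarrow> \<exists>u v. e = {u, v}"
    and w: "\<And>e f. lt e f \<Longrightarrow> w e \<le> w f"
    and F: "forest F" "F \<subseteq> E" "conn F = conn E"
  shows "sum w (msf E) \<le> sum w F"
  using F
proof (induction "card (F - msf E)" arbitrary: F rule: less_induct)
  case (less F)
  have finF: "finite F" using less E finite_subset by blast
  show ?case
  proof (cases "F \<subseteq> msf E")
    case True
    \<comment> \<open>A proper subset of a forest connects less than the forest does, so
      \<open>F\<close> equals \<open>msf E\<close> here.\<close>
    have "e \<in> F" if e: "e \<in> msf E" for e
    proof (rule ccontr)
      assume "e \<notin> F"
      obtain u v where uv: "e = {u, v}" using e unfolding msf_def by blast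
      have "{u, v} \<in> E" using e uv msf_subset by auto
      then have "(u, v) \<in> conn F" using conn_edge less.prems(3) by simp
      moreover have "F \<subseteq> msf E - {e}" using True \<open>e \<notin> F\<close> by auto
      ultimately have "(u, v) \<in> conn (msf E - {e})" using conn_monoD by metis
      then show False using forest_msf[OF E(1,2)] e uv unfolding forest_def by blast
    qed
    then have "msf E = F" using True by auto
    then show ?thesis by simp
  next
    case False
    then obtain f where f: "f \<in> F" "f \<notin> msf E" by auto
    then have fE: "f \<in> E" using less by auto
    then obtain u v where uv: "f = {u, v}" using E by blast
    have cf: "(u, v) \<in> conn (insert f (below (msf E) f) \<inter> msf E)"
      using conn_below_msf[OF E(1) fE uv] .
    have sub: "insert f (below (msf E) f) \<inter> msf E = below (msf E) f"
      using f below_subset by auto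
    let ?F0 = "F - {f}"
    have nuv: "(u, v) \<notin> conn ?F0" using less.prems(1) f uv unfolding forest_def by blast
    \<comment> \<open>The rejected edge \<open>f\<close> has a bypass of smaller forest edges.
      Removing \<open>f\<close> cuts \<open>F\<close> in two, and the bypass must cross this cut;
      the crossing edge replaces \<open>f\<close>.\<close>
    obtain a b where ab: "{a, b} \<in> below (msf E) f" "(u, a) \<in> conn ?F0" "(u, b) \<notin> conn ?F0"
      using conn_crossing_edge[OF cf[unfolded sub], of "{x. (u, x) \<in> conn ?F0}"] nuv by auto
    let ?e = "{a, b}"
    have e: "?e \<in> msf E" "lt ?e f" "?e \<in> E" using ab msf_subset by (auto simp: below_def)
    have nab: "(a, b) \<notin> conn ?F0" using ab conn_trans by metis
    then have eF: "?e \<notin> ?F0" using conn_edge by metis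
    have "(u, b) \<in> conn F"
    proof -
      have "(a, b) \<in> conn F" using conn_edge[OF e(3)] less.prems(3) by simp
      moreover have "(u, a) \<in> conn F" using ab conn_monoD by (metis Diff_subset)
      ultimately show ?thesis using conn_trans by metis
    qed
    then have "(u, b) \<in> conn (insert {u, v} ?F0)"
      by (rule conn_monoD) (use uv in blast)
    then have vb: "(v, b) \<in> conn ?F0"
      using ab(3) nuv by (elim conn_insert_cases) simp_all
    let ?F' = "insert ?e ?F0"
    have forest': "forest ?F'"
      using forest_insert[OF forest_subset[OF less.prems(1)] nab] by blast
    have sub': "?F' \<subseteq> E" using less.prems e by auto
    have "(u, v) \<in> conn ?F'"
    proof -
      have "(u, a) \<in> conn ?F'" "(b, v) \<in> conn ?F'"
        using ab(2) vb by (auto intro: conn_sym conn_monoD)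
      moreover have "(a, b) \<in> conn ?F'" by (rule conn_edge) simp
      ultimately show ?thesis using conn_trans by metis
    qed
    have "conn F \<subseteq> conn ?F'"
    proof (rule conn_subset)
      fix x y assume xy: "{x, y} \<in> F"
      show "(x, y) \<in> conn ?F'"
      proof (cases "{x, y} = {u, v}")
        case True
        then show ?thesis
          using \<open>(u, v) \<in> conn ?F'\<close> conn_sym by (auto simp: doubleton_eq_iff)
      next
        case False
        then show ?thesis using xy uv by (intro conn_edge) simp
      qed
    qed
    moreover have "conn ?F' \<subseteq> conn E" using sub' conn_mono by blast
    ultimately have conn': "conn ?F' = conn E" using less.prems by auto
    have "?F' - msf E \<subset> F - msf E" using e f by auto
    then have "card (?F' - msf E) < card (F - msf E)"
      using finF by (intro psubset_card_mono) auto
    from less.hyps[OF this forest' sub' conn']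
    have "sum w (msf E) \<le> sum w ?F'" .
    also have "\<dots> = w ?e + sum w ?F0" using eF finF by simp
    also have "\<dots> \<le> w f + sum w ?F0" using w[OF e(2)] by simp
    also have "\<dots> = sum w F" using finF f by (simp add: sum.remove)
    finally show ?thesis .
  qed
qed

end

section \<open>Splitting a graph along a border\<close>

text \<open>This is how the receiver learns the border. Looking at the third entry suffices because
  every border node announces itself by a quadruple of its own.\<close>

definition sketch_border :: "('a \<times> 'a \<times> 'a \<times> 'a) set \<Rightarrow> 'a set" where
  "sketch_border T = {x. \<exists>u v y. (u, v, x, y) \<in> T}"

text \<open>A contracted graph on the border nodes. The threshold \<open>P\<close> is applied to the
  merging edge \<open>{u, v}\<close>, not to the link \<open>{x, y}\<close> that stands for it. An
  announcement contributes at most a loop.\<close>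

definition links :: "('a \<times> 'a \<times> 'a \<times> 'a) set \<Rightarrow> 'a set set \<Rightarrow> ('a set \<Rightarrow> bool) \<Rightarrow> 'a set set" where
  "links T E\<^sub>B P = {{x, y} |u v x y. (u, v, x, y) \<in> T \<and> P {u, v}} \<union> {e \<in> E\<^sub>B. P e}"

lemma links_mono: "(\<And>f. P f \<Longrightarrow> Q f) \<Longrightarrow> links T E\<^sub>B P \<subseteq> links T E\<^sub>B Q"
  unfolding links_def by blast

context edge_order begin

text \<open>
  A quadruple \<open>(u, v, x, y)\<close> stands for a merging edge \<open>{u, v}\<close> whose ends were connected to the
  border nodes \<open>x\<close> and \<open>y\<close> before it; \<open>(b, b, b, b)\<close> only announces the border node \<open>b\<close>.
\<close>

definition sketch :: "'a set \<Rightarrow> 'a set set \<Rightarrow> ('a \<times> 'a \<times> 'a \<times> 'a) set" where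
  "sketch B E =
     (\<lambda>e. SOME (u, v, x, y). e = {u, v} \<and> x \<in> B \<and> y \<in> B \<and>
            (u, x) \<in> conn (below E e) \<and> (v, y) \<in> conn (below E e)) ` merges B E
     \<union> (\<lambda>b. (b, b, b, b)) ` B"

text \<open>Kruskal's test, carried out in the contracted graph with \<open>x\<close> and
  \<open>y\<close> in place of the ends of a merging edge. Announcements never pass it, as
  \<open>conn\<close> is reflexive.\<close>

definition global_msf :: "('a \<times> 'a \<times> 'a \<times> 'a) set \<Rightarrow> 'a set set \<Rightarrow> 'a set set" where
  "global_msf T E\<^sub>B =
     {e. \<exists>u v x y. e = {u, v} \<and> (u, v, x, y) \<in> T \<and> (x, y) \<notin> conn (links T E\<^sub>B (\<lambda>f. lt f e))}
     \<union> {e \<in> E\<^sub>B. \<exists>u v. e = {u, v} \<and> (u, v) \<notin> conn (links T E\<^sub>B (\<lambda>f. lt f e))}"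

lemma sketch_of_merge:
  assumes "e \<in> merges B E"
  obtains u v x y where "e = {u, v}" "(u, v, x, y) \<in> sketch B E" "x \<in> B" "y \<in> B"
    "(u, x) \<in> conn (below E e)" "(v, y) \<in> conn (below E e)"
proof -
  let ?Q = "\<lambda>(u, v, x, y). e = {u, v} \<and> x \<in> B \<and> y \<in> B \<and>
            (u, x) \<in> conn (below E e) \<and> (v, y) \<in> conn (below E e)"
  obtain u v x y where "?Q (u, v, x, y)" using assms unfolding merges_def by auto
  then have "?Q (SOME t. ?Q t)" by (rule someI)
  moreover have "(SOME t. ?Q t) \<in> sketch B E" unfolding sketch_def using assms by blast
  ultimately show thesis using that by (cases "SOME t. ?Q t") auto
qed

lemma sketchE:
  assumes "(u, v, x, y) \<in> sketch B E"
  obtains "u = x" "v = x" "y = x" "x \<in> B"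
  | "{u, v} \<in> merges B E" "x \<in> B" "y \<in> B"
    "(u, x) \<in> conn (below E {u, v})" "(v, y) \<in> conn (below E {u, v})"
proof -
  from assms consider b where "b \<in> B" "(u, v, x, y) = (b, b, b, b)"
    | e where "e \<in> merges B E" "(u, v, x, y) = (SOME (u, v, x, y). e = {u, v} \<and> x \<in> B \<and> y \<in> B \<and>
            (u, x) \<in> conn (below E e) \<and> (v, y) \<in> conn (below E e))"
    unfolding sketch_def by auto
  then show thesis
  proof cases
    case 1
    then show ?thesis using that(1) by simp
  next
    case 2
    let ?Q = "\<lambda>(u, v, x, y). e = {u, v} \<and> x \<in> B \<and> y \<in> B \<and>
            (u, x) \<in> conn (below E e) \<and> (v, y) \<in> conn (below E e)"
    obtain u' v' x' y' where "?Q (u', v', x', y')" using 2(1) unfolding merges_def by auto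
    then have "?Q (SOME t. ?Q t)" by (rule someI)
    then have "?Q (u, v, x, y)" using 2(2) by simp
    then have "e = {u, v}" "x \<in> B" "y \<in> B" "(u, x) \<in> conn (below E e)" "(v, y) \<in> conn (below E e)"
      by auto
    then show ?thesis using that(2) 2(1) by simp
  qed
qed

text \<open>At most \<open>card B\<close> merging edges by \<open>card_merges\<close>, and one
  announcement per border node.\<close>

lemma card_sketch:
  assumes "finite B" "\<And>e. e \<in> E \<Longrightarrow> finite e"
  shows "finite (sketch B E)" "card (sketch B E) \<le> 2 * card B"
proof -
  have m: "finite (merges B E)" "card (merges B E) \<le> card B"
    using card_merges[of B E] assms by auto
  then show "finite (sketch B E)" unfolding sketch_def using assms by simp
  show "card (sketch B E) \<le> 2 * card B" unfolding sketch_def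
    using card_Un_le[of "_ ` merges B E" "_ ` B"] card_image_le[OF m(1)] card_image_le[OF assms(1)] m(2)
    by (smt (verit) add_mono le_trans mult_2)
qed

lemma sketch_border_sketch [simp]: "sketch_border (sketch B E) = B"
proof
  show "sketch_border (sketch B E) \<subseteq> B"
    unfolding sketch_border_def by (auto elim: sketchE)
  show "B \<subseteq> sketch_border (sketch B E)"
    unfolding sketch_border_def sketch_def by blast
qed

end

text \<open>\<open>part u\<close> is the machine that holds \<open>u\<close>. Since
  \<open>{u, v} = {v, u}\<close>, the assumption \<open>crossing\<close> puts both ends of a
  crossing edge into \<open>B\<close>; \<open>B\<close> may contain further nodes.\<close>

locale split_graph = edge_order lt for lt :: "'a set \<Rightarrow> 'a set \<Rightarrow> bool" +
  fixes E :: "'a set set" and part :: "'a \<Rightarrow> nat" and m :: nat and B :: "'a set"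
  assumes fin_E: "finite E"
    and edgeE: "\<And>e. e \<in> E \<Longrightarrow> \<exists>u v. e = {u, v} \<and> u \<noteq> v \<and> part u < m \<and> part v < m"
    and fin_B: "finite B"
    and part_B: "\<And>b. b \<in> B \<Longrightarrow> part b < m"
    and crossing: "\<And>u v. {u, v} \<in> E \<Longrightarrow> part u \<noteq> part v \<Longrightarrow> u \<in> B"
begin

definition local_edges :: "nat \<Rightarrow> 'a set set" where
  "local_edges j = {e \<in> E. \<forall>x\<in>e. part x = j}"

definition local_border :: "nat \<Rightarrow> 'a set" where
  "local_border j = {b \<in> B. part b = j}"

definition sketches :: "('a \<times> 'a \<times> 'a \<times> 'a) set" where
  "sketches = (\<Union>j<m. sketch (local_border j) (local_edges j))"

definition border_edges :: "'a set set" where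
  "border_edges = {e \<in> E. e \<subseteq> B}"

lemma finite_edge: "e \<in> E \<Longrightarrow> finite e"
  using edgeE by blast

lemma local_edges_subset: "local_edges j \<subseteq> E"
  by (auto simp: local_edges_def)

lemma sketch_border_sketches: "sketch_border sketches = B"
proof -
  have "sketch_border sketches = (\<Union>j<m. sketch_border (sketch (local_border j) (local_edges j)))"
    unfolding sketches_def sketch_border_def by auto
  also have "\<dots> = B" using part_B by (auto simp: local_border_def)
  finally show ?thesis .
qed

lemma part_conn_local: "(u, v) \<in> conn {e \<in> local_edges j. P e} \<Longrightarrow> part u = j \<Longrightarrow> part v = j"
  by (induction rule: conn_induct) (auto simp: local_edges_def)

lemma sketchesE:
  assumes "(u, v, x, y) \<in> sketches"
  obtains "u = x" "v = x" "y = x" "x \<in> B"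
  | "{u, v} \<in> E" "x \<in> B" "y \<in> B" "(u, x) \<in> conn (below E {u, v})" "(v, y) \<in> conn (below E {u, v})"
proof -
  obtain j where j: "(u, v, x, y) \<in> sketch (local_border j) (local_edges j)"
    using assms unfolding sketches_def by blast
  have mono: "conn (below (local_edges j) {u, v}) \<subseteq> conn (below E {u, v})"
    by (intro conn_mono below_mono local_edges_subset)
  from j show thesis
  proof (cases rule: sketchE)
    case 1
    then show ?thesis using that(1) by (auto simp: local_border_def)
  next
    case 2
    show ?thesis
      by (rule that(2))
        (use 2 mono mergesD(1)[OF 2(1)] local_edges_subset in \<open>auto simp: local_border_def\<close>)
  qed
qed

text \<open>The thresholds for which connectivity must be preserved. The two instances used are
  "smaller than \<open>e\<close>" for the forest and "all edges" for the components.\<close>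

definition downward :: "('a set \<Rightarrow> bool) \<Rightarrow> bool" where
  "downward P \<longleftrightarrow> (\<forall>e f. P f \<longrightarrow> lt e f \<longrightarrow> P e)"

lemma downward_below: "downward (\<lambda>f. lt f e)"
  unfolding downward_def using lt_trans by blast

lemma downward_True: "downward (\<lambda>f. True)"
  unfolding downward_def by blast

abbreviation "Links \<equiv> links sketches border_edges"

text \<open>A link from \<open>x\<close> to \<open>y\<close> unfolds to a path from \<open>x\<close>
  to \<open>u\<close>, the edge \<open>{u, v}\<close>, and a path from \<open>v\<close> to
  \<open>y\<close>. The two paths use only edges below \<open>{u, v}\<close>, which satisfy
  \<open>P\<close> as well.\<close>

lemma links_sound:
  assumes P: "downward P"
  shows "conn (Links P) \<subseteq> conn {e \<in> E. P e}"
proof (rule conn_subset)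
  fix a b assume "{a, b} \<in> Links P"
  then consider "{a, b} \<in> E" "P {a, b}"
    | u v x y where "(u, v, x, y) \<in> sketches" "P {u, v}" "{a, b} = {x, y}"
    unfolding links_def border_edges_def by auto
  then show "(a, b) \<in> conn {e \<in> E. P e}"
  proof cases
    case 1
    then show ?thesis by (intro conn_edge) simp
  next
    case 2
    have "(x, y) \<in> conn {e \<in> E. P e}"
      using 2(1)
    proof (cases rule: sketchesE)
      case 1
      then show ?thesis by simp
    next
      case e: 2
      have "below E {u, v} \<subseteq> {e \<in> E. P e}"
        using P 2(2) unfolding below_def downward_def by blast
      then have "(u, x) \<in> conn {e \<in> E. P e}" "(v, y) \<in> conn {e \<in> E. P e}"
        using e(4,5) conn_monoD by metis+
      moreover have "(u, v) \<in> conn {e \<in> E. P e}" using e(1) 2(2) by (intro conn_edge) simp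
      ultimately show ?thesis by (meson conn_sym conn_trans)
    qed
    then show ?thesis using 2(3) conn_sym[of x y] unfolding doubleton_eq_iff by auto
  qed
qed

lemma links_complete_local:
  assumes "downward P" "p \<in> local_border j" "q \<in> local_border j" "j < m"
    and "(p, q) \<in> conn {e \<in> local_edges j. P e}"
  shows "(p, q) \<in> conn (Links P)"
  using assms(1-3,5)
proof (induction "card {e \<in> local_edges j. P e}" arbitrary: P p q rule: less_induct)
  case (less P p q)
  let ?S = "{e \<in> local_edges j. P e}"
  have fin: "finite ?S" using fin_E local_edges_subset finite_subset by (metis (no_types, lifting) mem_Collect_eq subsetI)
  show ?case
  proof (cases "?S = {}")
    case True
    then have "conn ?S = Id" unfolding True conn_def by simp
    then show ?thesis using less.prems(4) by simp
  next
    case False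
    have "finite e" if "e \<in> ?S" for e
      using that local_edges_subset[of j] by (intro finite_edge) auto
    then have "\<exists>e\<in>?S. \<forall>f\<in>?S. f \<noteq> e \<longrightarrow> lt f e"
      by (intro ex_greatest_edge[OF fin False]) simp
    then obtain e where e: "e \<in> ?S" "\<And>f. f \<in> ?S \<Longrightarrow> f \<noteq> e \<Longrightarrow> lt f e"
      by auto
    let ?S' = "below (local_edges j) e"
    have S: "?S = insert e ?S'"
    proof
      show "?S \<subseteq> insert e ?S'" using e by (auto simp: below_def)
      show "insert e ?S' \<subseteq> ?S" using e less.prems(1) by (auto simp: below_def downward_def)
    qed
    have "?S' \<subset> ?S" using S lt_irrefl unfolding below_def by blast
    then have "card ?S' < card ?S" using fin psubset_card_mono by blast
    then have IH: "(a, b) \<in> conn (Links P)"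
      if "a \<in> local_border j" "b \<in> local_border j" "(a, b) \<in> conn ?S'" for a b
    proof -
      have "(a, b) \<in> conn (Links (\<lambda>f. lt f e))"
        using less.hyps[of "\<lambda>f. lt f e" a b] \<open>card ?S' < card ?S\<close> that downward_below
        by (simp add: below_def)
      then show ?thesis
        by (rule conn_monoD) (rule links_mono, use e(1) less.prems(1) in \<open>auto simp: downward_def\<close>)
    qed
    have "e \<in> E" using e(1) by (simp add: local_edges_def)
    from edgeE[OF this] obtain u v where uv: "e = {u, v}" by blast
    have merge: "(p, q) \<in> conn (Links P)"
      if a: "(p, a) \<in> conn ?S'" "(b, q) \<in> conn ?S'" "{a, b} = e" for a b
    proof (cases "(a, b) \<in> conn ?S'")
      case True
      then have "(p, q) \<in> conn ?S'" using a by (meson conn_trans)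
      then show ?thesis using IH less.prems by blast
    next
      case False
      \<comment> \<open>The border nodes \<open>p\<close> and \<open>q\<close> themselves witness
        that both clusters meet the border.\<close>
      have "e \<in> merges (local_border j) (local_edges j)"
        unfolding merges_def using False a less.prems(2,3) e(1) by (auto intro: conn_sym)
      then obtain u' v' x y where s: "e = {u', v'}"
        "(u', v', x, y) \<in> sketch (local_border j) (local_edges j)"
        "x \<in> local_border j" "y \<in> local_border j" "(u', x) \<in> conn ?S'" "(v', y) \<in> conn ?S'"
        by (rule sketch_of_merge)
      have "(u', v', x, y) \<in> sketches" unfolding sketches_def using s(2) assms(4) by blast
      then have "{x, y} \<in> Links P" unfolding links_def using s(1) e(1) by blast
      then have xy: "(x, y) \<in> conn (Links P)" by (rule conn_edge)
      \<comment> \<open>The sketch fixed an orientation of \<open>e\<close> by arbitrary choice, so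
        it may be opposite to the one in which the path traverses \<open>e\<close>.\<close>
      consider "a = u'" "b = v'" | "a = v'" "b = u'" using a(3) s(1) by (auto simp: doubleton_eq_iff)
      then show ?thesis
      proof cases
        case 1
        then have "(p, x) \<in> conn ?S'" "(y, q) \<in> conn ?S'" using a s by (meson conn_sym conn_trans)+
        then show ?thesis using IH[of p x] IH[of y q] less.prems s xy by (meson conn_trans)
      next
        case 2
        then have "(p, y) \<in> conn ?S'" "(x, q) \<in> conn ?S'" using a s by (meson conn_sym conn_trans)+
        then show ?thesis using IH[of p y] IH[of x q] less.prems s xy by (meson conn_sym conn_trans)
      qed
    qed
    have "(p, q) \<in> conn (insert {u, v} ?S')" using less.prems(4) S uv by simp
    then show ?thesis
    proof (cases rule: conn_insert_cases)
      case 1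
      then show ?thesis using IH less.prems by blast
    next
      case 2
      then show ?thesis using merge uv by blast
    next
      case 3
      then show ?thesis using merge[of v u] uv by (simp add: insert_commute)
    qed
  qed
qed

lemma links_complete:
  assumes P: "downward P" and p: "p \<in> B" and q: "q \<in> B"
    and c: "(p, q) \<in> conn {e \<in> E. P e}"
  shows "(p, q) \<in> conn (Links P)"
proof -
  have loc: "b \<in> local_border (part z)" if "(b, z) \<in> conn {e \<in> local_edges (part z). P e}" "b \<in> B" for b z
    using part_conn_local[OF conn_sym[OF that(1)]] that(2) by (simp add: local_border_def)
  \<comment> \<open>The invariant along the path: the current node is locally connected to a border
    node that is reachable from \<open>p\<close> by links. A crossing edge has both ends in
    \<open>B\<close> and is a link itself; the local stretch before it becomes links by
    \<open>links_complete_local\<close>.\<close>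
  have "\<exists>b\<in>B. (p, b) \<in> conn (Links P) \<and> (b, q) \<in> conn {e \<in> local_edges (part q). P e}"
    using c
  proof (induction rule: conn_induct)
    case base
    show ?case using p by blast
  next
    case (step y z)
    then obtain b where b: "b \<in> B" "(p, b) \<in> conn (Links P)"
      "(b, y) \<in> conn {e \<in> local_edges (part y). P e}" by auto
    have yz: "{y, z} \<in> E" "P {y, z}" using step(2) by auto
    show ?case
    proof (cases "part y = part z")
      case True
      then have "{y, z} \<in> {e \<in> local_edges (part z). P e}" using yz by (simp add: local_edges_def)
      from conn_edge[OF this] have "(b, z) \<in> conn {e \<in> local_edges (part z). P e}"
        by (rule conn_trans[OF b(3)[unfolded True]])
      then show ?thesis using b(1,2) by auto
    next
      case False
      then have B: "y \<in> B" "z \<in> B"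
        using crossing[of y z] crossing[of z y] yz by (auto simp: insert_commute)
      have "(b, y) \<in> conn (Links P)"
        by (rule links_complete_local[OF P _ _ _ b(3)])
          (use loc[OF b(3,1)] B part_B in \<open>auto simp: local_border_def\<close>)
      moreover have "(y, z) \<in> conn (Links P)"
        by (rule conn_edge) (use B yz in \<open>simp add: links_def border_edges_def\<close>)
      ultimately have "(p, z) \<in> conn (Links P)" by (rule conn_trans[OF conn_trans[OF b(2)]])
      then show ?thesis using B by auto
    qed
  qed
  then obtain b where b: "b \<in> B" "(p, b) \<in> conn (Links P)"
      "(b, q) \<in> conn {e \<in> local_edges (part q). P e}" by auto
  have "(b, q) \<in> conn (Links P)"
    by (rule links_complete_local[OF P _ _ _ b(3)])
      (use loc[OF b(3,1)] q part_B in \<open>auto simp: local_border_def\<close>)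
  then show ?thesis by (rule conn_trans[OF b(2)])
qed

lemma conn_links_iff:
  assumes "downward P" "p \<in> B" "q \<in> B"
  shows "(p, q) \<in> conn (Links P) \<longleftrightarrow> (p, q) \<in> conn {e \<in> E. P e}"
  using links_complete[OF assms] links_sound[OF assms(1)] by blast

lemma conn_links_below_iff:
  assumes "p \<in> B" "q \<in> B"
  shows "(p, q) \<in> conn (Links (\<lambda>f. lt f e)) \<longleftrightarrow> (p, q) \<in> conn (below E e)"
  using conn_links_iff[OF downward_below assms] by (simp add: below_def)

text \<open>A cluster leaves its part only through a border node, so a local cluster without border
  nodes is also the cluster in the whole graph.\<close>

lemma conn_local_if_no_border:
  assumes "(u, z) \<in> conn {e \<in> E. P e}" "part u = j"
    and "\<And>x. x \<in> local_border j \<Longrightarrow> (u, x) \<notin> conn {e \<in> local_edges j. P e}"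
  shows "(u, z) \<in> conn {e \<in> local_edges j. P e}"
  using assms(1)
proof (induction rule: conn_induct)
  case base
  show ?case by simp
next
  case (step y z)
  have y: "part y = j" using part_conn_local[OF step(3)] assms(2) by simp
  have "y \<notin> B" using assms(3) step(3) y by (auto simp: local_border_def)
  then have "part z = j" using crossing[of y z] step(2) y by (cases "part y = part z") auto
  then have "{y, z} \<in> {e \<in> local_edges j. P e}" using step(2) y by (simp add: local_edges_def)
  from conn_edge[OF this] show ?case by (rule conn_trans[OF step(3)])
qed

text \<open>One of the two clusters joined by \<open>e\<close> has no border node. It is then a
  cluster of the whole graph too, so no path through other machines can bypass
  \<open>e\<close>.\<close>

lemma local_msf_not_merging:
  assumes e: "e \<in> msf (local_edges j)" "e \<notin> merges (local_border j) (local_edges j)"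
  shows "e \<in> msf E"
proof -
  obtain u v where uv: "e = {u, v}" "(u, v) \<notin> conn (below (local_edges j) e)"
    "e \<in> local_edges j" using e(1) unfolding msf_def by blast
  have part: "part u = j" "part v = j" using uv(1,3) by (auto simp: local_edges_def)
  have "(u, v) \<notin> conn (below E e)"
  proof
    assume c: "(u, v) \<in> conn (below E e)"
    have "(\<forall>x\<in>local_border j. (u, x) \<notin> conn (below (local_edges j) e)) \<or>
          (\<forall>x\<in>local_border j. (v, x) \<notin> conn (below (local_edges j) e))"
      using e(2) uv unfolding merges_def by auto
    then have "(u, v) \<in> conn (below (local_edges j) e) \<or> (v, u) \<in> conn (below (local_edges j) e)"
      using conn_local_if_no_border[of u v "\<lambda>f. lt f e" j]
        conn_local_if_no_border[of v u "\<lambda>f. lt f e" j] c conn_sym[OF c] part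
      unfolding below_def by blast
    then show False using uv(2) conn_sym by metis
  qed
  then show ?thesis using uv local_edges_subset unfolding msf_def by blast
qed

text \<open>Besides soundness, membership in \<open>merges B E\<close> bounds the number of these
  edges by \<open>card B\<close>, which is what allows one machine to output all of them.\<close>

lemma global_msf_subset: "global_msf sketches border_edges \<subseteq> msf E \<inter> merges B E"
proof
  fix e assume "e \<in> global_msf sketches border_edges"
  then consider u v x y where "e = {u, v}" "(u, v, x, y) \<in> sketches" "(x, y) \<notin> conn (Links (\<lambda>f. lt f e))"
    | u v where "e \<in> border_edges" "e = {u, v}" "(u, v) \<notin> conn (Links (\<lambda>f. lt f e))"
    unfolding global_msf_def by blast
  then have "e \<in> merges B E"
  proof cases
    case 1
    from 1(2) show ?thesis
    proof (cases rule: sketchesE)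
      case A: 1
      then show ?thesis using 1(3) by simp
    next
      case 2
      then have "(x, y) \<notin> conn (below E e)" using 1(3) conn_links_below_iff by blast
      then have "(u, v) \<notin> conn (below E e)" using 2(4,5) 1(1) by (meson conn_sym conn_trans)
      then show ?thesis unfolding merges_def using 1(1) 2 by blast
    qed
  next
    case 2
    then have "u \<in> B" "v \<in> B" "e \<in> E" by (auto simp: border_edges_def)
    moreover then have "(u, v) \<notin> conn (below E e)" using 2(3) conn_links_below_iff by blast
    ultimately show ?thesis unfolding merges_def using 2(2) by blast
  qed
  then show "e \<in> msf E \<inter> merges B E" using merges_subset_msf by blast
qed

text \<open>For the inclusion from left to right: an edge between two parts is a border edge, an
  edge inside a part that merges no border clusters is settled there, and any other edge has a
  quadruple in the sketch of its part.\<close>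

theorem msf_eq:
  "msf E = (\<Union>j<m. msf (local_edges j) - merges (local_border j) (local_edges j))
             \<union> global_msf sketches border_edges"
proof
  show "(\<Union>j<m. msf (local_edges j) - merges (local_border j) (local_edges j))
             \<union> global_msf sketches border_edges \<subseteq> msf E"
    using local_msf_not_merging global_msf_subset by blast
  show "msf E \<subseteq> (\<Union>j<m. msf (local_edges j) - merges (local_border j) (local_edges j))
             \<union> global_msf sketches border_edges"
  proof
    fix e assume e: "e \<in> msf E"
    then have eE: "e \<in> E" using msf_subset by blast
    obtain u v where uv: "e = {u, v}" "part u < m" "part v < m" using edgeE[OF eE] by blast
    have nc: "(u, v) \<notin> conn (below E e)" using msfD e uv by blast
    show "e \<in> (\<Union>j<m. msf (local_edges j) - merges (local_border j) (local_edges j))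
             \<union> global_msf sketches border_edges"
    proof (cases "part u = part v")
      case False
      then have B: "u \<in> B" "v \<in> B"
        using crossing[of u v] crossing[of v u] eE uv(1) by (auto simp: insert_commute)
      then have "(u, v) \<notin> conn (Links (\<lambda>f. lt f e))" using nc conn_links_below_iff by blast
      moreover have "e \<in> border_edges" using B eE uv by (auto simp: border_edges_def)
      ultimately show ?thesis unfolding global_msf_def using uv(1) by blast
    next
      case True
      let ?j = "part u"
      have el: "e \<in> local_edges ?j" using eE uv True by (auto simp: local_edges_def)
      \<comment> \<open>A part has fewer edges to bypass \<open>e\<close> with, so passing the
        global test implies passing the local one.\<close>
      have nl: "(u, v) \<notin> conn (below (local_edges ?j) e)"
        using nc conn_mono[OF below_mono[OF local_edges_subset]] by blast
      then have em: "e \<in> msf (local_edges ?j)" unfolding msf_def using el uv by blast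
      show ?thesis
      proof (cases "e \<in> merges (local_border ?j) (local_edges ?j)")
        case False
        then show ?thesis using em uv by blast
      next
        case True
        then obtain u' v' x y where s: "e = {u', v'}"
          "(u', v', x, y) \<in> sketch (local_border ?j) (local_edges ?j)"
          "x \<in> local_border ?j" "y \<in> local_border ?j"
          "(u', x) \<in> conn (below (local_edges ?j) e)" "(v', y) \<in> conn (below (local_edges ?j) e)"
          by (rule sketch_of_merge)
        have "(u', x) \<in> conn (below E e)" "(v', y) \<in> conn (below E e)"
          using s(5,6) conn_mono[OF below_mono[OF local_edges_subset]] by blast+
        moreover have "(u', v') \<notin> conn (below E e)" using msfD e s(1) by blast
        ultimately have "(x, y) \<notin> conn (below E e)" by (meson conn_sym conn_trans)
        then have "(x, y) \<notin> conn (Links (\<lambda>f. lt f e))"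
          using conn_links_below_iff s(3,4) by (auto simp: local_border_def)
        moreover have "(u', v', x, y) \<in> sketches" unfolding sketches_def using s(2) uv by blast
        ultimately show ?thesis unfolding global_msf_def using s(1) by blast
      qed
    qed
  qed
qed

lemma card_global_msf: "card (global_msf sketches border_edges) \<le> card B"
proof -
  have "finite (merges B E)" "card (merges B E) \<le> card B"
    using card_merges[OF fin_B] finite_edge by auto
  then show ?thesis using global_msf_subset card_mono[of "merges B E"] by (meson le_infE le_trans)
qed

end

section \<open>Deterministic programs\<close>

text \<open>All distributions are point masses. The assumption \<open>running\<close> is there
  because \<open>las_vegas\<close> demands a correct output in every reachable configuration in
  which all machines have halted, hence also before time \<open>T\<close>.\<close>

lemma las_vegas_deterministic:
  fixes cfg :: "nat \<Rightarrow> configuration"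
  assumes compute: "\<And>j x y. compute P j x y = return_pmf (f j x y)"
    and step: "\<And>t j. t < T \<Longrightarrow> j < m \<Longrightarrow> cfg (Suc t) j =
      (case cfg t j of Running x \<Rightarrow> f j x (\<lambda>i. message P m (cfg t) i j) | Halted x \<Rightarrow> Halted x)"
    and outside: "\<And>t j. t \<le> T \<Longrightarrow> m \<le> j \<Longrightarrow> cfg t j = Halted []"
    and halt: "all_halted m (cfg T)"
    and running: "\<And>t. t < T \<Longrightarrow> \<not> all_halted m (cfg t)"
    and resources: "\<And>t. t \<le> T \<Longrightarrow> within_resources P m S W (cfg t)"
    and correct: "correct (cfg T)"
    and T: "T \<le> R" and p: "p \<le> 1"
  shows "las_vegas P m S W R p (cfg 0) correct"
proof -
  \<comment> \<open>The sequence \<open>cfg\<close> is considered up to \<open>T\<close> only.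
    Afterwards the actual run stands still, whence \<open>min (Suc t) T\<close>.\<close>
  have round: "mpc_round P m (cfg t) = return_pmf (cfg (min (Suc t) T))" if "t \<le> T" for t
  proof -
    have eq: "(case cfg t j of Running x \<Rightarrow> compute P j x (\<lambda>i. message P m (cfg t) i j)
        | Halted x \<Rightarrow> return_pmf (Halted x)) = return_pmf (cfg (min (Suc t) T) j)" if "j < m" for j
    proof (cases "t < T")
      case True
      then show ?thesis using step[OF True that] by (auto simp: compute split: machine_state.splits)
    next
      case False
      then have "t = T" using \<open>t \<le> T\<close> by simp
      have "is_Halted (cfg T j)" using halt that unfolding all_halted_def by simp
      then obtain x where "cfg T j = Halted x" by (cases "cfg T j") auto
      then show ?thesis using \<open>t = T\<close> by simp
    qed
    have "mpc_round P m (cfg t) =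
        Pi_pmf {..<m} (Halted []) (\<lambda>j. return_pmf (cfg (min (Suc t) T) j))"
      unfolding mpc_round_def by (rule Pi_pmf_cong) (auto simp: eq)
    also have "\<dots> = return_pmf (\<lambda>j. if j \<in> {..<m} then cfg (min (Suc t) T) j else Halted [])"
      by (rule Pi_pmf_return_pmf) simp
    also have "(\<lambda>j. if j \<in> {..<m} then cfg (min (Suc t) T) j else Halted []) = cfg (min (Suc t) T)"
      using outside[of "min (Suc t) T"] by auto
    finally show ?thesis .
  qed
  have run: "mpc_run P m (cfg 0) t = return_pmf (cfg (min t T))" for t
  proof (induction t)
    case (Suc t)
    have "min (Suc (min t T)) T = min (Suc t) T" by simp
    then show ?case using Suc round[of "min t T"] by (simp add: bind_return_pmf)
  qed simp
  have prob: "measure_pmf.prob (mpc_run P m (cfg 0) t) {cfg. all_halted m cfg} = 1" if "T \<le> t" for t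
    using that halt by (simp add: run min_def)
  have "eventually (\<lambda>t. measure_pmf.prob (mpc_run P m (cfg 0) t) {cfg. all_halted m cfg} = 1) sequentially"
    using prob eventually_sequentially by blast
  then have "(\<lambda>t. measure_pmf.prob (mpc_run P m (cfg 0) t) {cfg. all_halted m cfg}) \<longlonglongrightarrow> 1"
    by (rule tendsto_eventually)
  moreover have "within_resources P m S W c \<and> (all_halted m c \<longrightarrow> correct c)"
    if "c \<in> set_pmf (mpc_run P m (cfg 0) t)" for t c
  proof -
    have c: "c = cfg (min t T)" using that by (simp add: run)
    show ?thesis
    proof (cases "t < T")
      case True
      then show ?thesis using c resources[of t] running[of t] by simp
    next
      case False
      then show ?thesis using c resources[of T] correct by (simp add: min_def)
    qed
  qed
  ultimately show ?thesis unfolding las_vegas_def using prob[OF T] p by simp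
qed

section \<open>Encodings\<close>

text \<open>The cutting rule of \<open>records\<close> for a single memory; the program also uses it
  to parse its input.\<close>

definition chunks :: "nat \<Rightarrow> 'a list \<Rightarrow> 'a list set" where
  "chunks L xs = {take L (drop (i * L) xs) | i. i * L < length xs}"

lemma length_concat_const: "(\<And>x. x \<in> set xs \<Longrightarrow> length x = L) \<Longrightarrow> length (concat xs) = length xs * L"
  by (induction xs) auto

lemma take_drop_concat:
  assumes "\<And>x. x \<in> set xs \<Longrightarrow> length x = L" "i < length xs"
  shows "take L (drop (i * L) (concat xs)) = xs ! i"
  using assms
proof (induction xs arbitrary: i)
  case (Cons x xs)
  then show ?case
    by (cases i) (auto simp: drop_append)
qed simp

lemma chunks_concat:
  assumes "\<And>x. x \<in> set xs \<Longrightarrow> length x = L" "0 < L"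
  shows "chunks L (concat xs) = set xs"
proof -
  have "i * L < length (concat xs) \<longleftrightarrow> i < length xs" for i
    using length_concat_const[of xs L] assms by simp
  then have "chunks L (concat xs) = {xs ! i | i. i < length xs}"
    unfolding chunks_def using take_drop_concat[OF assms(1)] by (intro Collect_cong) metis
  then show ?thesis by (simp add: set_conv_nth)
qed

text \<open>Any listing will do: wherever a message or a memory stores a set in this way, only the
  set of its words is read back.\<close>

definition enum :: "'a set \<Rightarrow> 'a list" where
  "enum A = (SOME xs. set xs = A \<and> distinct xs)"

lemma enum: "finite A \<Longrightarrow> set (enum A) = A \<and> distinct (enum A)"
  unfolding enum_def using finite_distinct_list[of A] by (rule someI_ex)

lemma set_enum [simp]: "finite A \<Longrightarrow> set (enum A) = A"
  using enum by blast

lemma length_enum [simp]: "finite A \<Longrightarrow> length (enum A) = card A"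
  using enum distinct_card by metis

lemma enum_empty [simp]: "enum {} = []"
  by (metis finite.emptyI set_empty set_enum)

definition addressed_to :: "nat set \<Rightarrow> nat \<Rightarrow> nat set" where
  "addressed_to A j = {w. prod_encode (j, w) \<in> A}"

lemma finite_addressed_to: "finite A \<Longrightarrow> finite (addressed_to A j)"
  unfolding addressed_to_def
  by (rule finite_subset[of _ "(\<lambda>n. snd (prod_decode n)) ` A"]) (auto intro!: rev_image_eqI)

lemma card_addressed_to:
  assumes "finite A"
  shows "(\<Sum>j<m. card (addressed_to A j)) \<le> card A"
proof -
  have "(\<Sum>j<m. card (addressed_to A j)) = card (SIGMA j:{..<m}. addressed_to A j)"
    using finite_addressed_to[OF assms] by (simp add: card_SigmaI)
  also have "\<dots> \<le> card A"
    by (rule card_inj_on_le[of prod_encode]) (use assms in \<open>auto simp: addressed_to_def inj_on_def\<close>)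
  finally show ?thesis .
qed

text \<open>Cantor pairing grows quadratically: the code is below \<open>2 * N ^ (2 * e)\<close>,
  and \<open>2 \<le> N\<close> turns the factor 2 into one more power of \<open>N\<close>.\<close>

lemma prod_encode_less:
  assumes "a < N ^ e" "b < N ^ e" "2 \<le> N"
  shows "prod_encode (a, b) < N ^ (2 * e + 1)"
proof -
  define M where "M = N ^ e - 1"
  have ab: "a \<le> M" "b \<le> M" and M: "N ^ e = M + 1" using assms by (auto simp: M_def)
  have "triangle (a + b) \<le> triangle (2 * M)"
    unfolding triangle_def using ab by (intro div_le_mono mult_le_mono) auto
  also have "triangle (2 * M) = M * (2 * M + 1)"
    unfolding triangle_def by (simp add: mult.assoc)
  finally have "prod_encode (a, b) \<le> M * (2 * M + 1) + M"
    unfolding prod_encode_def using ab by simp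
  also have "\<dots> < 2 * ((M + 1) * (M + 1))" by (simp add: algebra_simps)
  also have "\<dots> \<le> N * (N ^ e * N ^ e)" using assms(3) M by (intro mult_le_mono) auto
  also have "\<dots> = N ^ (2 * e + 1)" by (simp add: power_add mult_2)
  finally show ?thesis .
qed

text \<open>Each list element costs one pairing, which maps an exponent \<open>e\<close> to
  \<open>2 * e + 1\<close>, and one more power for the \<open>Suc\<close> in
  \<open>list_encode\<close>. The growth is exponential in the length, but node lists have the
  constant length \<open>d + k\<close>.\<close>

fun code_exp :: "nat \<Rightarrow> nat \<Rightarrow> nat" where
  "code_exp K 0 = K"
| "code_exp K (Suc q) = 2 * code_exp K q + 2"

lemma code_exp_ge: "K \<le> code_exp K q"
  by (induction q) auto

lemma list_encode_less:
  assumes "2 \<le> N" "\<And>w. w \<in> set v \<Longrightarrow> w < N ^ K"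
  shows "list_encode v < N ^ code_exp K (length v)"
  using assms(2)
proof (induction v)
  case Nil
  then show ?case using assms(1) by simp
next
  case (Cons x v)
  have "N ^ K \<le> N ^ code_exp K (length v)"
    using assms(1) code_exp_ge by (intro power_increasing) auto
  then have "x < N ^ code_exp K (length v)" using Cons(2)[of x] by simp
  moreover have "list_encode v < N ^ code_exp K (length v)" using Cons by simp
  ultimately have "prod_encode (x, list_encode v) < N ^ (2 * code_exp K (length v) + 1)"
    using assms(1) by (rule prod_encode_less)
  moreover have "N ^ (2 * code_exp K (length v) + 1) < N ^ (2 * code_exp K (length v) + 2)"
    using assms(1) by (intro power_strict_increasing) auto
  ultimately have "Suc (prod_encode (x, list_encode v)) < N ^ (2 * code_exp K (length v) + 2)"
    by linarith
  then show ?case by simp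
qed

section \<open>Cells\<close>

text \<open>For \<open>0 < L\<close> this fails exactly if all integers at distance at most
  \<open>c\<close> from \<open>x\<close> lie in the same block of length \<open>L\<close> as
  \<open>x\<close>.\<close>

definition near_wall :: "nat \<Rightarrow> nat \<Rightarrow> nat \<Rightarrow> bool" where
  "near_wall L c x \<longleftrightarrow> x mod L < c \<or> L \<le> x mod L + c"

definition near_border :: "nat \<Rightarrow> nat \<Rightarrow> nat \<Rightarrow> nat \<Rightarrow> nat list \<Rightarrow> bool" where
  "near_border d L c a v \<longleftrightarrow> (\<exists>i<d. near_wall L c (v ! i + a))"

text \<open>A cube is coded by one number so that it can serve as a sorting key. The balancing needs
  only that equal cubes have equal keys and that no key is frequent.\<close>

definition cell :: "nat \<Rightarrow> nat \<Rightarrow> nat \<Rightarrow> nat list \<Rightarrow> nat" where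
  "cell d L a v = list_encode (map (\<lambda>i. (v ! i + a) div L) [0..<d])"

text \<open>The sums \<open>x + a\<close> for \<open>a < L\<close> have pairwise different residues,
  and at most \<open>2 * c\<close> residues are near a wall.\<close>

lemma card_near_wall:
  assumes "0 < L"
  shows "card {a. a < L \<and> near_wall L c (x + a)} \<le> 2 * c"
proof -
  let ?A = "{a. a < L \<and> near_wall L c (x + a)}"
  have "inj_on (\<lambda>a. (x + a) mod L) ?A"
  proof (rule inj_onI)
    fix a b assume ab: "a \<in> ?A" "b \<in> ?A" "(x + a) mod L = (x + b) mod L"
    have *: "a = b" if "a \<le> b" "a < L" "b < L" "(x + a) mod L = (x + b) mod L" for a b
    proof -
      have "L dvd (x + b) - (x + a)" using that(1,4) mod_eq_dvd_iff_nat[of "x + a" "x + b" L] by simp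
      then have "b - a = 0" using that(3) nat_dvd_not_less[of "b - a" L] by fastforce
      then show ?thesis using that(1) by simp
    qed
    show "a = b" using *[of a b] *[of b a] ab by (cases "a \<le> b") auto
  qed
  moreover have "(\<lambda>a. (x + a) mod L) ` ?A \<subseteq> {..<c} \<union> {L - c..<L}"
    using assms by (auto simp: near_wall_def)
  ultimately have "card ?A \<le> card ({..<c} \<union> {L - c..<L})" by (intro card_inj_on_le) auto
  also have "\<dots> \<le> 2 * c" using card_Un_le[of "{..<c}" "{L - c..<L}"] by simp
  finally show ?thesis .
qed

lemma card_near_border_shifts:
  assumes "0 < L"
  shows "card {a. a < L \<and> near_border d L c a v} \<le> 2 * c * d"
proof -
  have "{a. a < L \<and> near_border d L c a v} = (\<Union>i<d. {a. a < L \<and> near_wall L c (v ! i + a)})"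
    by (auto simp: near_border_def)
  also have "card \<dots> \<le> (\<Sum>i<d. card {a. a < L \<and> near_wall L c (v ! i + a)})"
    by (intro card_UN_le) simp
  also have "\<dots> \<le> (\<Sum>i<d. 2 * c)" by (intro sum_mono card_near_wall assms)
  finally show ?thesis by (simp add: mult.commute)
qed

text \<open>Double counting of the pairs of a node and a shift that is bad for it.\<close>

lemma sum_card_near_border:
  assumes "0 < L" "finite V"
  shows "(\<Sum>a<L. card {v \<in> V. near_border d L c a v}) \<le> card V * (2 * c * d)"
proof -
  have "(\<Sum>a<L. card {v \<in> V. near_border d L c a v}) = (\<Sum>a<L. \<Sum>v\<in>V. if near_border d L c a v then 1 else 0)"
    using assms(2) by (simp add: sum.If_cases Int_def)
  also have "\<dots> = (\<Sum>v\<in>V. \<Sum>a<L. if near_border d L c a v then 1 else 0)" by (rule sum.swap)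
  also have "\<dots> = (\<Sum>v\<in>V. card {a. a < L \<and> near_border d L c a v})"
    by (simp add: sum.If_cases Int_def)
  also have "\<dots> \<le> (\<Sum>v\<in>V. 2 * c * d)" by (intro sum_mono card_near_border_shifts assms)
  finally show ?thesis by simp
qed

lemma near_wall_if_different_cells:
  assumes "x div L \<noteq> y div L" "y \<le> x + c" "x \<le> y + c" "0 < L"
  shows "near_wall L c x"
proof (rule ccontr)
  assume "\<not> near_wall L c x"
  then have n: "c \<le> x mod L" "x mod L + c < L" by (auto simp: near_wall_def)
  have x: "x = L * (x div L) + x mod L" by simp
  have "L * (x div L) \<le> y" using x n assms by linarith
  moreover have "y < L * (x div L) + L" using x n assms by linarith
  ultimately have "y div L = x div L"
    using assms(4) by (intro div_nat_eqI) (auto simp: algebra_simps)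
  then show False using assms by simp
qed

lemma near_border_if_different_cells:
  assumes "cell d L a u \<noteq> cell d L a v" "\<And>i. i < d \<Longrightarrow> u ! i \<le> v ! i + c \<and> v ! i \<le> u ! i + c" "0 < L"
  shows "near_border d L c a u"
proof -
  obtain i where "i < d" "(u ! i + a) div L \<noteq> (v ! i + a) div L"
    using assms(1) unfolding cell_def list_encode_eq by auto
  then show ?thesis unfolding near_border_def
    using near_wall_if_different_cells[of "u ! i + a" L "v ! i + a" c] assms(2,3) by fastforce
qed

text \<open>Within a cube, the remainders modulo \<open>L\<close> determine the position, and
  positions are distinct.\<close>

lemma card_cell:
  assumes "inj_on (position d) V" "\<And>v. v \<in> V \<Longrightarrow> d \<le> length v" "0 < L"
  shows "card {v \<in> V. cell d L a v = z} \<le> L ^ d"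
proof -
  let ?A = "{v \<in> V. cell d L a v = z}"
  let ?f = "\<lambda>v. map (\<lambda>i. (v ! i + a) mod L) [0..<d]"
  have "inj_on ?f ?A"
  proof (rule inj_onI)
    fix u v assume uv: "u \<in> ?A" "v \<in> ?A" "?f u = ?f v"
    have "u ! i = v ! i" if "i < d" for i
    proof -
      have "(u ! i + a) mod L = (v ! i + a) mod L" using uv(3) that by simp
      moreover have "map (\<lambda>i. (u ! i + a) div L) [0..<d] = map (\<lambda>i. (v ! i + a) div L) [0..<d]"
        using uv(1,2) by (simp add: cell_def list_encode_eq[symmetric] del: map_eq_conv)
      then have "(u ! i + a) div L = (v ! i + a) div L" using that by simp
      ultimately show ?thesis by (metis add_right_cancel div_mult_mod_eq)
    qed
    then have "position d u = position d v"
      unfolding position_def using assms(2) uv by (intro nth_equalityI) auto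
    then show "u = v" using assms(1) uv by (auto dest: inj_onD)
  qed
  moreover have "?f ` ?A \<subseteq> {xs. set xs \<subseteq> {..<L} \<and> length xs = d}" using assms(3) by auto
  ultimately have "card ?A \<le> card {xs. set xs \<subseteq> {..<L} \<and> length xs = d}"
    by (intro card_inj_on_le[of ?f]) (auto intro: finite_lists_length_eq)
  then show ?thesis using card_lists_length_eq[of "{..<L}" d] by simp
qed

section \<open>Regular sampling\<close>

definition num_less :: "('a \<Rightarrow> nat) \<Rightarrow> 'a set \<Rightarrow> nat \<Rightarrow> nat" where
  "num_less \<kappa> X z = card {v \<in> X. \<kappa> v < z}"

text \<open>Sample \<open>p\<close> is one more than the key of rank \<open>(p + 1) * t\<close> in
  sorted order, so it may exceed every key by one.\<close>

definition samples :: "('a \<Rightarrow> nat) \<Rightarrow> nat \<Rightarrow> 'a set \<Rightarrow> nat list" where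
  "samples \<kappa> t X = map (\<lambda>p. LEAST z. (p + 1) * t \<le> num_less \<kappa> X z) [0..<card X div t]"

lemma num_less_mono: "finite X \<Longrightarrow> y \<le> z \<Longrightarrow> num_less \<kappa> X y \<le> num_less \<kappa> X z"
  unfolding num_less_def by (rule card_mono) auto

lemma num_less_le_card: "finite X \<Longrightarrow> num_less \<kappa> X z \<le> card X"
  unfolding num_less_def by (rule card_mono) auto

lemma length_samples [simp]: "length (samples \<kappa> t X) = card X div t"
  by (simp add: samples_def)

lemma num_less_eq_card: "(\<And>v. v \<in> X \<Longrightarrow> \<kappa> v < N) \<Longrightarrow> num_less \<kappa> X N = card X"
  unfolding num_less_def by (rule arg_cong[of _ _ card]) auto

lemma samples_le:
  assumes "\<And>v. v \<in> X \<Longrightarrow> \<kappa> v < N" "z \<in> set (samples \<kappa> t X)"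
  shows "z \<le> N"
proof -
  obtain p where p: "p < card X div t" "z = (LEAST z. (p + 1) * t \<le> num_less \<kappa> X z)"
    using assms(2) by (auto simp: samples_def)
  have "(p + 1) * t \<le> card X div t * t" using p(1) by (intro mult_le_mono1) simp
  then have "(p + 1) * t \<le> card X" by (meson div_times_less_eq_dividend le_trans)
  then have "(p + 1) * t \<le> num_less \<kappa> X N" using num_less_eq_card[of X \<kappa> N] assms(1) by simp
  then show ?thesis unfolding p(2) by (rule Least_le)
qed

text \<open>By minimality, sample \<open>p\<close> is at most \<open>z\<close> iff
  \<open>(p + 1) * t \<le> num_less \<kappa> X z\<close>. Counting samples thus recovers the rank of
  \<open>z\<close> in \<open>X\<close> up to an error below \<open>t\<close>.\<close>

lemma count_samples:
  assumes "finite X" "0 < t"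
  shows "length (filter (\<lambda>s. s \<le> z) (samples \<kappa> t X)) = num_less \<kappa> X z div t"
proof -
  let ?s = "\<lambda>p. LEAST z. (p + 1) * t \<le> num_less \<kappa> X z"
  have s: "?s p \<le> z \<longleftrightarrow> p < num_less \<kappa> X z div t" if p: "p < card X div t" for p
  proof -
    have "\<exists>N. \<forall>v\<in>X. \<kappa> v < N" using assms(1)
      by (metis finite_imageI finite_nat_set_iff_bounded imageI)
    then obtain N where "\<And>v. v \<in> X \<Longrightarrow> \<kappa> v < N" by blast
    then have "num_less \<kappa> X N = card X" by (rule num_less_eq_card)
    moreover have "(p + 1) * t \<le> card X div t * t" using p by (intro mult_le_mono1) simp
    then have "(p + 1) * t \<le> card X" by (meson div_times_less_eq_dividend le_trans)
    ultimately have L: "(p + 1) * t \<le> num_less \<kappa> X (?s p)" by (metis (mono_tags, lifting) LeastI)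
    have "?s p \<le> z \<longleftrightarrow> (p + 1) * t \<le> num_less \<kappa> X z"
    proof
      assume "?s p \<le> z"
      then show "(p + 1) * t \<le> num_less \<kappa> X z" using L num_less_mono[OF assms(1)] le_trans by blast
    qed (rule Least_le)
    also have "\<dots> \<longleftrightarrow> p < num_less \<kappa> X z div t"
      using assms(2) by (simp add: less_eq_div_iff_mult_less_eq Suc_le_eq[symmetric])
    finally show ?thesis .
  qed
  have "length (filter (\<lambda>s. s \<le> z) (samples \<kappa> t X)) = length (filter (\<lambda>p. ?s p \<le> z) [0..<card X div t])"
    unfolding samples_def by (simp add: filter_map o_def)
  also have "\<dots> = card {p. p < card X div t \<and> ?s p \<le> z}"
    by (subst distinct_card[symmetric]) (auto intro: arg_cong[of _ _ card])
  also have "{p. p < card X div t \<and> ?s p \<le> z} = {..<num_less \<kappa> X z div t}"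
    using s div_le_mono[OF num_less_le_card[OF assms(1)], of \<kappa> z t] by fastforce
  finally show ?thesis by simp
qed

lemma le_add_if_div_eq:
  fixes x y k j :: nat
  assumes "x div k = j" "y div k = j" "0 < k"
  shows "y \<le> x + k"
proof -
  have "y mod k < k" using assms(3) by simp
  moreover have "y = k * j + y mod k" "x = k * j + x mod k"
    using mult_div_mod_eq[of k x] mult_div_mod_eq[of k y] unfolding assms(1,2) by simp_all
  ultimately show ?thesis by linarith
qed

text \<open>The sum of the quotients is the rank in \<open>V\<close> divided by \<open>t\<close>, up
  to a rounding loss below 1 for each \<open>X i\<close>. Keys of one bucket differ in this sum by
  at most \<open>m + 1\<close>, hence in rank by at most \<open>t * (m + 1) + t * m\<close>. The
  remaining \<open>D\<close> pays for the elements with the largest key, which strict counts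
  omit.\<close>

lemma card_bucket:
  fixes \<kappa> :: "'a \<Rightarrow> nat"
  assumes fin: "\<And>i. i < m \<Longrightarrow> finite (X i)" and disj: "\<And>i j. i < m \<Longrightarrow> j < m \<Longrightarrow> i \<noteq> j \<Longrightarrow> X i \<inter> X j = {}"
    and V: "V = (\<Union>i<m. X i)" and t: "0 < t"
    and D: "\<And>z. card {v \<in> V. \<kappa> v = z} \<le> D"
  shows "card {v \<in> V. (\<Sum>i<m. num_less \<kappa> (X i) (\<kappa> v) div t) div (m + 1) = j} \<le> t * (m + 1) + t * m + D"
proof -
  let ?R = "\<lambda>z. \<Sum>i<m. num_less \<kappa> (X i) z div t"
  let ?C = "{v \<in> V. ?R (\<kappa> v) div (m + 1) = j}"
  have finV: "finite V" using fin V by simp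
  then have finC: "finite ?C" by simp
  show ?thesis
  proof (cases "?C = {}")
    case False
    let ?lo = "Min (\<kappa> ` ?C)" and ?hi = "Max (\<kappa> ` ?C)"
    have "?lo \<in> \<kappa> ` ?C" "?hi \<in> \<kappa> ` ?C" using finC False by (auto intro: Min_in Max_in simp del: Min_in Max_in)
    then have j: "?R ?lo div (m + 1) = j" "?R ?hi div (m + 1) = j" by auto
    have R: "?R ?hi \<le> ?R ?lo + (m + 1)"
      using j by (rule le_add_if_div_eq) simp
    have num_less_V: "num_less \<kappa> V z = (\<Sum>i<m. num_less \<kappa> (X i) z)" for z
    proof -
      have "{v \<in> V. \<kappa> v < z} = (\<Union>i<m. {v \<in> X i. \<kappa> v < z})" using V by auto
      moreover have "{v \<in> X i. \<kappa> v < z} \<inter> {v \<in> X j. \<kappa> v < z} = {}" if "i < m" "j < m" "i \<noteq> j" for i j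
        using disj[OF that] by auto
      ultimately show ?thesis unfolding num_less_def
        using fin by (simp add: card_UN_disjoint)
    qed
    have lo: "t * ?R ?lo \<le> num_less \<kappa> V ?lo"
      unfolding num_less_V sum_distrib_left by (intro sum_mono) simp
    have "num_less \<kappa> V ?hi \<le> (\<Sum>i<m. t * (num_less \<kappa> (X i) ?hi div t) + t)"
      unfolding num_less_V
    proof (intro sum_mono)
      fix i
      have "num_less \<kappa> (X i) ?hi = t * (num_less \<kappa> (X i) ?hi div t) + num_less \<kappa> (X i) ?hi mod t" by simp
      moreover have "num_less \<kappa> (X i) ?hi mod t < t" using t by simp
      ultimately show "num_less \<kappa> (X i) ?hi \<le> t * (num_less \<kappa> (X i) ?hi div t) + t" by linarith
    qed
    also have "\<dots> = t * ?R ?hi + t * m" by (simp add: sum.distrib sum_distrib_left mult.commute)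
    also have "t * ?R ?hi \<le> t * (?R ?lo + (m + 1))" using R by (rule mult_le_mono2)
    finally have hi: "num_less \<kappa> V ?hi \<le> num_less \<kappa> V ?lo + t * (m + 1) + t * m"
      using lo by (simp add: algebra_simps)
    let ?A = "{v \<in> V. \<kappa> v < ?hi}" and ?B = "{v \<in> V. \<kappa> v < ?lo}" and ?Z = "{v \<in> V. \<kappa> v = ?hi}"
    have C: "\<kappa> v \<le> ?hi" "?lo \<le> \<kappa> v" if "v \<in> ?C" for v
      using finC that by (auto intro: Max_ge Min_le)
    obtain v where "v \<in> ?C" using False by blast
    then have "?lo \<le> ?hi" using C order_trans by blast
    then have BA: "?B \<subseteq> ?A" by (auto intro: less_le_trans)
    have "v \<in> (?A - ?B) \<union> ?Z" if v: "v \<in> ?C" for v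
    proof -
      have "v \<in> V" using v by simp
      then show ?thesis using C[OF v] by (simp add: le_less not_less)
    qed
    then have "?C \<subseteq> (?A - ?B) \<union> ?Z" by (rule subsetI)
    then have "card ?C \<le> card ((?A - ?B) \<union> ?Z)"
      by (rule card_mono[rotated]) (simp add: finV)
    also have "\<dots> \<le> card (?A - ?B) + card ?Z" by (rule card_Un_le)
    also have "card (?A - ?B) = num_less \<kappa> V ?hi - num_less \<kappa> V ?lo"
      unfolding num_less_def[of \<kappa> V] by (rule card_Diff_subset[OF _ BA]) (simp add: finV)
    finally show ?thesis using hi D[of ?hi] by linarith
  next
    case True
    show ?thesis unfolding True by simp
  qed
qed

section \<open>The scales of the algorithm\<close>

definition side :: "nat \<Rightarrow> real \<Rightarrow> nat \<Rightarrow> nat" where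
  "side d \<alpha> n = nat \<lceil>memory_scale \<alpha> n powr (1 / real d)\<rceil>"

text \<open>The step \<open>s / m\<close> balances two costs: all machines together produce at most
  \<open>m * m\<close> samples, and the rounding errors of \<open>m\<close> machines still sum to
  only \<open>O(s)\<close> nodes.\<close>

definition sample_step :: "real \<Rightarrow> nat \<Rightarrow> nat" where
  "sample_step \<alpha> n = nat \<lceil>memory_scale \<alpha> n / real (num_machines \<alpha> n)\<rceil>"

lemma nat_ceiling_bounds:
  fixes x :: real
  assumes "0 < x"
  shows "x \<le> real (nat \<lceil>x\<rceil>)" "real (nat \<lceil>x\<rceil>) < x + 1" "1 \<le> nat \<lceil>x\<rceil>"
  using assms by linarith+

locale grid_scales =
  fixes d :: nat and \<alpha> :: real and n :: nat
  assumes d: "2 \<le> d"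
    and \<alpha>_gt: "max ((real d + 1) / (real d + 2)) (4 / 5) < \<alpha>" and \<alpha>_less: "\<alpha> < 1"
    and n: "1 \<le> n"
begin

abbreviation "s \<equiv> memory_scale \<alpha> n"
abbreviation "m \<equiv> num_machines \<alpha> n"
abbreviation "L \<equiv> side d \<alpha> n"
abbreviation "t \<equiv> sample_step \<alpha> n"

lemma powr_n_mono: "x \<le> y \<Longrightarrow> real n powr x \<le> real n powr y"
  using n by (intro powr_mono) auto

lemma \<alpha>_pos: "4 / 5 < \<alpha>"
  using \<alpha>_gt by simp

lemma s_ge_1: "1 \<le> s"
  unfolding memory_scale_def using n \<alpha>_pos by (intro ge_one_powr_ge_zero) auto

lemma s_le_n: "s \<le> real n"
  using powr_n_mono[of \<alpha> 1] \<alpha>_less n by (simp add: memory_scale_def)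

lemma n_div_s: "real n / s = real n powr (1 - \<alpha>)"
  using n by (simp add: memory_scale_def powr_diff)

lemma n_div_s_ge_1: "1 \<le> real n / s"
  using s_le_n s_ge_1 by (simp add: field_simps)

lemma m_ge: "real n / s \<le> real m" and m_pos: "1 \<le> m" and m_le: "real m \<le> 2 * (real n / s)"
  using nat_ceiling_bounds[of "real n / s"] n_div_s_ge_1 unfolding num_machines_def by auto

lemma m_le_n: "m \<le> n"
proof -
  have "real n / s \<le> real n" using s_ge_1 by (simp add: field_simps mult_le_cancel_left1)
  then show ?thesis unfolding num_machines_def by linarith
qed

lemma m_square_le: "real m * real m \<le> 4 * s"
proof -
  have "real m * real m \<le> (2 * real n powr (1 - \<alpha>)) * (2 * real n powr (1 - \<alpha>))"
    using m_le by (intro mult_mono) (auto simp: n_div_s)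
  also have "\<dots> = 4 * real n powr (2 - 2 * \<alpha>)"
    by (simp add: powr_add[symmetric])
  also have "\<dots> \<le> 4 * real n powr \<alpha>"
    using \<alpha>_pos powr_n_mono[of "2 - 2 * \<alpha>" \<alpha>] by simp
  finally show ?thesis by (simp add: memory_scale_def)
qed

lemma m_le_s: "real m \<le> 4 * s"
proof -
  have "real m * 1 \<le> real m * real m" using m_pos by (intro mult_left_mono) auto
  then show ?thesis using m_square_le by linarith
qed

lemma root_s: "s powr (1 / real d) = real n powr (\<alpha> / real d)"
  by (simp add: memory_scale_def powr_powr)

lemma root_s_ge_1: "1 \<le> s powr (1 / real d)"
  using s_ge_1 by (intro ge_one_powr_ge_zero) auto

lemma L_ge: "s powr (1 / real d) \<le> real L" and L_pos: "1 \<le> L"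
  and L_le: "real L \<le> 2 * s powr (1 / real d)"
proof -
  have "0 < s powr (1 / real d)" using root_s_ge_1 by linarith
  note b = nat_ceiling_bounds[OF this]
  show "s powr (1 / real d) \<le> real L" "1 \<le> L" unfolding side_def by (rule b)+
  show "real L \<le> 2 * s powr (1 / real d)" using b(2) root_s_ge_1 unfolding side_def by linarith
qed

lemma L_le_n: "L \<le> n"
proof -
  have "\<alpha> / real d \<le> 1" using d \<alpha>_less by (simp add: field_simps)
  then have "s powr (1 / real d) \<le> real n" unfolding root_s using powr_n_mono[of "\<alpha> / real d" 1] n by simp
  then show ?thesis unfolding side_def by linarith
qed

text \<open>The volume of the first exchange, in which each machine sends its \<open>L\<close>
  counts to all others. As \<open>2 \<le> d\<close>, the exponent
  \<open>1 - \<alpha> + \<alpha> / d\<close> is at most \<open>1 - \<alpha> / 2\<close>, and this is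
  at most \<open>\<alpha>\<close>.\<close>

lemma m_L_le: "real m * real L \<le> 4 * s"
proof -
  have "real m * real L \<le> (2 * real n powr (1 - \<alpha>)) * (2 * real n powr (\<alpha> / real d))"
    using m_le L_le by (intro mult_mono) (auto simp: n_div_s root_s)
  also have "\<dots> = 4 * real n powr (1 - \<alpha> + \<alpha> / real d)"
    by (simp only: powr_add)
  also have "\<dots> \<le> 4 * real n powr \<alpha>"
  proof -
    have "\<alpha> / real d \<le> \<alpha> / 2" using d \<alpha>_pos by (intro divide_left_mono) auto
    then have "1 - \<alpha> + \<alpha> / real d \<le> \<alpha>" using \<alpha>_pos by simp
    then show ?thesis using powr_n_mono by simp
  qed
  finally show ?thesis by (simp add: memory_scale_def)
qed

lemma L_power_le: "real (L ^ d) \<le> 2 ^ d * s"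
proof -
  have pos: "0 < s powr (1 / real d)" using root_s_ge_1 by linarith
  have "real (L ^ d) \<le> (2 * s powr (1 / real d)) ^ d"
    unfolding of_nat_power using L_le by (intro power_mono) auto
  also have "\<dots> = 2 ^ d * (s powr (1 / real d)) powr real d"
    unfolding power_mult_distrib using powr_realpow[OF pos, of d] by simp
  also have "(s powr (1 / real d)) powr real d = s"
    using d s_ge_1 by (simp add: powr_powr)
  finally show ?thesis .
qed

lemma t_ge: "s / real m \<le> real t" and t_pos: "1 \<le> t" and t_le: "real t \<le> s / real m + 1"
  using nat_ceiling_bounds[of "s / real m"] s_ge_1 m_pos unfolding sample_step_def by auto

lemma t_m_le: "real t * real m \<le> 5 * s"
proof -
  have "real t * real m \<le> (s / real m + 1) * real m" using t_le by (intro mult_right_mono) auto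
  also have "\<dots> = s + real m" using m_pos by (simp add: field_simps)
  finally show ?thesis using m_le_s by simp
qed

lemma div_t_le: "real (x div t) \<le> real x * real m / s"
proof -
  have "real (x div t * t) \<le> real x" by (simp only: of_nat_le_iff div_times_less_eq_dividend)
  then have "real (x div t) \<le> real x / real t" using t_pos by (simp add: field_simps)
  also have "\<dots> \<le> real x / (s / real m)"
    using t_ge t_pos s_ge_1 m_pos by (intro divide_left_mono mult_pos_pos divide_pos_pos) auto
  finally show ?thesis by simp
qed

lemma bucket_le: "real (t * (m + 1) + t * m + L ^ d) \<le> (15 + 2 ^ d) * s"
proof -
  have "real t \<le> real t * real m" using m_pos by (simp add: mult_le_cancel_left1)
  then show ?thesis using t_m_le L_power_le by (simp add: algebra_simps)
qed

lemma input_le: "real_of_int \<lceil>real n / real m\<rceil> \<le> 2 * s"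
proof -
  have "real n \<le> real m * s" using m_ge s_ge_1 by (simp add: field_simps)
  then have "real n / real m \<le> s" using m_pos by (simp add: field_simps)
  then show ?thesis using s_ge_1 by linarith
qed

lemma n_div_t_le: "n div t \<le> m * m"
proof -
  have "real n * real m / s \<le> real m * real m"
    using mult_right_mono[OF m_ge, of "real m"] by simp
  then have "real (n div t) \<le> real (m * m)" using div_t_le[of n] by simp
  then show ?thesis by (simp only: of_nat_le_iff)
qed

lemma c_n_le:
  assumes c: "real c \<le> s powr (1 / real (d ^ 3))"
  shows "real c * real n \<le> s * real L"
proof -
  have D: "0 < real d" using d by simp
  \<comment> \<open>Multiplied by \<open>x ^ 3\<close>, the claim reads
    \<open>x ^ 3 \<le> \<alpha> * (x ^ 3 + x ^ 2 - 1)\<close>. Inserting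
    \<open>(x + 1) / (x + 2)\<close> for \<open>\<alpha>\<close> leaves
    \<open>0 \<le> x ^ 2 - x - 1\<close>, true from \<open>x = 2\<close> on.\<close>
  have "1 \<le> (\<alpha> + \<alpha> / real d) - \<alpha> / real (d ^ 3)"
  proof -
    define x where "x = real d"
    have x: "2 \<le> x" using d by (simp add: x_def)
    have "(x + 1) / (x + 2) < \<alpha>" using \<alpha>_gt by (simp add: x_def)
    then have a: "x + 1 < \<alpha> * (x + 2)" using x by (simp add: field_simps)
    have q: "0 \<le> x ^ 3 + x ^ 2 - 1"
      using power_mono[OF x, of 3] power_mono[OF x, of 2] by simp
    have "x ^ 3 * (x + 2) \<le> (x + 1) * (x ^ 3 + x ^ 2 - 1)"
    proof -
      have "(x + 1) * (x ^ 3 + x ^ 2 - 1) - x ^ 3 * (x + 2) = x * (x - 1) - 1"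
        by (simp add: algebra_simps power2_eq_square power3_eq_cube)
      moreover have "2 * 1 \<le> x * (x - 1)" using x by (intro mult_mono) auto
      ultimately show ?thesis by linarith
    qed
    also have "\<dots> \<le> (\<alpha> * (x + 2)) * (x ^ 3 + x ^ 2 - 1)"
      using a q by (intro mult_right_mono) auto
    finally have "x ^ 3 * (x + 2) \<le> (\<alpha> * (x ^ 3 + x ^ 2 - 1)) * (x + 2)"
      by (simp add: algebra_simps)
    then have "x ^ 3 \<le> \<alpha> * (x ^ 3 + x ^ 2 - 1)" using x by (simp add: mult_le_cancel_right)
    then have "1 \<le> \<alpha> * (x ^ 3 + x ^ 2 - 1) / x ^ 3" using x by (simp add: field_simps)
    also have "\<dots> = (\<alpha> + \<alpha> / x) - \<alpha> / x ^ 3"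
      using x by (simp add: field_simps power2_eq_square power3_eq_cube)
    finally show ?thesis by (simp add: x_def)
  qed
  then have e: "\<alpha> / real (d ^ 3) + 1 \<le> \<alpha> + \<alpha> / real d" by simp
  have "real c * real n \<le> real n powr (\<alpha> / real (d ^ 3)) * real n powr 1"
    using c n by (intro mult_mono) (auto simp: memory_scale_def powr_powr)
  also have "\<dots> = real n powr (\<alpha> / real (d ^ 3) + 1)" by (simp only: powr_add)
  also have "\<dots> \<le> real n powr (\<alpha> + \<alpha> / real d)" using e by (rule powr_n_mono)
  also have "\<dots> = s * s powr (1 / real d)" unfolding root_s powr_add by (simp add: memory_scale_def)
  also have "\<dots> \<le> s * real L" using L_ge s_ge_1 by (intro mult_left_mono) auto
  finally show ?thesis .
qed

end

section \<open>The program\<close>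

text \<open>These numbers are in general far too large for a word. They are only compared in local
  computations, never stored or sent.\<close>

definition edge_code :: "nat list set \<Rightarrow> nat" where
  "edge_code e = set_encode (list_encode ` e)"

lemma edge_code_inj: "finite e \<Longrightarrow> finite f \<Longrightarrow> edge_code e = edge_code f \<Longrightarrow> e = f"
  unfolding edge_code_def
  by (metis finite_imageI inj_image_eq_iff inj_list_encode set_encode_eq)

definition quad_code :: "nat list \<times> nat list \<times> nat list \<times> nat list \<Rightarrow> nat" where
  "quad_code = (\<lambda>(u, v, x, y). prod_encode
     (prod_encode (list_encode u, list_encode v), prod_encode (list_encode x, list_encode y)))"

lemma quad_code_eq [simp]: "quad_code p = quad_code q \<longleftrightarrow> p = q"
  by (auto simp: quad_code_def list_encode_eq split: prod.splits)

definition ends :: "'a set \<Rightarrow> 'a \<times> 'a" where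
  "ends e = (SOME (u, v). e = {u, v})"

lemma ends: "\<exists>u v. e = {u, v} \<Longrightarrow> (case ends e of (u, v) \<Rightarrow> {u, v}) = e"
proof -
  assume "\<exists>u v. e = {u, v}"
  then have "\<exists>p. case p of (u, v) \<Rightarrow> e = {u, v}" by auto
  from someI_ex[OF this] show ?thesis unfolding ends_def by (auto split: prod.splits)
qed

locale grid_program =
  fixes d k K :: nat and \<alpha> :: real and sem :: rule_semantics
    and n c :: nat and r :: "nat list"
begin

text \<open>\<open>edge_weight\<close> reads nothing but the rule of its graph, so the empty node
  set is a placeholder and weights can be computed without knowing \<open>V\<close>.\<close>

definition weight :: "nat list set \<Rightarrow> real" where
  "weight = edge_weight sem \<lparr>nodes = {}, edge_rule = r\<rparr>"

text \<open>Ties are broken by the edge alone, so all machines agree on the order. The code is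
  injective on finite sets only, which is why \<open>edge_order\<close> asks for totality only
  there.\<close>

definition edge_less :: "nat list set \<Rightarrow> nat list set \<Rightarrow> bool" where
  "edge_less e f \<longleftrightarrow> weight e < weight f \<or> weight e = weight f \<and> edge_code e < edge_code f"

sublocale edge_order edge_less
proof
  show "edge_less e f \<or> edge_less f e" if "finite e" "finite f" "e \<noteq> f" for e f
    using edge_code_inj that unfolding edge_less_def by fastforce
qed (auto simp: edge_less_def)

text \<open>Nodes and rule determine the edges between them, so redistributing nodes is
  enough.\<close>

definition induced_edges :: "nat list set \<Rightarrow> nat list set set" where
  "induced_edges X = edges sem \<lparr>nodes = X, edge_rule = r\<rparr>"

abbreviation near :: "nat \<Rightarrow> nat list \<Rightarrow> bool" where
  "near \<equiv> near_border d (side d \<alpha> n) c"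

abbreviation key :: "nat \<Rightarrow> nat list \<Rightarrow> nat" where
  "key \<equiv> cell d (side d \<alpha> n)"

text \<open>
  The memory of a machine after \<open>p > 0\<close> rounds is \<open>state p a A\<close>, where \<open>a\<close> is the shift of the
  cells and \<open>A\<close> is the set of encoded data. The first word tells it from the input, whose words
  are less than \<open>(n + 1) ^ K\<close>.
\<close>

definition state :: "nat \<Rightarrow> nat \<Rightarrow> nat set \<Rightarrow> nat list" where
  "state p a A = ((n + 1) ^ K + p) # a # enum A"

text \<open>Truncated subtraction yields 0 on input words; \<open>[]\<close> is treated apart
  because \<open>hd []\<close> is unspecified.\<close>

definition phase :: "nat list \<Rightarrow> nat" where
  "phase x = (if x = [] then 0 else hd x - (n + 1) ^ K)"

definition shift :: "nat list \<Rightarrow> nat" where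
  "shift x = x ! 1"

definition content :: "nat list \<Rightarrow> nat set" where
  "content x = set (drop 2 x)"

lemma phase_state [simp]: "phase (state p a A) = p"
  and shift_state [simp]: "shift (state p a A) = a"
  and content_state [simp]: "finite A \<Longrightarrow> content (state p a A) = A"
  by (auto simp: phase_def shift_def content_def state_def)

lemma phase_input: "(\<And>w. w \<in> set x \<Longrightarrow> w < (n + 1) ^ K) \<Longrightarrow> phase x = 0"
  by (cases x) (auto simp: phase_def intro: less_imp_le)

definition local_sketch :: "nat \<Rightarrow> nat list set \<Rightarrow> (nat list \<times> nat list \<times> nat list \<times> nat list) set" where
  "local_sketch a X = sketch {v \<in> X. near a v} (induced_edges X)"

text \<open>The last branch serves both rounds with addressed data: the nodes in phase 2 and the
  replies of machine 0 in phase 4.\<close>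

definition outgoing :: "nat \<Rightarrow> nat list \<Rightarrow> nat \<Rightarrow> nat list" where
  "outgoing i x j =
     (if phase x = 0 then map (\<lambda>a. card {v \<in> chunks (d + k) x. near a v}) [0..<side d \<alpha> n]
      else if phase x = 1 then samples (key (shift x)) (sample_step \<alpha> n) (list_decode ` content x)
      else if phase x = 3 then
        (if j = 0 then enum (quad_code ` local_sketch (shift x) (list_decode ` content x)) else [])
      else enum (addressed_to (content x) j))"

definition destination :: "nat \<Rightarrow> (nat \<Rightarrow> nat list) \<Rightarrow> nat list \<Rightarrow> nat" where
  "destination a y v =
     length (filter (\<lambda>z. z \<le> key a v) (concat (map y [0..<num_machines \<alpha> n])))
       div (num_machines \<alpha> n + 1)"

definition received :: "(nat \<Rightarrow> nat list) \<Rightarrow> nat set" where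
  "received y = (\<Union>l<num_machines \<alpha> n. set (y l))"

text \<open>Both problems share the first three rounds; \<open>final\<close> takes over at phase
  3.\<close>

definition next_state ::
    "(nat list \<Rightarrow> (nat \<Rightarrow> nat list) \<Rightarrow> machine_state) \<Rightarrow>
     nat \<Rightarrow> nat list \<Rightarrow> (nat \<Rightarrow> nat list) \<Rightarrow> machine_state" where
  "next_state final i x y =
     (if phase x = 0 then
        Running (state 1 (arg_min (\<lambda>a. \<Sum>l<num_machines \<alpha> n. y l ! a) (\<lambda>a. a < side d \<alpha> n))
          (list_encode ` chunks (d + k) x))
      else if phase x = 1 then
        Running (state 2 (shift x)
          ((\<lambda>v. prod_encode (destination (shift x) y v, list_encode v)) ` list_decode ` content x))
      else if phase x = 2 then Running (state 3 (shift x) (received y))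
      else final x y)"

definition program :: "(nat list \<Rightarrow> (nat \<Rightarrow> nat list) \<Rightarrow> machine_state) \<Rightarrow> mpc_program" where
  "program final =
     \<lparr>send = outgoing, compute = (\<lambda>i x y. return_pmf (next_state final i x y))\<rparr>"

definition received_sketch :: "nat set \<Rightarrow> (nat list \<times> nat list \<times> nat list \<times> nat list) set" where
  "received_sketch W = {q. quad_code q \<in> W}"

text \<open>Only machine 0 receives sketches. For all others \<open>W\<close> is empty and the
  second part vanishes, so no case distinction on the machine number is needed.\<close>

definition forest_part :: "nat \<Rightarrow> nat list set \<Rightarrow> nat set \<Rightarrow> nat list set set" where
  "forest_part a X W =
     (msf (induced_edges X) - merges {v \<in> X. near a v} (induced_edges X)) \<union>
     global_msf (received_sketch W) (induced_edges (sketch_border (received_sketch W)))"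

definition forest_final :: "nat list \<Rightarrow> (nat \<Rightarrow> nat list) \<Rightarrow> machine_state" where
  "forest_final x y =
     Halted (concat (map (\<lambda>(u, v). position d u @ position d v)
       (enum (ends ` forest_part (shift x) (list_decode ` content x) (received y)))))"

text \<open>Connected border nodes satisfy the same predicate here, so the arbitrary choice is the
  same for all of them.\<close>

definition representative :: "nat set \<Rightarrow> nat list \<Rightarrow> nat list" where
  "representative W b = (let T = received_sketch W; B = sketch_border T in
     SOME b'. b' \<in> B \<and> (b, b') \<in> conn (links T (induced_edges B) (\<lambda>_. True)))"

text \<open>
  The address \<open>num_machines \<alpha> n\<close> belongs to no machine; it marks the nodes that stay.
\<close>

definition replies :: "nat list set \<Rightarrow> (nat \<Rightarrow> nat list) \<Rightarrow> nat set" where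
  "replies X y =
     (\<lambda>v. prod_encode (num_machines \<alpha> n, list_encode v)) ` X \<union>
     (\<Union>l<num_machines \<alpha> n.
        (\<lambda>b. prod_encode (l, prod_encode (list_encode b, list_encode (representative (received y) b))))
          ` sketch_border (received_sketch (set (y l))))"

text \<open>If the local component meets the border, any of its border nodes leads to the same
  reply. Otherwise it is a component of the whole graph, and a local choice is final.\<close>

definition component_node :: "nat \<Rightarrow> nat list set \<Rightarrow> nat set \<Rightarrow> nat list \<Rightarrow> nat list" where
  "component_node a X W v =
     (if \<exists>b\<in>X. near a b \<and> (v, b) \<in> conn (induced_edges X)
      then SOME z. \<exists>b\<in>X. near a b \<and> (v, b) \<in> conn (induced_edges X) \<and>
                  prod_encode (list_encode b, list_encode z) \<in> W
      else SOME z. (v, z) \<in> conn (induced_edges X))"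

definition component_final :: "nat list \<Rightarrow> (nat \<Rightarrow> nat list) \<Rightarrow> machine_state" where
  "component_final x y =
     (if phase x = 3 then Running (state 4 (shift x) (replies (list_decode ` content x) y))
      else (let X = list_decode ` addressed_to (content x) (num_machines \<alpha> n) in
        Halted (concat (map (\<lambda>v. position d v @ position d (component_node (shift x) X (received y) v))
          (enum X)))))"

end

section \<open>The run of the program\<close>

lemma list_decode_encode_image [simp]: "list_decode ` list_encode ` X = X"
  by (simp add: image_image)

lemma addressed_to_image:
  "addressed_to ((\<lambda>v. prod_encode (f v, g v)) ` X) j = g ` {v \<in> X. f v = j}"
  unfolding addressed_to_def by auto

lemma length_filter_concat_upt:
  "length (filter P (concat (map y [0..<m]))) = (\<Sum>i<m. length (filter P (y i)))"
  by (induction m) auto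

lemma disjoint_if_distinct_concat:
  assumes "distinct (concat (map f [0..<m]))" "i < m" "j < m" "i \<noteq> j"
  shows "set (f i) \<inter> set (f j) = {}"
proof -
  have *: "set (f i) \<inter> set (f j) = {}" if "i < j" "j < m" for i j
    using assms(1) that by (induction m) (auto simp: less_Suc_eq disjoint_iff atLeast0LessThan)
  show ?thesis using *[of i j] *[of j i] assms by (cases "i < j") auto
qed

text \<open>The received count lists have only \<open>L\<close> entries, so the computed objective
  agrees with the intended one only for shifts below \<open>L\<close>.\<close>

lemma arg_min_cong: "(\<And>x. P x \<Longrightarrow> f x = g x) \<Longrightarrow> arg_min f P = arg_min g P"
  unfolding arg_min_def is_arg_min_def by (rule arg_cong[of _ _ Eps]) (auto simp: fun_eq_iff)

locale grid_run =
  grid_program d k K \<alpha> sem "card (nodes G)" c "edge_rule G" +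
  grid_scales d \<alpha> "card (nodes G)"
  for d k K \<alpha> sem and G :: implicit_graph and c +
  fixes inp :: "nat \<Rightarrow> nat list list"
  assumes grid: "implicit_grid_graph d c k K sem G"
    and c_le: "real c \<le> s powr (1 / real (d ^ 3))"
    and input: "evenly_distributed m (nodes G) inp"
begin

section \<open>Shift and redistribution for a fixed input\<close>

abbreviation "V \<equiv> nodes G"
abbreviation "X i \<equiv> set (inp i)"

definition best_shift :: nat where
  "best_shift = arg_min (\<lambda>a. \<Sum>l<m. card {v \<in> X l. near a v}) (\<lambda>a. a < L)"

text \<open>What \<open>destination\<close> computes from the samples of all machines. It depends on
  \<open>v\<close> only through its cube, so no cube is split.\<close>

definition dest :: "nat list \<Rightarrow> nat" where
  "dest v = (\<Sum>i<m. num_less (key best_shift) (X i) (key best_shift v) div t) div (m + 1)"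

definition part :: "nat \<Rightarrow> nat list set" where
  "part j = {v \<in> V. dest v = j}"

definition border :: "nat list set" where
  "border = {v \<in> V. near best_shift v}"

lemma finite_V: "finite V"
  using grid by (simp add: implicit_grid_graph_def implicit_graph_def)

lemma length_node: "v \<in> V \<Longrightarrow> length v = d + k"
  and word_node: "v \<in> V \<Longrightarrow> w \<in> set v \<Longrightarrow> w < (card V + 1) ^ K"
  using grid by (auto simp: implicit_grid_graph_def implicit_graph_def)

lemma inj_position: "inj_on (position d) V"
  using grid by (simp add: implicit_grid_graph_def)

lemma X_Un: "V = (\<Union>i<m. X i)" and distinct_inp: "i < m \<Longrightarrow> distinct (inp i)"
  and X_disjoint: "i < m \<Longrightarrow> j < m \<Longrightarrow> i \<noteq> j \<Longrightarrow> X i \<inter> X j = {}"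
proof -
  have d: "distinct (concat (map inp [0..<m]))" and V: "set (concat (map inp [0..<m])) = V"
    using input by (auto simp: evenly_distributed_def)
  show "V = (\<Union>i<m. X i)" using V by (auto simp: atLeast0LessThan)
  show "distinct (inp i)" if "i < m" using d that by (auto simp: distinct_concat_iff)
  show "X i \<inter> X j = {}" if "i < m" "j < m" "i \<noteq> j"
    using disjoint_if_distinct_concat[OF d that] .
qed

lemma X_subset: "i < m \<Longrightarrow> X i \<subseteq> V"
  using X_Un by blast

lemma card_X: "i < m \<Longrightarrow> real (card (X i)) \<le> 2 * s"
proof -
  assume i: "i < m"
  then have "card (X i) = length (inp i)" using distinct_inp distinct_card by blast
  moreover have "int (length (inp i)) \<le> \<lceil>real (card V) / real m\<rceil>"
    using input i by (simp add: evenly_distributed_def)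
  ultimately show ?thesis using input_le by linarith
qed

lemma sum_card_X: "(\<Sum>i<m. card (X i \<inter> A)) = card (V \<inter> A)"
proof -
  have "V \<inter> A = (\<Union>i<m. X i \<inter> A)" using X_Un by auto
  moreover have "(X i \<inter> A) \<inter> (X j \<inter> A) = {}" if "i < m" "j < m" "i \<noteq> j" for i j
    using X_disjoint[OF that] by auto
  ultimately show ?thesis using card_UN_disjoint[of "{..<m}" "\<lambda>i. X i \<inter> A"] by simp
qed

lemma chunks_inp: "i < m \<Longrightarrow> chunks (d + k) (concat (inp i)) = X i"
  using X_subset length_node d by (intro chunks_concat) auto

lemma L_gt_0: "0 < L" using L_pos by simp

lemma best_shift_less: "best_shift < L"
  unfolding best_shift_def by (rule arg_min_natI[of _ 0]) (rule L_gt_0)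

text \<open>The best shift is no worse than the average over all \<open>L\<close> shifts, and
  \<open>c_n_le\<close> bounds that average.\<close>

lemma card_border: "real (card border) \<le> 2 * real d * s"
proof -
  have eq: "(\<Sum>l<m. card {v \<in> X l. near a v}) = card {v \<in> V. near a v}" for a
    using sum_card_X[of "{v. near a v}"] by (simp add: Int_def)
  have "card border \<le> card {v \<in> V. near a v}" if "a < L" for a
    using arg_min_nat_le[of "\<lambda>a. a < L" a "\<lambda>a. \<Sum>l<m. card {v \<in> X l. near a v}"] that
    unfolding best_shift_def[symmetric] unfolding border_def eq by simp
  then have "(\<Sum>a<L. card border) \<le> (\<Sum>a<L. card {v \<in> V. near a v})" by (intro sum_mono) simp
  also have "\<dots> \<le> card V * (2 * c * d)" by (rule sum_card_near_border[OF L_gt_0 finite_V])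
  finally have "real (L * card border) \<le> real (card V * (2 * c * d))" by (simp only: of_nat_le_iff) simp
  also have "\<dots> = 2 * real d * (real c * real (card V))" by simp
  also have "\<dots> \<le> 2 * real d * (s * real L)" using c_n_le[OF c_le] by (intro mult_left_mono) auto
  finally have "real (card border) * real L \<le> (2 * real d * s) * real L" by (simp add: algebra_simps)
  then show ?thesis using L_gt_0 by (simp add: mult_le_cancel_right)
qed

text \<open>There are at most \<open>m * m\<close> samples. Dividing by \<open>m\<close> could
  therefore yield the invalid address \<open>m\<close>; dividing by \<open>m + 1\<close>
  cannot.\<close>

lemma dest_less: "dest v < m"
proof -
  let ?R = "\<Sum>i<m. num_less (key best_shift) (X i) (key best_shift v) div t"
  have "t * ?R \<le> (\<Sum>i<m. card (X i))"
    unfolding sum_distrib_left by (intro sum_mono) (meson List.finite_set le_trans num_less_le_card times_div_less_eq_dividend)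
  also have "\<dots> = card V" using sum_card_X[of UNIV] by simp
  finally have "?R \<le> card V div t" using t_pos by (simp add: less_eq_div_iff_mult_less_eq mult.commute)
  also have "\<dots> \<le> m * m" by (rule n_div_t_le)
  also have "\<dots> < m * (m + 1)" using m_pos by simp
  finally show ?thesis unfolding dest_def by (simp add: div_less_iff_less_mult mult.commute)
qed

lemma finite_part: "finite (part j)"
  using finite_V by (simp add: part_def)

lemma part_subset: "part j \<subseteq> V"
  by (auto simp: part_def)

lemma part_Un: "V = (\<Union>j<m. part j)"
  using dest_less by (auto simp: part_def)

lemma card_part: "real (card (part j)) \<le> (15 + 2 ^ d) * s"
proof -
  have "card (part j) \<le> t * (m + 1) + t * m + L ^ d"
    unfolding part_def dest_def
  proof (rule card_bucket)
    show "card {v \<in> V. key best_shift v = z} \<le> L ^ d" for z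
      using inj_position length_node L_gt_0 by (intro card_cell) auto
  qed (use X_disjoint X_Un t_pos in auto)
  then have "real (card (part j)) \<le> real (t * (m + 1) + t * m + L ^ d)" by (simp only: of_nat_le_iff)
  then show ?thesis using bucket_le by linarith
qed

lemma edgesD:
  assumes "{u, v} \<in> edges sem G"
  shows "u \<in> V" "v \<in> V" "u \<noteq> v" "\<And>i. i < d \<Longrightarrow> u ! i \<le> v ! i + c \<and> v ! i \<le> u ! i + c"
proof -
  obtain x y where xy: "(x, y) \<in> adjacent sem G" "{u, v} = {x, y}"
    using assms by (auto simp: edges_def)
  have xV: "x \<in> V" "y \<in> V" "x \<noteq> y" using xy(1) by (auto simp: adjacent_def)
  have dist: "linf_dist d (position d x) (position d y) \<le> c"
    using grid xy(1) by (auto simp: implicit_grid_graph_def)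
  have le: "x ! i \<le> y ! i + c \<and> y ! i \<le> x ! i + c" if "i < d" for i
  proof -
    have "nat \<bar>int (position d x ! i) - int (position d y ! i)\<bar> \<le> linf_dist d (position d x) (position d y)"
      unfolding linf_dist_def using that by (intro Max_ge) auto
    then have "nat \<bar>int (x ! i) - int (y ! i)\<bar> \<le> c" using dist that by (simp add: position_def)
    then show ?thesis by linarith
  qed
  consider "u = x" "v = y" | "u = y" "v = x" using xy(2) by (auto simp: doubleton_eq_iff)
  then show "u \<in> V" "v \<in> V" "u \<noteq> v" "\<And>i. i < d \<Longrightarrow> u ! i \<le> v ! i + c \<and> v ! i \<le> u ! i + c"
    using xV le by (cases; simp)+
qed

lemma edges_pair: "e \<in> edges sem G \<Longrightarrow> \<exists>u v. e = {u, v} \<and> u \<in> V \<and> v \<in> V \<and> u \<noteq> v"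
  by (auto simp: edges_def adjacent_def)

lemma finite_edges: "finite (edges sem G)"
proof (rule finite_subset)
  show "edges sem G \<subseteq> Pow V" by (auto simp: edges_def adjacent_def)
  show "finite (Pow V)" using finite_V by simp
qed

sublocale split_graph edge_less "edges sem G" dest m border
proof
  show "finite (edges sem G)" by (rule finite_edges)
  show "\<exists>u v. e = {u, v} \<and> u \<noteq> v \<and> dest u < m \<and> dest v < m" if "e \<in> edges sem G" for e
    using edges_pair[OF that] dest_less by blast
  show "finite border" using finite_V by (simp add: border_def)
  show "dest b < m" for b by (rule dest_less)
  show "u \<in> border" if e: "{u, v} \<in> edges sem G" "dest u \<noteq> dest v" for u v
  proof -
    \<comment> \<open>\<open>dest\<close> is a function of the cube, so nodes on different machines
      lie in different cubes.\<close>
    have "key best_shift u \<noteq> key best_shift v" using e(2) by (auto simp: dest_def)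
    then have "near best_shift u"
      by (rule near_border_if_different_cells) (use edgesD[OF e(1)] L_gt_0 in auto)
    then show ?thesis using edgesD[OF e(1)] by (simp add: border_def)
  qed
qed

section \<open>What the machines compute, in terms of the split graph\<close>

lemma induced_edges_iff:
  "e \<in> induced_edges A \<longleftrightarrow>
     (\<exists>u v. e = {u, v} \<and> u \<in> A \<and> v \<in> A \<and> u \<noteq> v \<and> sem (edge_rule G) u v \<noteq> None)"
  by (simp add: induced_edges_def edges_def adjacent_def)

lemma induced_edges_eq:
  assumes "A \<subseteq> V"
  shows "induced_edges A = {e \<in> edges sem G. e \<subseteq> A}"
proof (intro set_eqI iffI)
  have E: "edges sem G = induced_edges V"
    by (simp add: induced_edges_def edges_def adjacent_def)
  show "e \<in> {e \<in> edges sem G. e \<subseteq> A}" if e: "e \<in> induced_edges A" for e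
  proof -
    obtain u v where "e = {u, v}" "u \<in> A" "v \<in> A" "u \<noteq> v" "sem (edge_rule G) u v \<noteq> None"
      using e unfolding induced_edges_iff by blast
    moreover then have "e \<in> induced_edges V"
      unfolding induced_edges_iff using assms by (intro exI[of _ u] exI[of _ v]) auto
    ultimately show ?thesis unfolding E by simp
  qed
  show "e \<in> induced_edges A" if "e \<in> {e \<in> edges sem G. e \<subseteq> A}" for e
  proof -
    have "e \<in> induced_edges V" "e \<subseteq> A" using that unfolding E by auto
    then obtain u v where "e = {u, v}" "u \<noteq> v" "sem (edge_rule G) u v \<noteq> None" "{u, v} \<subseteq> A"
      unfolding induced_edges_iff by blast
    then show ?thesis unfolding induced_edges_iff by (intro exI[of _ u] exI[of _ v]) simp
  qed
qed

lemma induced_edges_part: "induced_edges (part j) = local_edges j"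
proof -
  have "e \<subseteq> V" if "e \<in> edges sem G" for e using edges_pair[OF that] by blast
  then show ?thesis
    unfolding induced_edges_eq[OF part_subset] local_edges_def by (auto simp: part_def)
qed

lemma border_subset: "border \<subseteq> V"
  by (auto simp: border_def)

lemma induced_edges_border: "induced_edges border = border_edges"
  unfolding induced_edges_eq[OF border_subset] border_edges_def ..

lemma near_part: "{v \<in> part j. near best_shift v} = local_border j"
  unfolding local_border_def unfolding part_def border_def by auto

abbreviation "sketch_of j \<equiv> sketch (local_border j) (local_edges j)"

lemma local_sketch_part: "local_sketch best_shift (part j) = sketch_of j"
  unfolding local_sketch_def near_part induced_edges_part ..

lemma finite_local_border: "finite (local_border j)"
  using fin_B by (simp add: local_border_def)

lemma card_sketch_of: "finite (sketch_of j)" "card (sketch_of j) \<le> 2 * card (local_border j)"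
proof -
  have "finite e" if "e \<in> local_edges j" for e
    using that by (intro finite_edge) (simp add: local_edges_def)
  note card_sketch[of "local_border j" "local_edges j", OF finite_local_border this]
  then show "finite (sketch_of j)" "card (sketch_of j) \<le> 2 * card (local_border j)" by simp_all
qed

lemma sum_card_local_border: "(\<Sum>j<m. card (local_border j)) = card border"
proof -
  have "border = (\<Union>j<m. local_border j)" using dest_less by (auto simp: local_border_def)
  moreover have "local_border i \<inter> local_border j = {}" if "i \<noteq> j" for i j
    using that by (auto simp: local_border_def)
  ultimately show ?thesis
    using finite_local_border card_UN_disjoint[of "{..<m}" local_border] by simp
qed

lemma local_border_subset: "local_border j \<subseteq> border"
  by (auto simp: local_border_def)

lemma card_local_border: "card (local_border j) \<le> card border"
  using card_mono[OF fin_B local_border_subset] .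

subsection \<open>Rounds\<close>

definition conf :: "(nat \<Rightarrow> nat list) \<Rightarrow> configuration" where
  "conf x = (\<lambda>i. if i < m then Running (x i) else Halted [])"

lemma message_conf:
  "message (program final) m (conf x) i j = (if i < m \<and> j < m then outgoing i (x i) j else [])"
  by (simp add: message_def conf_def program_def)

definition mem0 :: "nat \<Rightarrow> nat list" where
  "mem0 i = concat (inp i)"

definition mem1 :: "nat \<Rightarrow> nat list" where
  "mem1 i = state 1 best_shift (list_encode ` X i)"

definition mem2 :: "nat \<Rightarrow> nat list" where
  "mem2 i = state 2 best_shift ((\<lambda>v. prod_encode (dest v, list_encode v)) ` X i)"

definition mem3 :: "nat \<Rightarrow> nat list" where
  "mem3 j = state 3 best_shift (list_encode ` part j)"

lemma phase_mem0: "i < m \<Longrightarrow> phase (mem0 i) = 0"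
  by (rule phase_input) (use X_subset word_node in \<open>auto simp: mem0_def\<close>)

lemma outgoing_mem0:
  "i < m \<Longrightarrow> outgoing i (mem0 i) j = map (\<lambda>a. card {v \<in> X i. near a v}) [0..<L]"
  using phase_mem0 chunks_inp by (simp add: outgoing_def mem0_def)

lemma outgoing_mem1: "outgoing i (mem1 i) j = samples (key best_shift) t (X i)"
  by (simp add: outgoing_def mem1_def)

lemma phase_mem2: "phase (mem2 i) = 2" "shift (mem2 i) = best_shift"
  by (simp_all add: mem2_def)

lemma outgoing_mem2: "outgoing i (mem2 i) j = enum (list_encode ` {v \<in> X i. dest v = j})"
  by (simp add: outgoing_def mem2_def addressed_to_image)

lemma outgoing_mem3:
  "outgoing i (mem3 i) j = (if j = 0 then enum (quad_code ` sketch_of i) else [])"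
  using finite_part by (simp add: outgoing_def mem3_def local_sketch_part)

lemma step0:
  assumes "j < m"
  shows "next_state final j (mem0 j) (\<lambda>i. message (program final) m (conf mem0) i j) = Running (mem1 j)"
proof -
  have "arg_min (\<lambda>a. \<Sum>l<m. message (program final) m (conf mem0) l j ! a) (\<lambda>a. a < L) = best_shift"
    unfolding best_shift_def
    by (intro arg_min_cong sum.cong refl) (use assms in \<open>simp add: message_conf outgoing_mem0\<close>)
  then show ?thesis
    using assms phase_mem0[OF assms] chunks_inp[OF assms, folded mem0_def]
    by (simp add: next_state_def mem1_def)
qed

lemma step1:
  assumes "j < m"
  shows "next_state final j (mem1 j) (\<lambda>i. message (program final) m (conf mem1) i j) = Running (mem2 j)"
proof -
  have "destination best_shift (\<lambda>i. message (program final) m (conf mem1) i j) v = dest v" for v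
  proof -
    have "(\<Sum>i<m. length (filter (\<lambda>z. z \<le> key best_shift v) (message (program final) m (conf mem1) i j)))
        = (\<Sum>i<m. num_less (key best_shift) (X i) (key best_shift v) div t)"
      by (intro sum.cong refl)
        (use assms t_pos in \<open>simp add: message_conf outgoing_mem1 count_samples\<close>)
    then show ?thesis unfolding destination_def length_filter_concat_upt dest_def by (rule arg_cong)
  qed
  then show ?thesis by (simp add: next_state_def mem1_def mem2_def image_image)
qed

lemma step2:
  assumes "j < m"
  shows "next_state final j (mem2 j) (\<lambda>i. message (program final) m (conf mem2) i j) = Running (mem3 j)"
proof -
  have "received (\<lambda>i. message (program final) m (conf mem2) i j) = (\<Union>i<m. list_encode ` {v \<in> X i. dest v = j})"
    unfolding received_def
    by (intro SUP_cong refl) (use assms in \<open>simp add: message_conf outgoing_mem2\<close>)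
  also have "\<dots> = list_encode ` (\<Union>i<m. {v \<in> X i. dest v = j})" by (rule image_UN[symmetric])
  also have "(\<Union>i<m. {v \<in> X i. dest v = j}) = part j" unfolding part_def using X_Un by auto
  finally show ?thesis
    by (simp add: next_state_def mem3_def phase_mem2)
qed

lemma received_mem3:
  assumes "j < m"
  shows "received (\<lambda>i. message (program final) m (conf mem3) i j) =
    (if j = 0 then quad_code ` sketches else {})"
  unfolding received_def sketches_def
  using assms card_sketch_of(1) by (auto simp: message_conf outgoing_mem3)

lemma received_sketch_image [simp]: "received_sketch (quad_code ` T) = T"
  unfolding received_sketch_def by auto

lemma received_sketch_empty [simp]: "received_sketch {} = {}"
  unfolding received_sketch_def by simp

lemma step3:
  "next_state final j (mem3 j) y = final (mem3 j) y"
  by (simp add: next_state_def mem3_def)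

end

section \<open>The minimum spanning forest\<close>

definition halted :: "nat \<Rightarrow> (nat \<Rightarrow> nat list) \<Rightarrow> configuration" where
  "halted m x = (\<lambda>i. if i < m then Halted (x i) else Halted [])"

lemma records_halted: "records l m (halted m x) = (\<Union>j<m. chunks l (x j))"
  unfolding records_def chunks_def halted_def by (intro SUP_cong) auto

context grid_run begin

abbreviation "E \<equiv> edges sem G"

lemma conn_in_V: "(u, v) \<in> conn E \<Longrightarrow> u \<in> V \<Longrightarrow> v \<in> V"
  by (induction rule: conn_induct) (auto dest: edgesD)

lemma connection_eq: "connection V F = conn F \<inter> V \<times> V"
  by (simp add: connection_def conn_def)

lemma length_position: "v \<in> V \<Longrightarrow> length (position d v) = d"
  using length_node by (simp add: position_def)

definition forest_edges :: "nat \<Rightarrow> nat list set set" where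
  "forest_edges j = (msf (local_edges j) - merges (local_border j) (local_edges j)) \<union>
     (if j = 0 then global_msf sketches border_edges else {})"

definition forest_output :: "nat \<Rightarrow> nat list" where
  "forest_output j =
     concat (map (\<lambda>(u, v). position d u @ position d v) (enum (ends ` forest_edges j)))"

lemma step3_forest:
  assumes "j < m"
  shows "forest_final (mem3 j) (\<lambda>i. message (program final) m (conf mem3) i j) = Halted (forest_output j)"
proof -
  have empty: "sketch_border {} = {}" "induced_edges {} = {}" "global_msf {} {} = {}"
    by (auto simp: sketch_border_def induced_edges_iff global_msf_def)
  have "forest_part best_shift (part j) (received (\<lambda>i. message (program final) m (conf mem3) i j))
      = forest_edges j"
    unfolding forest_part_def received_mem3[OF assms] forest_edges_def near_part induced_edges_part
    by (simp add: empty sketch_border_sketches induced_edges_border)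
  moreover have "shift (mem3 j) = best_shift" "list_decode ` content (mem3 j) = part j"
    using finite_part by (simp_all add: mem3_def)
  ultimately show ?thesis unfolding forest_final_def forest_output_def by simp
qed

lemma forest_edges_Un: "(\<Union>j<m. forest_edges j) = msf E"
proof -
  have "(\<Union>j<m. if j = 0 then Z else {}) = Z" for Z :: "nat list set set"
  proof (intro equalityI subsetI)
    fix e assume "e \<in> Z"
    then show "e \<in> (\<Union>j<m. if j = 0 then Z else {})" using m_pos by (intro UN_I[of 0]) auto
  qed (auto split: if_splits)
  then show ?thesis unfolding forest_edges_def UN_Un_distrib msf_eq by simp
qed

lemma forest_edges_subset: "j < m \<Longrightarrow> forest_edges j \<subseteq> E"
  using forest_edges_Un msf_subset by blast

lemma finite_forest_edges: "j < m \<Longrightarrow> finite (forest_edges j)"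
  using forest_edges_subset finite_edges finite_subset by blast

lemma ends_edge:
  assumes "e \<in> E"
  shows "fst (ends e) \<in> V" "snd (ends e) \<in> V" "{fst (ends e), snd (ends e)} = e"
proof -
  obtain u v where uv: "e = {u, v}" "u \<in> V" "v \<in> V" using edges_pair[OF assms] by blast
  then have *: "{fst (ends e), snd (ends e)} = e"
    using ends[of e] by (cases "ends e") auto
  then have "{fst (ends e), snd (ends e)} \<subseteq> V" using uv by simp
  then show "fst (ends e) \<in> V" "snd (ends e) \<in> V" by simp_all
  show "{fst (ends e), snd (ends e)} = e" by (rule *)
qed

lemma weight_eq: "weight = edge_weight sem G"
  by (intro ext) (simp add: weight_def edge_weight_def)

lemma minimum_spanning_forest_msf: "minimum_spanning_forest sem G (msf E)"
  unfolding minimum_spanning_forest_def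
proof (intro conjI allI impI)
  have fin: "finite e" if "e \<in> E" for e using that by (rule finite_edge)
  show "spanning_forest sem G (msf E)"
    unfolding spanning_forest_def connection_eq conn_msf[OF finite_edges]
    using forest_imp_no_cycle[OF forest_msf[OF finite_edges fin]] msf_subset by simp
  fix F assume F: "spanning_forest sem G F"
  have FE: "F \<subseteq> E" and nc: "\<not> (\<exists>p. is_cycle F p)"
    and c: "conn F \<inter> V \<times> V = conn E \<inter> V \<times> V"
    using F unfolding spanning_forest_def connection_eq by auto
  \<comment> \<open>The hypothesis gives equality on \<open>V \<times> V\<close> only; this suffices
    because all edges have both ends in \<open>V\<close>.\<close>
  have "conn F = conn E"
  proof
    show "conn F \<subseteq> conn E" using FE by (rule conn_mono)
    show "conn E \<subseteq> conn F"
    proof (rule conn_subset)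
      fix u v assume uv: "{u, v} \<in> E"
      then have "(u, v) \<in> conn E \<inter> V \<times> V" using conn_edge[OF uv] edgesD[OF uv] by simp
      then show "(u, v) \<in> conn F" using c by blast
    qed
  qed
  moreover have "forest F"
    by (rule no_cycle_imp_forest[OF nc]) (use FE edgesD in blast)
  moreover have "\<exists>u v. e = {u, v}" if "e \<in> E" for e using edges_pair[OF that] by blast
  moreover have "weight e \<le> weight f" if "edge_less e f" for e f
    using that by (auto simp: edge_less_def)
  ultimately have "sum weight (msf E) \<le> sum weight F"
    using FE fin by (intro msf_minimum finite_edges)
  then show "sum (edge_weight sem G) (msf E) \<le> sum (edge_weight sem G) F"
    by (simp add: weight_eq)
qed

lemma forest_correct: "outputs_minimum_spanning_forest d sem G m (halted m forest_output)"
proof -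
  let ?rec = "\<lambda>(u, v). position d u @ position d v"
  let ?A = "\<Union>j<m. ends ` forest_edges j"
  have "chunks (2 * d) (forest_output j) = ?rec ` ends ` forest_edges j" if j: "j < m" for j
  proof -
    have fin: "finite (ends ` forest_edges j)" using finite_forest_edges[OF j] by simp
    have len: "length x = 2 * d" if x: "x \<in> set (map ?rec (enum (ends ` forest_edges j)))" for x
    proof -
      have "x \<in> ?rec ` ends ` forest_edges j" using x fin by simp
      then obtain e where "e \<in> forest_edges j" "x = ?rec (ends e)" by blast
      then show ?thesis
        using ends_edge[of e] forest_edges_subset[OF j] length_position
        by (cases "ends e") auto
    qed
    have "chunks (2 * d) (forest_output j) = set (map ?rec (enum (ends ` forest_edges j)))"
      unfolding forest_output_def by (rule chunks_concat, erule len) (use d in simp)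
    then show ?thesis using fin by simp
  qed
  then have "records (2 * d) m (halted m forest_output) = (\<Union>j<m. ?rec ` ends ` forest_edges j)"
    unfolding records_halted by simp
  also have "\<dots> = ?rec ` ?A" by (simp only: image_UN)
  finally have rec: "records (2 * d) m (halted m forest_output) = ?rec ` ?A" .
  have edge: "(case ends e of (u, v) \<Rightarrow> {u, v}) = e" if "e \<in> forest_edges j" "j < m" for e j
    using ends_edge[of e] forest_edges_subset that by (auto simp: case_prod_beta)
  have "(\<lambda>(u, v). {u, v}) ` ?A = (\<Union>j<m. (\<lambda>e. case ends e of (u, v) \<Rightarrow> {u, v}) ` forest_edges j)"
    by (simp only: image_UN image_image)
  also have "\<dots> = (\<Union>j<m. forest_edges j)" using edge by (intro SUP_cong) force+
  also have "\<dots> = msf E" by (rule forest_edges_Un)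
  finally have A: "(\<lambda>(u, v). {u, v}) ` ?A = msf E" .
  have "?A \<subseteq> V \<times> V"
  proof
    fix p assume "p \<in> ?A"
    then obtain j e where "j < m" "e \<in> forest_edges j" "p = ends e" by auto
    then have "e \<in> E" using forest_edges_subset by blast
    then show "p \<in> V \<times> V" using ends_edge(1,2)[of e] \<open>p = ends e\<close> by (simp add: mem_Times_iff)
  qed
  then show ?thesis
    unfolding outputs_minimum_spanning_forest_def
    using rec A minimum_spanning_forest_msf by (intro exI[of _ ?A]) simp
qed

end

section \<open>The components\<close>

context grid_run begin

definition chosen :: "nat list \<Rightarrow> nat list" where
  "chosen b = (SOME b'. b' \<in> border \<and> (b, b') \<in> conn E)"

definition label_node :: "nat list \<Rightarrow> nat list" where
  "label_node v =
     (let j = dest v in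
      if \<exists>b\<in>local_border j. (v, b) \<in> conn (local_edges j)
      then chosen (SOME b. b \<in> local_border j \<and> (v, b) \<in> conn (local_edges j))
      else SOME z. (v, z) \<in> conn (local_edges j))"

lemma chosen: "b \<in> border \<Longrightarrow> chosen b \<in> border \<and> (b, chosen b) \<in> conn E"
  unfolding chosen_def by (rule someI[of _ b]) simp

lemma chosen_eq:
  assumes "(b, b') \<in> conn E"
  shows "chosen b = chosen b'"
proof -
  have "(b, z) \<in> conn E \<longleftrightarrow> (b', z) \<in> conn E" for z
    using conn_trans[OF assms, of z] conn_trans[OF conn_sym[OF assms], of z] by blast
  then show ?thesis unfolding chosen_def by simp
qed

lemma conn_local_subset: "(u, v) \<in> conn (local_edges j) \<Longrightarrow> (u, v) \<in> conn E"
  by (rule conn_monoD[OF _ local_edges_subset])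

lemma label_node_border:
  assumes "b \<in> local_border (dest v)" "(v, b) \<in> conn (local_edges (dest v))"
  shows "label_node v = chosen b"
proof -
  let ?Q = "\<lambda>b. b \<in> local_border (dest v) \<and> (v, b) \<in> conn (local_edges (dest v))"
  have "?Q (SOME b. ?Q b)" using assms by (intro someI[of ?Q b]) simp
  then have "(SOME b. ?Q b, b) \<in> conn E"
    using assms(2) conn_local_subset by (meson conn_sym conn_trans)
  then have "chosen (SOME b. ?Q b) = chosen b" by (rule chosen_eq)
  then show ?thesis unfolding label_node_def Let_def using assms by auto
qed

lemma conn_label_node: "(v, label_node v) \<in> conn E"
proof (cases "\<exists>b\<in>local_border (dest v). (v, b) \<in> conn (local_edges (dest v))")
  case True
  then obtain b where b: "b \<in> local_border (dest v)" "(v, b) \<in> conn (local_edges (dest v))" by blast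
  then have "(b, chosen b) \<in> conn E" using chosen local_border_subset by blast
  then show ?thesis unfolding label_node_border[OF b] by (rule conn_trans[OF conn_local_subset[OF b(2)]])
next
  case False
  have "(v, SOME z. (v, z) \<in> conn (local_edges (dest v))) \<in> conn (local_edges (dest v))"
    by (rule someI[of _ v]) simp
  then have "(v, label_node v) \<in> conn (local_edges (dest v))"
    unfolding label_node_def Let_def using False by simp
  then show ?thesis by (rule conn_local_subset)
qed

lemma conn_local_without_border:
  assumes "(u, z) \<in> conn E" "\<And>b. b \<in> local_border (dest u) \<Longrightarrow> (u, b) \<notin> conn (local_edges (dest u))"
  shows "(u, z) \<in> conn (local_edges (dest u))" "dest z = dest u"
proof -
  show *: "(u, z) \<in> conn (local_edges (dest u))"
    using conn_local_if_no_border[of u z "\<lambda>_. True" "dest u"] assms by simp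
  show "dest z = dest u" using part_conn_local[of u z "dest u" "\<lambda>_. True"] * by simp
qed

lemma label_node_eq:
  assumes "(u, v) \<in> conn E"
  shows "label_node u = label_node v"
proof -
  let ?H = "\<lambda>v. \<exists>b\<in>local_border (dest v). (v, b) \<in> conn (local_edges (dest v))"
  \<comment> \<open>Meeting the border locally is invariant under global connectivity: if the local
    component of \<open>v\<close> has no border node, it is a whole component and would have to
    contain the border node \<open>b\<close> found from \<open>u\<close>.\<close>
  have H: "?H v" if uv: "(u, v) \<in> conn E" and u: "?H u" for u v
  proof (rule ccontr)
    assume v: "\<not> ?H v"
    obtain b where b: "b \<in> local_border (dest u)" "(u, b) \<in> conn (local_edges (dest u))" using u by blast
    have nb: "(v, b) \<notin> conn (local_edges (dest v))" if "b \<in> local_border (dest v)" for b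
      using v that by auto
    have vb: "(v, b) \<in> conn E" using conn_trans[OF conn_sym[OF uv] conn_local_subset[OF b(2)]] .
    have "(v, b) \<in> conn (local_edges (dest v))" "dest b = dest v"
      using conn_local_without_border[OF vb nb] by simp_all
    moreover have "b \<in> border" using b(1) by (simp add: local_border_def)
    ultimately show False using nb[of b] by (simp add: local_border_def)
  qed
  show ?thesis
  proof (cases "?H u")
    case True
    then obtain b where b: "b \<in> local_border (dest u)" "(u, b) \<in> conn (local_edges (dest u))" by blast
    obtain b' where b': "b' \<in> local_border (dest v)" "(v, b') \<in> conn (local_edges (dest v))"
      using H[OF assms True] by blast
    have "(b, b') \<in> conn E"
      using conn_trans[OF conn_trans[OF conn_sym[OF conn_local_subset[OF b(2)]] assms] conn_local_subset[OF b'(2)]] .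
    then have "chosen b = chosen b'" by (rule chosen_eq)
    then show ?thesis using label_node_border[OF b] label_node_border[OF b'] by simp
  next
    case False
    have F: "\<not> ?H v" by (rule contrapos_nn[OF False]) (rule H[OF conn_sym[OF assms]])
    have nb: "(u, b) \<notin> conn (local_edges (dest u))" if "b \<in> local_border (dest u)" for b
      using False that by auto
    have uv: "(u, v) \<in> conn (local_edges (dest u))" "dest v = dest u"
      using conn_local_without_border[OF assms nb] by simp_all
    have "(u, z) \<in> conn (local_edges (dest u)) \<longleftrightarrow> (v, z) \<in> conn (local_edges (dest v))" for z
      unfolding uv(2) using conn_trans[OF uv(1), of z] conn_trans[OF conn_sym[OF uv(1)], of z] by blast
    then show ?thesis unfolding label_node_def Let_def using False F by simp
  qed
qed

lemma label_node_eq_iff: "label_node u = label_node v \<longleftrightarrow> (u, v) \<in> conn E"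
proof
  assume "label_node u = label_node v"
  then have "(label_node u, v) \<in> conn E" using conn_sym[OF conn_label_node[of v]] by simp
  then show "(u, v) \<in> conn E" by (rule conn_trans[OF conn_label_node])
qed (rule label_node_eq)

definition component_output :: "nat \<Rightarrow> nat list" where
  "component_output j = concat (map (\<lambda>v. position d v @ position d (label_node v)) (enum (part j)))"

text \<open>Labels are positions of nodes of the graph, and distinct nodes have distinct positions,
  so comparing labels amounts to comparing \<open>label_node\<close>.\<close>

lemma components_correct: "outputs_components d sem G m (halted m component_output)"
proof -
  let ?label = "\<lambda>v. position d (label_node v)"
  have lV: "label_node v \<in> V" if "v \<in> V" for v using conn_in_V[OF conn_label_node that] .
  have "chunks (2 * d) (component_output j) = (\<lambda>v. position d v @ ?label v) ` part j" for j
  proof -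
    have len: "length x = 2 * d" if x: "x \<in> set (map (\<lambda>v. position d v @ ?label v) (enum (part j)))" for x
    proof -
      obtain v where v: "v \<in> part j" "x = position d v @ ?label v" using x finite_part by auto
      then have "v \<in> V" by (simp add: part_def)
      then show ?thesis using v(2) lV length_position by simp
    qed
    have "chunks (2 * d) (component_output j) = set (map (\<lambda>v. position d v @ ?label v) (enum (part j)))"
      unfolding component_output_def by (rule chunks_concat, erule len) (use d in simp)
    then show ?thesis using finite_part by simp
  qed
  then have "records (2 * d) m (halted m component_output) = (\<Union>j<m. (\<lambda>v. position d v @ ?label v) ` part j)"
    unfolding records_halted by simp
  also have "\<dots> = (\<lambda>v. position d v @ ?label v) ` (\<Union>j<m. part j)" by (rule image_UN[symmetric])
  finally have rec: "records (2 * d) m (halted m component_output) = (\<lambda>v. position d v @ ?label v) ` V"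
    using part_Un by simp
  have "?label u = ?label v \<longleftrightarrow> (u, v) \<in> conn E" if "u \<in> V" "v \<in> V" for u v
    using inj_on_eq_iff[OF inj_position lV[OF that(1)] lV[OF that(2)]] label_node_eq_iff by simp
  then have "{v \<in> V. ?label v = ?label u} = connection V E `` {u}" if "u \<in> V" for u
    unfolding connection_eq using that conn_sym by auto
  then have "(\<lambda>l. {v \<in> V. ?label v = l}) ` (?label ` V) = components sem G"
    unfolding components_def quotient_def image_image by auto
  then show ?thesis
    unfolding outputs_components_def using rec lV length_position
    by (intro exI[of _ ?label]) simp
qed

section \<open>Replies of machine 0 and the last round\<close>

definition reply :: "nat list \<Rightarrow> nat" where
  "reply b = prod_encode (list_encode b, list_encode (chosen b))"

definition stored_replies :: "nat \<Rightarrow> nat set" where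
  "stored_replies j =
     (if j = 0 then (\<Union>l<m. (\<lambda>b. prod_encode (l, reply b)) ` local_border l) else {})"

definition mem4 :: "nat \<Rightarrow> nat list" where
  "mem4 j = state 4 best_shift
     ((\<lambda>v. prod_encode (m, list_encode v)) ` part j \<union> stored_replies j)"

lemma finite_stored_replies: "finite (stored_replies j)"
  using finite_local_border by (simp add: stored_replies_def)

lemma representative_eq: "b \<in> border \<Longrightarrow> representative (quad_code ` sketches) b = chosen b"
  unfolding representative_def chosen_def Let_def received_sketch_image sketch_border_sketches
    induced_edges_border
  using conn_links_iff[OF downward_True] by (intro arg_cong[of _ _ Eps]) auto

lemma step3_component:
  assumes j: "j < m"
  shows "component_final (mem3 j) (\<lambda>i. message (program final) m (conf mem3) i j) = Running (mem4 j)"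
proof -
  let ?y = "\<lambda>i. message (program final) m (conf mem3) i j"
  have X: "phase (mem3 j) = 3" "shift (mem3 j) = best_shift" "list_decode ` content (mem3 j) = part j"
    using finite_part by (simp_all add: mem3_def)
  have "(\<lambda>b. prod_encode (l, prod_encode (list_encode b, list_encode (representative (received ?y) b))))
          ` sketch_border (received_sketch (set (?y l)))
      = (if j = 0 then (\<lambda>b. prod_encode (l, reply b)) ` local_border l else {})" if l: "l < m" for l
  proof (cases "j = 0")
    case True
    have "set (?y l) = quad_code ` sketch_of l"
      using True l j card_sketch_of by (simp add: message_conf outgoing_mem3)
    then have b: "sketch_border (received_sketch (set (?y l))) = local_border l" by simp
    have "representative (received ?y) b = chosen b" if "b \<in> local_border l" for b
      unfolding received_mem3[OF j] using True that local_border_subset representative_eq by auto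
    then show ?thesis unfolding b reply_def using True by auto
  next
    case False
    then have "set (?y l) = {}" using l j by (simp add: message_conf outgoing_mem3)
    then show ?thesis using False by (simp add: sketch_border_def)
  qed
  then have "(\<Union>l<m. (\<lambda>b. prod_encode (l, prod_encode (list_encode b, list_encode (representative (received ?y) b))))
          ` sketch_border (received_sketch (set (?y l)))) = stored_replies j"
    unfolding stored_replies_def by simp
  then show ?thesis unfolding component_final_def replies_def X mem4_def by simp
qed

lemma content_mem4: "phase (mem4 j) = 4" "shift (mem4 j) = best_shift"
  "content (mem4 j) = (\<lambda>v. prod_encode (m, list_encode v)) ` part j \<union> stored_replies j"
  using finite_part finite_stored_replies by (simp_all add: mem4_def)

lemma addressed_to_mem4:
  "addressed_to (content (mem4 i)) m = list_encode ` part i"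
  "j < m \<Longrightarrow> addressed_to (content (mem4 i)) j = (if i = 0 then reply ` local_border j else {})"
  unfolding content_mem4 addressed_to_def stored_replies_def by auto

lemma outgoing_mem4:
  "j < m \<Longrightarrow> outgoing i (mem4 i) j = (if i = 0 then enum (reply ` local_border j) else [])"
  by (simp add: outgoing_def content_mem4(1) addressed_to_mem4)

lemma step4_component:
  assumes j: "j < m"
  shows "component_final (mem4 j) (\<lambda>i. message (program final) m (conf mem4) i j) = Halted (component_output j)"
proof -
  let ?y = "\<lambda>i. message (program final) m (conf mem4) i j"
  have y: "set (?y i) = (if i = 0 then reply ` local_border j else {})" if "i < m" for i
    using that j finite_local_border by (simp add: message_conf outgoing_mem4)
  have rec: "received ?y = reply ` local_border j"
  proof -
    have "received ?y = (\<Union>i<m. if i = 0 then reply ` local_border j else {})"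
      unfolding received_def by (intro SUP_cong refl) (use y in auto)
    also have "\<dots> = reply ` local_border j" using m_pos by (force split: if_splits)
    finally show ?thesis .
  qed
  have node: "component_node best_shift (part j) (reply ` local_border j) v = label_node v"
    if v: "v \<in> part j" for v
  proof -
    have dv: "dest v = j" using v by (simp add: part_def)
    have B: "(\<exists>b\<in>part j. near best_shift b \<and> Q b) \<longleftrightarrow> (\<exists>b\<in>local_border j. Q b)" for Q
      unfolding near_part[symmetric] by auto
    show ?thesis
    proof (cases "\<exists>b\<in>local_border j. (v, b) \<in> conn (local_edges j)")
      case True
      then obtain b where b: "b \<in> local_border j" "(v, b) \<in> conn (local_edges j)" by blast
      \<comment> \<open>Exactly one \<open>z\<close> qualifies, so the choice in
        \<open>component_node\<close> is forced.\<close>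
      have "(\<exists>b\<in>local_border j. (v, b) \<in> conn (local_edges j) \<and>
          prod_encode (list_encode b, list_encode z) \<in> reply ` local_border j) \<longleftrightarrow> z = label_node v" for z
      proof -
        have "prod_encode (list_encode b, list_encode z) \<in> reply ` local_border j \<longleftrightarrow> z = chosen b"
          if "b \<in> local_border j" for b
          using that by (auto simp: reply_def list_encode_eq)
        moreover have "label_node v = chosen b" if "b \<in> local_border j" "(v, b) \<in> conn (local_edges j)" for b
          using label_node_border[of b v] that dv by simp
        ultimately show ?thesis using b by metis
      qed
      then show ?thesis
        unfolding component_node_def B induced_edges_part using True by simp
    next
      case False
      then show ?thesis
        unfolding component_node_def B induced_edges_part label_node_def Let_def dv by simp
    qed
  qed
  have "list_decode ` addressed_to (content (mem4 j)) m = part j"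
    by (simp add: addressed_to_mem4)
  moreover have "map (\<lambda>v. position d v @ position d (component_node best_shift (part j) (reply ` local_border j) v))
      (enum (part j)) = map (\<lambda>v. position d v @ position d (label_node v)) (enum (part j))"
    using node finite_part by simp
  ultimately show ?thesis
    unfolding component_final_def component_output_def Let_def rec content_mem4(1,2)
    by (simp del: map_eq_conv)
qed

end

section \<open>Resources\<close>

text \<open>A crude sum that dominates every single estimate: the input, the output records, then
  memories and messages. The bracket bounds the exponents of words, of which the largest arise from
  two nested pairings of node codes.\<close>

definition resource_bound :: "nat \<Rightarrow> nat \<Rightarrow> nat \<Rightarrow> nat" where
  "resource_bound d k K =
     2 * (d + k) + 2 * d * (15 + 2 ^ d + 2 * d) + 2 ^ d + 40 + (4 * code_exp K (d + k) + K + 5)"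

lemma code_exp_mono: "p \<le> q \<Longrightarrow> code_exp K p \<le> code_exp K q"
  by (induction q) (auto simp: le_Suc_eq)

context grid_run begin

abbreviation "C \<equiv> resource_bound d k K"
definition N :: nat where
  "N = card V + 1"

definition code_size :: nat where
  "code_size = code_exp K (d + k)"

lemma le_space: "x \<le> a * s \<Longrightarrow> a \<le> real C \<Longrightarrow> x \<le> real C * s"
  using s_ge_1 by (meson mult_right_mono order_trans zero_le_one)

lemma N_ge_2: "2 \<le> N"
  using n by (simp add: N_def)

lemma node_word: "v \<in> V \<Longrightarrow> w \<in> set v \<Longrightarrow> w < N ^ K"
  unfolding N_def by (rule word_node)

lemma less_word: "w < N ^ e \<Longrightarrow> e \<le> 4 * code_size + K + 5 \<Longrightarrow> w < N ^ C"
proof -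
  assume "w < N ^ e" "e \<le> 4 * code_size + K + 5"
  moreover then have "N ^ e \<le> N ^ C"
    using N_ge_2 by (intro power_increasing) (auto simp: resource_bound_def code_size_def)
  ultimately show ?thesis by linarith
qed

lemma less_N: "w \<le> card V \<Longrightarrow> w < N ^ 1"
  by (simp add: N_def)

lemma weaken: "w < N ^ e \<Longrightarrow> e \<le> e' \<Longrightarrow> w < N ^ e'"
  using power_increasing[of e e' N] N_ge_2 by linarith

lemma code_less: "v \<in> V \<Longrightarrow> list_encode v < N ^ code_size"
  using list_encode_less[OF N_ge_2, of v K] node_word length_node by (simp add: code_size_def)

lemma key_less:
  assumes v: "v \<in> V"
  shows "key best_shift v < N ^ code_size"
proof -
  let ?c = "map (\<lambda>i. (v ! i + best_shift) div L) [0..<d]"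
  have "w < N ^ K" if w: "w \<in> set ?c" for w
  proof -
    obtain i where i: "i < d" "w = (v ! i + best_shift) div L" using w by auto
    \<comment> \<open>As the shift is less than \<open>L\<close>, the coordinates of a cube are at
      most those of its nodes and obey the same bound.\<close>
    have "v ! i + best_shift < L * (v ! i + 1)"
    proof -
      have "v ! i * 1 \<le> v ! i * L" using L_pos by (intro mult_le_mono2)
      then have "v ! i + best_shift < v ! i * L + L" using best_shift_less by linarith
      then show ?thesis by (simp add: algebra_simps)
    qed
    then have "w < v ! i + 1" unfolding i(2) using L_gt_0 by (simp add: div_less_iff_less_mult mult.commute)
    moreover have "v ! i < N ^ K" using node_word[OF v, of "v ! i"] length_node[OF v] i(1) by simp
    ultimately show ?thesis by linarith
  qed
  then have "key best_shift v < N ^ code_exp K (length ?c)"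
    unfolding cell_def by (rule list_encode_less[OF N_ge_2])
  then show ?thesis by (rule weaken) (simp add: code_size_def code_exp_mono)
qed

lemma pair_less: "a < N ^ e \<Longrightarrow> b < N ^ e \<Longrightarrow> prod_encode (a, b) < N ^ (2 * e + 1)"
  using prod_encode_less[OF _ _ N_ge_2] .

lemma addressed_less:
  assumes "j \<le> card V" "b < N ^ e" "1 \<le> e"
  shows "prod_encode (j, b) < N ^ (2 * e + 1)"
  by (rule pair_less[OF weaken[OF less_N[OF assms(1)] assms(3)] assms(2)])

lemma quad_less:
  assumes "u \<in> V" "v \<in> V" "x \<in> V" "y \<in> V"
  shows "quad_code (u, v, x, y) < N ^ C"
proof -
  have "quad_code (u, v, x, y) < N ^ (2 * (2 * code_size + 1) + 1)"
    unfolding quad_code_def prod.case by (intro pair_less code_less assms)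
  then show ?thesis by (rule less_word) simp
qed

lemma reply_less: "b \<in> border \<Longrightarrow> reply b < N ^ (2 * code_size + 1)"
  unfolding reply_def using border_subset chosen[of b] by (intro pair_less code_less) auto

lemma sketch_in_V:
  assumes "(u, v, x, y) \<in> sketch_of j"
  shows "u \<in> V" "v \<in> V" "x \<in> V" "y \<in> V"
proof -
  have B: "b \<in> V" if "b \<in> local_border j" for b
    using that local_border_subset border_subset by blast
  from assms have "u \<in> V \<and> v \<in> V \<and> x \<in> V \<and> y \<in> V"
  proof (cases rule: sketchE)
    case 1
    then show ?thesis using B by simp
  next
    case 2
    have "{u, v} \<in> local_edges j" using mergesD(1)[OF 2(1)] .
    then have "{u, v} \<in> E" by (simp add: local_edges_def)
    then show ?thesis using edgesD(1,2) B 2(2,3) by simp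
  qed
  then show "u \<in> V" "v \<in> V" "x \<in> V" "y \<in> V" by simp_all
qed

lemma state_resources:
  assumes "finite A" "p \<le> 4" "real (card A) \<le> a * s" "a + 2 \<le> real C" "\<And>w. w \<in> A \<Longrightarrow> w < N ^ C"
  shows "real (length (state p best_shift A)) \<le> real C * s"
    "\<And>w. w \<in> set (state p best_shift A) \<Longrightarrow> w < N ^ C"
proof -
  have "real (length (state p best_shift A)) = 2 + real (card A)"
    using assms(1) by (simp add: state_def)
  also have "\<dots> \<le> (a + 2) * s" using assms(3) s_ge_1 by (simp add: algebra_simps)
  finally show "real (length (state p best_shift A)) \<le> real C * s" using assms(4) by (rule le_space)
  \<comment> \<open>The phase marker: \<open>p\<close> is at most 4, and \<open>N ^ 3\<close> is at
    least 8.\<close>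
  have "N ^ K + p < N ^ (K + 3)"
  proof -
    have "2 ^ 3 \<le> N ^ 3" using N_ge_2 by (rule power_mono) simp
    then have "N ^ K * 8 \<le> N ^ (K + 3)" by (simp add: power_add)
    moreover have "1 \<le> N ^ K" using N_ge_2 by simp
    ultimately show ?thesis using assms(2) by linarith
  qed
  then have "N ^ K + p < N ^ C" by (rule less_word) simp
  moreover have "best_shift < N ^ C"
    by (rule less_word[OF less_N]) (use best_shift_less L_le_n in auto)
  ultimately show "\<And>w. w \<in> set (state p best_shift A) \<Longrightarrow> w < N ^ C"
    using assms(1,5) unfolding state_def N_def[symmetric] by auto
qed

lemma within_conf:
  assumes "\<And>j. j < m \<Longrightarrow> real (length (x j)) \<le> real C * s"
    and "\<And>j. j < m \<Longrightarrow> real (\<Sum>i<m. length (outgoing j (x j) i)) \<le> real C * s"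
    and "\<And>j. j < m \<Longrightarrow> real (\<Sum>i<m. length (outgoing i (x i) j)) \<le> real C * s"
    and "\<And>j w. j < m \<Longrightarrow> w \<in> set (x j) \<Longrightarrow> w < N ^ C"
    and "\<And>i j w. i < m \<Longrightarrow> j < m \<Longrightarrow> w \<in> set (outgoing i (x i) j) \<Longrightarrow> w < N ^ C"
  shows "within_resources (program final) m (real C * s) (N ^ C) (conf x)"
proof -
  have "(\<Sum>i<m. length (message (program final) m (conf x) j i)) = (\<Sum>i<m. length (outgoing j (x j) i))"
    "(\<Sum>i<m. length (message (program final) m (conf x) i j)) = (\<Sum>i<m. length (outgoing i (x i) j))"
    if "j < m" for j
    using that by (auto simp: message_conf intro!: sum.cong)
  moreover have "memory (conf x j) = x j" if "j < m" for j using that by (simp add: conf_def)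
  ultimately show ?thesis
    unfolding within_resources_def using assms by (simp add: message_conf)
qed

lemma within_halted:
  assumes "\<And>j. j < m \<Longrightarrow> real (length (x j)) \<le> real C * s"
    and "\<And>j w. j < m \<Longrightarrow> w \<in> set (x j) \<Longrightarrow> w < N ^ C"
  shows "within_resources (program final) m (real C * s) (N ^ C) (halted m x)"
proof -
  have "message (program final) m (halted m x) i j = []" for i j
    by (simp add: message_def halted_def)
  moreover have "0 \<le> real C * s" using s_ge_1 by simp
  ultimately show ?thesis
    unfolding within_resources_def using assms by (simp add: halted_def)
qed

lemma resources0: "within_resources (program final) m (real C * s) (N ^ C) (conf mem0)"
proof (rule within_conf)
  fix j assume j: "j < m"
  have "length (mem0 j) = length (inp j) * (d + k)"
    unfolding mem0_def using X_subset[OF j] length_node by (intro length_concat_const) auto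
  also have "length (inp j) = card (X j)" using distinct_inp[OF j] distinct_card by metis
  finally have "real (length (mem0 j)) = real (card (X j)) * real (d + k)" by simp
  also have "\<dots> \<le> (2 * s) * real (d + k)" using card_X[OF j] by (rule mult_right_mono) simp
  also have "\<dots> = (2 * real (d + k)) * s" by simp
  finally show "real (length (mem0 j)) \<le> real C * s" by (rule le_space) (simp add: resource_bound_def)
  have "(\<Sum>i<m. length (outgoing j (mem0 j) i)) = m * L" using j by (simp add: outgoing_mem0)
  then show "real (\<Sum>i<m. length (outgoing j (mem0 j) i)) \<le> real C * s"
    using m_L_le by (intro le_space[of _ 4]) (simp_all add: resource_bound_def)
  have "(\<Sum>i<m. length (outgoing i (mem0 i) j)) = m * L" by (simp add: outgoing_mem0)
  then show "real (\<Sum>i<m. length (outgoing i (mem0 i) j)) \<le> real C * s"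
    using m_L_le by (intro le_space[of _ 4]) (simp_all add: resource_bound_def)
  show "w < N ^ C" if w: "w \<in> set (mem0 j)" for w
  proof -
    obtain v where "v \<in> V" "w \<in> set v" using w X_subset[OF j] by (auto simp: mem0_def)
    then show ?thesis by (intro less_word[OF node_word]) auto
  qed
next
  fix i j w assume ij: "i < m" "j < m" "w \<in> set (outgoing i (mem0 i) j)"
  then obtain a where "w = card {v \<in> X i. near a v}" by (auto simp: outgoing_mem0)
  also have "\<dots> \<le> card V" using X_subset[OF ij(1)] finite_V by (intro card_mono) auto
  finally show "w < N ^ C" by (intro less_word[OF less_N]) auto
qed

lemma resources1: "within_resources (program final) m (real C * s) (N ^ C) (conf mem1)"
proof (rule within_conf)
  fix j assume j: "j < m"
  have card: "real (card (list_encode ` X j)) \<le> 2 * s"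
    using card_image_le[of "X j" list_encode] card_X[OF j] by simp
  have word: "w < N ^ C" if w: "w \<in> list_encode ` X j" for w
  proof -
    obtain v where "v \<in> V" "w = list_encode v" using w X_subset[OF j] by blast
    then show ?thesis using less_word[OF code_less] by simp
  qed
  note state_resources[OF _ _ card _ word, of 1, folded mem1_def]
  then show "real (length (mem1 j)) \<le> real C * s" "\<And>w. w \<in> set (mem1 j) \<Longrightarrow> w < N ^ C"
    by (simp_all add: resource_bound_def)
  have "real (\<Sum>i<m. length (outgoing j (mem1 j) i)) = real m * real (card (X j) div t)"
    by (simp add: outgoing_mem1)
  also have "\<dots> \<le> real m * (real (card (X j)) * real m / s)"
    using div_t_le by (rule mult_left_mono) simp
  also have "\<dots> \<le> real m * (2 * s * real m / s)"
    using card_X[OF j] s_ge_1 by (intro mult_left_mono divide_right_mono mult_right_mono) auto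
  also have "\<dots> = 2 * (real m * real m)" using s_ge_1 by simp
  also have "\<dots> \<le> 8 * s" using m_square_le by simp
  finally show "real (\<Sum>i<m. length (outgoing j (mem1 j) i)) \<le> real C * s"
    by (rule le_space) (simp add: resource_bound_def)
  have "t * (\<Sum>i<m. card (X i) div t) \<le> (\<Sum>i<m. card (X i))"
    unfolding sum_distrib_left by (intro sum_mono) simp
  also have "\<dots> = card V" using sum_card_X[of UNIV] by simp
  finally have "(\<Sum>i<m. card (X i) div t) \<le> card V div t"
    using t_pos by (simp add: less_eq_div_iff_mult_less_eq mult.commute)
  then have "(\<Sum>i<m. length (outgoing i (mem1 i) j)) \<le> m * m"
    using n_div_t_le by (simp add: outgoing_mem1)
  then have "real (\<Sum>i<m. length (outgoing i (mem1 i) j)) \<le> real (m * m)" by (simp only: of_nat_le_iff)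
  also have "\<dots> \<le> 4 * s" using m_square_le by simp
  finally show "real (\<Sum>i<m. length (outgoing i (mem1 i) j)) \<le> real C * s"
    by (rule le_space) (simp add: resource_bound_def)
next
  fix i j w assume ij: "i < m" "j < m" "w \<in> set (outgoing i (mem1 i) j)"
  have "w \<le> N ^ code_size"
    by (rule samples_le[of "X i" "key best_shift"])
      (use ij X_subset[OF ij(1)] key_less in \<open>auto simp: outgoing_mem1\<close>)
  \<comment> \<open>A sample can equal the strict upper bound of the keys, which costs one more
    power.\<close>
  also have "\<dots> < N ^ (code_size + 1)" using N_ge_2 by (intro power_strict_increasing) auto
  finally show "w < N ^ C" by (rule less_word) simp
qed

lemma resources2: "within_resources (program final) m (real C * s) (N ^ C) (conf mem2)"
proof (rule within_conf)
  fix j assume j: "j < m"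
  let ?A = "(\<lambda>v. prod_encode (dest v, list_encode v)) ` X j"
  have card: "real (card ?A) \<le> 2 * s"
    using card_image_le[of "X j" "\<lambda>v. prod_encode (dest v, list_encode v)"] card_X[OF j] by simp
  have word: "w < N ^ C" if w: "w \<in> ?A" for w
  proof -
    obtain v where v: "v \<in> V" "w = prod_encode (dest v, list_encode v)" using w X_subset[OF j] by blast
    have "w < N ^ (2 * (code_size + 1) + 1)" unfolding v(2)
      by (rule addressed_less)
        (use dest_less[of v] m_le_n weaken[OF code_less[OF v(1)], of "code_size + 1"] in auto)
    then show ?thesis by (rule less_word) simp
  qed
  note state_resources[OF _ _ card _ word, of 2, folded mem2_def]
  then show "real (length (mem2 j)) \<le> real C * s" "\<And>w. w \<in> set (mem2 j) \<Longrightarrow> w < N ^ C"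
    by (simp_all add: resource_bound_def)
  have "(\<Sum>i<m. length (outgoing j (mem2 j) i)) = (\<Sum>i<m. card (addressed_to ?A i))"
    by (simp add: outgoing_mem2 addressed_to_image)
  also have "\<dots> \<le> card ?A" by (rule card_addressed_to) simp
  finally have "real (\<Sum>i<m. length (outgoing j (mem2 j) i)) \<le> 2 * s" using card by linarith
  then show "real (\<Sum>i<m. length (outgoing j (mem2 j) i)) \<le> real C * s"
    by (rule le_space) (simp add: resource_bound_def)
  have "(\<Sum>i<m. length (outgoing i (mem2 i) j)) \<le> (\<Sum>i<m. card (X i \<inter> {v. dest v = j}))"
    by (intro sum_mono) (simp add: outgoing_mem2 Int_def card_image_le)
  also have "\<dots> = card (part j)" unfolding sum_card_X by (simp add: part_def Int_def)
  finally have "real (\<Sum>i<m. length (outgoing i (mem2 i) j)) \<le> (15 + 2 ^ d) * s"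
    using card_part[of j] by linarith
  then show "real (\<Sum>i<m. length (outgoing i (mem2 i) j)) \<le> real C * s"
    by (rule le_space) (simp add: resource_bound_def)
next
  fix i j w assume ij: "i < m" "j < m" "w \<in> set (outgoing i (mem2 i) j)"
  then show "w < N ^ C" using X_subset[OF ij(1)]
    by (auto simp: outgoing_mem2 intro!: less_word[OF code_less])
qed

lemma card_border_le: "real (card border) \<le> (2 * real d) * s"
  using card_border by simp

lemma resources3: "within_resources (program final) m (real C * s) (N ^ C) (conf mem3)"
proof (rule within_conf)
  fix j assume j: "j < m"
  have card: "real (card (list_encode ` part j)) \<le> (15 + 2 ^ d) * s"
    using card_image_le[OF finite_part, of list_encode j] card_part[of j] by linarith
  have word: "w < N ^ C" if w: "w \<in> list_encode ` part j" for w
  proof -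
    obtain v where "v \<in> V" "w = list_encode v" using w part_subset by blast
    then show ?thesis using less_word[OF code_less] by simp
  qed
  note state_resources[OF _ _ card _ word, of 3, folded mem3_def]
  then show "real (length (mem3 j)) \<le> real C * s" "\<And>w. w \<in> set (mem3 j) \<Longrightarrow> w < N ^ C"
    using finite_part by (simp_all add: resource_bound_def)
  have len: "length (outgoing i (mem3 i) l) \<le> (if l = 0 then 2 * card (local_border i) else 0)" for i l
    using card_image_le[OF card_sketch_of(1), of quad_code i] card_sketch_of[of i] by (simp add: outgoing_mem3)
  have "(\<Sum>i<m. length (outgoing j (mem3 j) i)) \<le> (\<Sum>i<m. if i = 0 then 2 * card (local_border j) else 0)"
    by (intro sum_mono len)
  also have "\<dots> \<le> 2 * card (local_border j)" by (simp add: sum.delta)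
  finally have "real (\<Sum>i<m. length (outgoing j (mem3 j) i)) \<le> (4 * real d) * s"
    using card_local_border[of j] card_border_le by linarith
  then show "real (\<Sum>i<m. length (outgoing j (mem3 j) i)) \<le> real C * s"
    by (rule le_space) (simp add: resource_bound_def algebra_simps)
  have "(\<Sum>i<m. length (outgoing i (mem3 i) j)) \<le> (\<Sum>i<m. 2 * card (local_border i))"
    by (intro sum_mono order_trans[OF len]) simp
  also have "\<dots> = 2 * card border" by (simp add: sum_distrib_left[symmetric] sum_card_local_border)
  finally have "real (\<Sum>i<m. length (outgoing i (mem3 i) j)) \<le> (4 * real d) * s"
    using card_border_le by linarith
  then show "real (\<Sum>i<m. length (outgoing i (mem3 i) j)) \<le> real C * s"
    by (rule le_space) (simp add: resource_bound_def algebra_simps)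
next
  fix i j w assume "i < m" "j < m" "w \<in> set (outgoing i (mem3 i) j)"
  then have "w \<in> quad_code ` sketch_of i" using card_sketch_of by (auto simp: outgoing_mem3 split: if_splits)
  then obtain u v x y where q: "(u, v, x, y) \<in> sketch_of i" "w = quad_code (u, v, x, y)" by auto
  show "w < N ^ C" unfolding q(2) by (rule quad_less[OF sketch_in_V[OF q(1)]])
qed

lemma resources4: "within_resources (program final) m (real C * s) (N ^ C) (conf mem4)"
proof (rule within_conf)
  fix j assume j: "j < m"
  let ?own = "(\<lambda>v. prod_encode (m, list_encode v)) ` part j"
  have stored: "card (stored_replies j) \<le> card border"
  proof (cases "j = 0")
    case True
    have "card (stored_replies j) \<le> (\<Sum>l<m. card ((\<lambda>b. prod_encode (l, reply b)) ` local_border l))"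
      unfolding stored_replies_def using True by (simp add: card_UN_le)
    also have "\<dots> \<le> (\<Sum>l<m. card (local_border l))"
      by (intro sum_mono card_image_le finite_local_border)
    finally show ?thesis by (simp add: sum_card_local_border)
  qed (simp add: stored_replies_def)
  have "card (?own \<union> stored_replies j) \<le> card (part j) + card border"
    using card_Un_le[of ?own "stored_replies j"] stored
      card_image_le[OF finite_part, of "\<lambda>v. prod_encode (m, list_encode v)" j] by linarith
  then have card: "real (card (?own \<union> stored_replies j)) \<le> (15 + 2 ^ d + 2 * real d) * s"
    using card_part[of j] card_border_le by (simp add: distrib_right)
  have word: "w < N ^ C" if w: "w \<in> ?own \<union> stored_replies j" for w
  proof -
    have "(\<exists>v\<in>V. w = prod_encode (m, list_encode v)) \<or>
        (\<exists>l<m. \<exists>b\<in>border. w = prod_encode (l, reply b))"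
      using w by (auto simp: stored_replies_def part_def local_border_def split: if_splits)
    then consider v where "v \<in> V" "w = prod_encode (m, list_encode v)"
      | l b where "l < m" "b \<in> border" "w = prod_encode (l, reply b)"
      by blast
    then show ?thesis
    proof cases
      case 1
      have "w < N ^ (2 * (code_size + 1) + 1)" unfolding 1(2)
        by (rule addressed_less) (use m_le_n weaken[OF code_less[OF 1(1)], of "code_size + 1"] in auto)
      then show ?thesis by (rule less_word) simp
    next
      case 2
      have "w < N ^ (2 * (2 * code_size + 1) + 1)" unfolding 2(3)
        by (rule addressed_less) (use m_le_n reply_less 2 in auto)
      then show ?thesis by (rule less_word) simp
    qed
  qed
  note state_resources[OF _ _ card _ word, of 4, folded mem4_def]
  then show "real (length (mem4 j)) \<le> real C * s" "\<And>w. w \<in> set (mem4 j) \<Longrightarrow> w < N ^ C"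
    using finite_part finite_stored_replies by (simp_all add: resource_bound_def algebra_simps)
  have len: "length (outgoing i (mem4 i) l) \<le> (if i = 0 then card (local_border l) else 0)" if "l < m" for i l
    using card_image_le[OF finite_local_border, of reply l] finite_local_border that
    by (simp add: outgoing_mem4)
  have "(\<Sum>i<m. length (outgoing j (mem4 j) i)) \<le> (\<Sum>i<m. card (local_border i))"
    by (intro sum_mono order_trans[OF len]) auto
  then have "real (\<Sum>i<m. length (outgoing j (mem4 j) i)) \<le> (2 * real d) * s"
    unfolding sum_card_local_border using card_border_le by linarith
  then show "real (\<Sum>i<m. length (outgoing j (mem4 j) i)) \<le> real C * s"
    by (rule le_space) (simp add: resource_bound_def algebra_simps)
  have "(\<Sum>i<m. length (outgoing i (mem4 i) j)) \<le> (\<Sum>i<m. if i = 0 then card (local_border j) else 0)"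
    by (intro sum_mono len j)
  also have "\<dots> \<le> card border" using card_local_border[of j] by (simp add: sum.delta)
  finally have "real (\<Sum>i<m. length (outgoing i (mem4 i) j)) \<le> (2 * real d) * s"
    using card_border_le by linarith
  then show "real (\<Sum>i<m. length (outgoing i (mem4 i) j)) \<le> real C * s"
    by (rule le_space) (simp add: resource_bound_def algebra_simps)
next
  fix i j w assume ij: "i < m" "j < m" "w \<in> set (outgoing i (mem4 i) j)"
  then obtain b where "b \<in> border" "w = reply b"
    using finite_local_border local_border_subset by (auto simp: outgoing_mem4 split: if_splits)
  then show "w < N ^ C" using less_word[OF reply_less] by simp
qed

lemma position_word: "v \<in> V \<Longrightarrow> w \<in> set (position d v) \<Longrightarrow> w < N ^ C"
  by (rule less_word[OF node_word[of v]]) (auto simp: position_def dest: in_set_takeD)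

text \<open>That a forest has at most as many edges as nodes comes from \<open>card_merges\<close>:
  with all nodes of the part as border, every forest edge merges two clusters that meet it.\<close>

lemma card_forest_edges: "real (card (forest_edges j)) \<le> (15 + 2 ^ d + 2 * real d) * s"
proof -
  have fin: "finite (local_edges j)" using finite_edges local_edges_subset finite_subset by blast
  have "e \<in> merges (part j) (local_edges j)" if e: "e \<in> msf (local_edges j)" for e
  proof -
    obtain u v where uv: "e = {u, v}" "e \<in> local_edges j" "(u, v) \<notin> conn (below (local_edges j) e)"
      using e unfolding msf_def by blast
    then have "u \<in> part j" "v \<in> part j"
      using edgesD(1,2)[of u v] by (auto simp: local_edges_def part_def)
    then show ?thesis unfolding merges_def using uv by blast
  qed
  then have sub: "msf (local_edges j) \<subseteq> merges (part j) (local_edges j)" by blast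
  have "finite e" if "e \<in> local_edges j" for e
    using that by (intro finite_edge) (simp add: local_edges_def)
  note M = card_merges[OF finite_part[of j] this, of "local_edges j"]
  have "card (msf (local_edges j) - merges (local_border j) (local_edges j)) \<le> card (part j)"
    using M sub card_mono[of "merges (part j) (local_edges j)"] by (meson Diff_subset le_trans subset_trans)
  moreover have "card (if j = 0 then global_msf sketches border_edges else {}) \<le> card border"
    using card_global_msf by simp
  ultimately have "card (forest_edges j) \<le> card (part j) + card border"
    unfolding forest_edges_def by (meson add_mono card_Un_le le_trans)
  then show ?thesis using card_part[of j] card_border_le by (simp add: distrib_right)
qed

lemma resources_forest: "within_resources (program final) m (real C * s) (N ^ C) (halted m forest_output)"
proof (rule within_halted)
  fix j assume j: "j < m"
  let ?rec = "\<lambda>(u, v). position d u @ position d v"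
  have fin: "finite (ends ` forest_edges j)" using finite_forest_edges[OF j] by simp
  have ends: "fst p \<in> V \<and> snd p \<in> V" if "p \<in> ends ` forest_edges j" for p
    using that ends_edge(1,2) forest_edges_subset[OF j] by blast
  have "length (forest_output j) = card (ends ` forest_edges j) * (2 * d)"
  proof -
    have len: "length x = 2 * d" if x: "x \<in> set (map ?rec (enum (ends ` forest_edges j)))" for x
    proof -
      obtain p where "p \<in> ends ` forest_edges j" "x = ?rec p" using x fin by auto
      then show ?thesis using ends[of p] length_position by (simp add: case_prod_beta)
    qed
    have "length (forest_output j) = length (map ?rec (enum (ends ` forest_edges j))) * (2 * d)"
      unfolding forest_output_def by (rule length_concat_const) (erule len)
    then show ?thesis using fin by simp
  qed
  also have "\<dots> \<le> card (forest_edges j) * (2 * d)"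
    using card_image_le[OF finite_forest_edges[OF j], of ends] by (rule mult_le_mono1)
  finally have "real (length (forest_output j)) \<le> real (card (forest_edges j) * (2 * d))"
    by (simp only: of_nat_le_iff)
  also have "\<dots> \<le> ((15 + 2 ^ d + 2 * real d) * s) * (2 * real d)"
    using card_forest_edges[of j] by (simp add: mult_right_mono)
  also have "\<dots> = (2 * real d * (15 + 2 ^ d + 2 * real d)) * s" by simp
  finally show "real (length (forest_output j)) \<le> real C * s"
    by (rule le_space) (simp add: resource_bound_def algebra_simps)
  show "w < N ^ C" if w: "w \<in> set (forest_output j)" for w
  proof -
    have "\<exists>p\<in>ends ` forest_edges j. w \<in> set (?rec p)"
      using w fin unfolding forest_output_def by simp
    then obtain p where p: "p \<in> ends ` forest_edges j" "w \<in> set (?rec p)" by blast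
    then have "w \<in> set (position d (fst p)) \<or> w \<in> set (position d (snd p))"
      by (simp add: case_prod_beta)
    then show ?thesis using ends[OF p(1)] position_word by auto
  qed
qed

lemma resources_component: "within_resources (program final) m (real C * s) (N ^ C) (halted m component_output)"
proof (rule within_halted)
  fix j assume j: "j < m"
  have lV: "label_node v \<in> V" if "v \<in> V" for v using conn_in_V[OF conn_label_node that] .
  let ?rec = "\<lambda>v. position d v @ position d (label_node v)"
  have len: "length x = 2 * d" if x: "x \<in> set (map ?rec (enum (part j)))" for x
  proof -
    obtain v where v: "v \<in> part j" "x = ?rec v" using x finite_part by auto
    then have "v \<in> V" by (simp add: part_def)
    then show ?thesis using v(2) lV length_position by simp
  qed
  have "length (component_output j) = length (map ?rec (enum (part j))) * (2 * d)"
    unfolding component_output_def by (rule length_concat_const) (erule len)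
  then have "real (length (component_output j)) = real (card (part j)) * (2 * real d)"
    using finite_part by simp
  also have "\<dots> \<le> ((15 + 2 ^ d) * s) * (2 * real d)"
    using card_part[of j] by (rule mult_right_mono) simp
  also have "\<dots> = (2 * real d * (15 + 2 ^ d)) * s" by simp
  finally show "real (length (component_output j)) \<le> real C * s"
    by (rule le_space) (simp add: resource_bound_def algebra_simps)
  show "w < N ^ C" if w: "w \<in> set (component_output j)" for w
  proof -
    obtain v where v: "v \<in> part j" "w \<in> set (?rec v)"
      using w finite_part unfolding component_output_def by auto
    then have "v \<in> V" by (simp add: part_def)
    then show ?thesis using v(2) lV position_word by auto
  qed
qed

section \<open>The complete runs\<close>

lemma compute_program: "compute (program final) j x y = return_pmf (next_state final j x y)"
  by (simp add: program_def)

lemma conf_not_halted: "\<not> all_halted m (conf x)"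
  unfolding all_halted_def conf_def using m_pos by (auto intro!: exI[of _ 0])

lemma initial_conf: "initial_configuration m inp = conf mem0"
  unfolding initial_configuration_def conf_def mem0_def ..

theorem las_vegas_forest:
  assumes "p \<le> 1"
  shows "las_vegas (program forest_final) m (real C * s) (N ^ C) 4 p
    (initial_configuration m inp) (outputs_minimum_spanning_forest d sem G m)"
proof -
  \<comment> \<open>Beyond the end of the list \<open>nth\<close> is unspecified, but
    \<open>las_vegas_deterministic\<close> inspects \<open>cfg\<close> only up to
    \<open>T\<close>.\<close>
  define cfg where "cfg = nth [conf mem0, conf mem1, conf mem2, conf mem3, halted m forest_output]"
  have cfg: "cfg 0 = conf mem0" "cfg 1 = conf mem1" "cfg 2 = conf mem2" "cfg 3 = conf mem3"
    "cfg 4 = halted m forest_output"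
    by (simp_all add: cfg_def)
  have less: "t < 4 \<longleftrightarrow> t = 0 \<or> t = 1 \<or> t = 2 \<or> t = 3" and le: "t \<le> 4 \<longleftrightarrow> t < 4 \<or> t = 4" for t :: nat
    by auto
  have "las_vegas (program forest_final) m (real C * s) (N ^ C) 4 p (cfg 0)
      (outputs_minimum_spanning_forest d sem G m)"
  proof (rule las_vegas_deterministic[where T = 4, OF compute_program])
    fix t j :: nat assume t: "t < 4" and j: "j < m"
    have "conf x j = Running (x j)" "halted m y j = Halted (y j)" for x y
      using j by (simp_all add: conf_def halted_def)
    then show "cfg (Suc t) j = (case cfg t j of
        Running x \<Rightarrow> next_state forest_final j x (\<lambda>i. message (program forest_final) m (cfg t) i j)
      | Halted x \<Rightarrow> Halted x)"
      using t step0[OF j] step1[OF j] step2[OF j] step3 step3_forest[OF j] cfg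
      unfolding less by (elim disjE) (simp_all add: eval_nat_numeral)
  next
    fix t j :: nat assume "t \<le> 4" "m \<le> j"
    then show "cfg t j = Halted []" unfolding le less using cfg
      by (elim disjE) (simp_all add: conf_def halted_def)
  next
    show "all_halted m (cfg 4)" by (simp add: cfg all_halted_def halted_def)
  next
    fix t assume "t < (4 :: nat)"
    then show "\<not> all_halted m (cfg t)" unfolding less using cfg conf_not_halted by (elim disjE) simp_all
  next
    fix t assume "t \<le> (4 :: nat)"
    then show "within_resources (program forest_final) m (real C * s) (N ^ C) (cfg t)"
      unfolding le less using cfg resources0 resources1 resources2 resources3 resources_forest
      by (elim disjE) simp_all
  next
    show "outputs_minimum_spanning_forest d sem G m (cfg 4)" using forest_correct by (simp add: cfg)
  qed (use assms in auto)
  then show ?thesis by (simp add: initial_conf cfg)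
qed

theorem las_vegas_components:
  assumes "p \<le> 1"
  shows "las_vegas (program component_final) m (real C * s) (N ^ C) 5 p
    (initial_configuration m inp) (outputs_components d sem G m)"
proof -
  define cfg where
    "cfg = nth [conf mem0, conf mem1, conf mem2, conf mem3, conf mem4, halted m component_output]"
  have cfg: "cfg 0 = conf mem0" "cfg 1 = conf mem1" "cfg 2 = conf mem2" "cfg 3 = conf mem3"
    "cfg 4 = conf mem4" "cfg 5 = halted m component_output"
    by (simp_all add: cfg_def)
  have less: "t < 5 \<longleftrightarrow> t = 0 \<or> t = 1 \<or> t = 2 \<or> t = 3 \<or> t = 4"
    and le: "t \<le> 5 \<longleftrightarrow> t < 5 \<or> t = 5" for t :: nat
    by auto
  have step4: "next_state final j (mem4 j) y = final (mem4 j) y" for final j y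
    by (simp add: next_state_def content_mem4)
  have "las_vegas (program component_final) m (real C * s) (N ^ C) 5 p (cfg 0)
      (outputs_components d sem G m)"
  proof (rule las_vegas_deterministic[where T = 5, OF compute_program])
    fix t j :: nat assume t: "t < 5" and j: "j < m"
    have "conf x j = Running (x j)" "halted m y j = Halted (y j)" for x y
      using j by (simp_all add: conf_def halted_def)
    then show "cfg (Suc t) j = (case cfg t j of
        Running x \<Rightarrow> next_state component_final j x (\<lambda>i. message (program component_final) m (cfg t) i j)
      | Halted x \<Rightarrow> Halted x)"
      using t step0[OF j] step1[OF j] step2[OF j] step3 step4 step3_component[OF j] step4_component[OF j] cfg
      unfolding less by (elim disjE) (simp_all add: eval_nat_numeral)
  next
    fix t j :: nat assume "t \<le> 5" "m \<le> j"
    then show "cfg t j = Halted []" unfolding le less using cfg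
      by (elim disjE) (simp_all add: conf_def halted_def)
  next
    show "all_halted m (cfg 5)" by (simp add: cfg all_halted_def halted_def)
  next
    fix t assume "t < (5 :: nat)"
    then show "\<not> all_halted m (cfg t)" unfolding less using cfg conf_not_halted by (elim disjE) simp_all
  next
    fix t assume "t \<le> (5 :: nat)"
    then show "within_resources (program component_final) m (real C * s) (N ^ C) (cfg t)"
      unfolding le less
      using cfg resources0 resources1 resources2 resources3 resources4 resources_component
      by (elim disjE) simp_all
  next
    show "outputs_components d sem G m (cfg 5)" using components_correct by (simp add: cfg)
  qed (use assms in auto)
  then show ?thesis by (simp add: initial_conf cfg)
qed

end

lemma grid_runI:
  assumes "2 \<le> d" "max ((real d + 1) / (real d + 2)) (4 / 5) < \<alpha>" "\<alpha> < 1"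
    and "implicit_grid_graph d c k K sem G" "1 \<le> c"
    and c: "real c \<le> memory_scale \<alpha> (card (nodes G)) powr (1 / real (d ^ 3))"
    and "evenly_distributed (num_machines \<alpha> (card (nodes G))) (nodes G) inp"
  shows "grid_run d k K \<alpha> sem G c inp"
proof -
  \<comment> \<open>For the empty graph \<open>s\<close> is 0, and so is the bound on
    \<open>c\<close>, which contradicts \<open>1 \<le> c\<close>.\<close>
  have "card (nodes G) \<noteq> 0"
  proof
    assume "card (nodes G) = 0"
    then show False using c assms(5) by (simp add: memory_scale_def)
  qed
  then show ?thesis using assms by unfold_locales auto
qed

theorem theorem17:
  fixes d k K :: nat and \<alpha> :: real
  assumes "2 \<le> d"
    and "max ((real d + 1) / (real d + 2)) (4 / 5) < \<alpha>" and "\<alpha> < 1"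
  shows "(\<exists>C R \<gamma>. 0 < \<gamma> \<and>
            (\<forall>sem. \<exists>alg. solves_grid_problem d k K \<alpha> sem C R \<gamma> alg outputs_components)) \<and>
         (\<exists>C R \<gamma>. 0 < \<gamma> \<and>
            (\<forall>sem. \<exists>alg. solves_grid_problem d k K \<alpha> sem C R \<gamma> alg
                             outputs_minimum_spanning_forest))"
proof
  let ?C = "resource_bound d k K"
  have "solves_grid_problem d k K \<alpha> sem ?C 5 1
      (\<lambda>n c r. grid_program.program d k K \<alpha> sem n c r (grid_program.component_final d K \<alpha> sem n c r))
      outputs_components" for sem
    unfolding solves_grid_problem_def
  proof (intro allI impI, elim conjE)
    fix G c inp n s m
    assume A: "n = card (nodes G)" "s = memory_scale \<alpha> n" "m = num_machines \<alpha> n"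
      "implicit_grid_graph d c k K sem G" "1 \<le> c" "real c \<le> s powr (1 / real (d ^ 3))"
      "evenly_distributed m (nodes G) inp"
    interpret grid_run d k K \<alpha> sem G c inp
      using assms A by (intro grid_runI) auto
    \<comment> \<open>The program halts within the given rounds with probability 1, so any target
      probability up to 1 is met and the exponent 1 is an arbitrary positive choice.\<close>
    have "1 - 1 / real n powr 1 \<le> 1" by simp
    from las_vegas_components[OF this]
    show "las_vegas (grid_program.program d k K \<alpha> sem n c (edge_rule G)
        (grid_program.component_final d K \<alpha> sem n c (edge_rule G))) m (real ?C * s)
        ((n + 1) ^ ?C) 5 (1 - 1 / real n powr 1) (initial_configuration m inp)
        (outputs_components d sem G m)"
      unfolding N_def A(1-3) .
  qed
  then show "\<exists>C R \<gamma>. 0 < \<gamma> \<and>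
      (\<forall>sem. \<exists>alg. solves_grid_problem d k K \<alpha> sem C R \<gamma> alg outputs_components)"
    by (intro exI[of _ ?C] exI[of _ 5] exI[of _ 1]) auto
  have "solves_grid_problem d k K \<alpha> sem ?C 4 1
      (\<lambda>n c r. grid_program.program d k K \<alpha> sem n c r (grid_program.forest_final d \<alpha> sem n c r))
      outputs_minimum_spanning_forest" for sem
    unfolding solves_grid_problem_def
  proof (intro allI impI, elim conjE)
    fix G c inp n s m
    assume A: "n = card (nodes G)" "s = memory_scale \<alpha> n" "m = num_machines \<alpha> n"
      "implicit_grid_graph d c k K sem G" "1 \<le> c" "real c \<le> s powr (1 / real (d ^ 3))"
      "evenly_distributed m (nodes G) inp"
    interpret grid_run d k K \<alpha> sem G c inp
      using assms A by (intro grid_runI) auto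
    have "1 - 1 / real n powr 1 \<le> 1" by simp
    from las_vegas_forest[OF this]
    show "las_vegas (grid_program.program d k K \<alpha> sem n c (edge_rule G)
        (grid_program.forest_final d \<alpha> sem n c (edge_rule G))) m (real ?C * s)
        ((n + 1) ^ ?C) 4 (1 - 1 / real n powr 1) (initial_configuration m inp)
        (outputs_minimum_spanning_forest d sem G m)"
      unfolding N_def A(1-3) .
  qed
  then show "\<exists>C R \<gamma>. 0 < \<gamma> \<and>
      (\<forall>sem. \<exists>alg. solves_grid_problem d k K \<alpha> sem C R \<gamma> alg
                       outputs_minimum_spanning_forest)"
    by (intro exI[of _ ?C] exI[of _ 4] exI[of _ 1]) auto
qed

end
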